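(* Let $n$ be a positive integer, $R=\mathbb C\,C_2=\mathbb C[z]/\langle z^2-1\rangle$, and let $X_n$ be the set of transpositions in $S_n$. Let $\mu=[1,z]\in Z^2(S_n,C_2)$ be the cocycle defined in the context. 1. The algebra $\mathcal B(RX_n,q_z)$ is the cocycle extension of $\mathcal B(X_n,q_1)$ by the cocycle $\mu\in Z^2(S_n,C_2)$, and is also the cocycle extension of $\mathcal B(X_n,q_{-1})$ by the cocycle $\mu\cdot(\mu|_{z=-1})\in Z^2(S_n,R^\times)$. 2. $\mathcal B(RX_n,q_z)$ is a $C_2$-flat deformation of both $\mathcal B(X_n,q_1)$ and $\mathcal B(X_n,q_{-1})$, in particular a free $R$-module. One has $$\mathcal B(RX_n,q_z)|_{z=1}=\mathcal B(X_n,q_1),\qquad \mathcal B(RX_n,q_z)|_{z=-1}=\mathcal B(X_n,q_{-1}),$$ hence $$\mathcal B(RX_n,q_z)\cong \tfrac{1+z}{2}\,\mathcal B(X_n,q_1)\oplus \tfrac{1-z}{2}\,\mathcal B(X_n,q_{-1})$$ as a direct sum of two-sided ideals.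
   Context: $C_2=\{1,z\}$ is the group of order $2$. $Z^2(G,\Gamma)$ denotes normalised $2$-cocycles: $\mu(g,h)\mu(gh,k)=\mu(g,hk)\mu(h,k)$, $\mu(1,g)=\mu(g,1)=1$. The functions $q_1,q_{-1},q_z$. For $\varepsilon\in\{1,-1,z\}$, $q_\varepsilon\colon S_n\times X_n\to R^\times$ (with values in $\{\pm1\}$ when $\varepsilon=\pm1$) is the unique function satisfying $q(\rho\sigma,\tau)=q(\rho,\sigma\tau\sigma^{-1})q(\sigma,\tau)$ for $\rho,\sigma\in S_n,\tau\in X_n$, such that for $\sigma\in X_n$ and $i<j$: $q_\varepsilon(\sigma,(i\,j))=\varepsilon$ if $\sigma(i)<\sigma(j)$ and $=-1$ if $\sigma(i)>\sigma(j)$. Nichols algebras. Over $K=\mathbb C$ (for $q=q_{\pm1}$) or $K=R$ (for $q=q_z$), let $KX_n$ be the free $K$-module with basis $\{e_\tau:\tau\in X_n\}$; it is $S_n$-graded with $e_\tau$ of degree $\tau$, has $S_n$-action $\sigma\triangleright e_\tau=q(\sigma,\tau)e_{\sigma\tau\sigma^{-1}}$, and braiding $\Psi(e_\tau\otimes e_\upsilon)=q(\tau,\upsilon)e_{\tau\upsilon\tau^{-1}}\otimes e_\tau$. The algebra $\mathcal B(KX_n,q)$ is $T_K(KX_n)/\bigoplus_m\ker[m]!_\Psi$, where $[m]!_\Psi=\sum_{\sigma\in S_m}\Psi_\sigma$, $\Psi_\sigma=\Psi_{i_1,i_1+1}\cdots\Psi_{i_l,i_l+1}$ for a reduced expression $\sigma=s_{i_1}\cdots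 s_{i_l}$. Write $\mathcal B(X_n,q_{\pm1})$ when $K=\mathbb C$. It is $S_n$-graded. The cocycle $[1,z]$. Let $T_n$ be the group generated by $t_1,\dots,t_{n-1},z$ with relations $t_i^2=1$, $z^2=1$, $zt_i=t_iz$, $t_jt_{j+1}t_j=t_{j+1}t_jt_{j+1}$, $t_kt_l=z\,t_lt_k$ for $k<l-1$. It is a central extension of $S_n$ by $C_2$ via $t_i\mapsto(i\ i+1)$, $z\mapsto1$. Let $T\colon S_n\to T_n$ be a set-theoretic section with $T(1)=1$, $T((i\ i+1))=t_i$, and $T((i\ j+1))=z\,t_jT((i\ j))t_j^{-1}$ for $i<j$ (on other elements of $S_n$ the section is any fixed choice). Then $[1,z](g,h)=T(g)T(h)T(gh)^{-1}\in C_2$. Consequently (Vendramin) for transpositions $\sigma$ and $\tau=(i\,j)$, $i<j$: $T(\sigma)T(\tau)T(\sigma)^{-1}=\chi(\sigma,\tau)T(\sigma\tau\sigma^{-1})$ with $\chi(\sigma,\tau)=z$ if $\sigma(i)<\sigma(j)$ and $1$ otherwise. $\mu|_{z=-1}$ is the $\{\pm1\}$-valued cocycle obtained by substituting $z=-1$. Cocycle extension. For an $S_n$-graded $\mathbb C$-algebra $A$ and $\nu\in Z^2(S_n,R^\times)$, the cocycle extension of $A$ by $\nu$ is the $R$-algebra $R\otimes_{\mathbb C}A$ with product $a\star b=\nu(g,h)ab$ for $a,b$ of degrees $g,h$. Here "is the cocycle extension" means isomorphic via the identity on the generators $e_\tau$. Specialisation and flatness. For an $R$-algebra $B$ and $q=\pm1$,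 $B|_{z=q}=B/(z-q)B$. "$C_2$-flat deformation of both" means that $B$ is a free $R$-module whose specialisation at $z=1$, respectively at $z=-1$, is isomorphic to the stated algebra. *)

theory Defs
  imports
    "HOL.Complex"
    "HOL-Library.Poly_Mapping"
    "HOL-Library.Z2"
    "HOL-Library.FuncSet"
    "HOL-Combinatorics.Transposition"
    "HOL-Algebra.Sym_Groups"
    "HOL-Algebra.QuotRing"
    "HOL-Algebra.Module"
    "HOL-Algebra.Chinese_Remainder"
    "HOL-Algebra.Algebraic_Closure_Type"
begin

type_synonym perm = "nat \<Rightarrow> nat"

section \<open>The group algebra of the group of order two\<close>

text \<open>The multiplication of \<^typ>\<open>'a \<Rightarrow>\<^sub>0 'b\<close> is convolution with respect to addition on
  \<^typ>\<open>'a\<close>, so this is the group algebra of the additive group of \<^typ>\<open>bit\<close>, that is,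
  \<open>\<complex>[z]/(z\<^sup>2 - 1)\<close> where \<open>z\<close> is the basis element at the nontrivial group element.\<close>

type_synonym CC2 = "bit \<Rightarrow>\<^sub>0 complex"

definition group_elt :: "bit \<Rightarrow> CC2"
  where "group_elt d = Poly_Mapping.single d 1"

definition zR :: CC2
  where "zR = group_elt 1"

definition const :: "complex \<Rightarrow> CC2"
  where "const c = Poly_Mapping.single 0 c"

text \<open>Substitution of a complex number (to be used with \<open>\<plusminus>1\<close>) for \<open>z\<close>.\<close>

definition subst_z :: "complex \<Rightarrow> CC2 \<Rightarrow> complex"
  where "subst_z c r = Poly_Mapping.lookup r 0 + c * Poly_Mapping.lookup r 1"

definition idem_plus :: CC2
  where "idem_plus = const (1/2) * (1 + zR)"

definition idem_minus :: CC2
  where "idem_minus = const (1/2) * (1 - zR)"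

definition C2 :: "CC2 monoid"
  where "C2 = \<lparr>carrier = {1, zR}, monoid.mult = (*), one = 1\<rparr>"

section \<open>Algebras over a commutative ring\<close>

text \<open>A not necessarily commutative algebra over the commutative ring \<^typ>\<open>'k\<close> is represented by a
  record of type \<^typ>\<open>('k, 'b) module\<close>, which has both a multiplication and a scalar
  multiplication. (The locale \<^locale>\<open>algebra\<close> of the library is restricted to commutative
  algebras.)\<close>

definition alg_iso :: "('k, 'a) module \<Rightarrow> ('k, 'b) module \<Rightarrow> ('a \<Rightarrow> 'b) set"
  where "alg_iso A B = {\<psi> \<in> ring_iso A B.
     \<forall>k. \<forall>x \<in> carrier A. \<psi> (k \<odot>\<^bsub>A\<^esub> x) = k \<odot>\<^bsub>B\<^esub> \<psi> x}"

text \<open>Isomorphic via the identity on generators: \<open>a\<close> and \<open>b\<close> are the families of generators,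
  indexed by \<open>S\<close>.\<close>

definition gen_iso :: "'x set \<Rightarrow> ('k, 'a) module \<Rightarrow> ('x \<Rightarrow> 'a) \<Rightarrow> ('k, 'b) module \<Rightarrow> ('x \<Rightarrow> 'b) \<Rightarrow> bool"
  where "gen_iso S A a B b \<longleftrightarrow> (\<exists>\<psi> \<in> alg_iso A B. \<forall>x \<in> S. \<psi> (a x) = b x)"

definition quot_alg :: "('k, 'b) module \<Rightarrow> 'b set \<Rightarrow> ('k, 'b set) module"
  where "quot_alg A I =
    ring.extend (A Quot I) (module.fields (\<lambda>k C. \<Union>a\<in>C. I +>\<^bsub>A\<^esub> (k \<odot>\<^bsub>A\<^esub> a)))"

definition dsum_alg :: "('k, 'a) module \<Rightarrow> ('k, 'b) module \<Rightarrow> ('k, 'a \<times> 'b) module"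
  where "dsum_alg A B =
    ring.extend (RDirProd A B) (module.fields (\<lambda>k (x, y). (k \<odot>\<^bsub>A\<^esub> x, k \<odot>\<^bsub>B\<^esub> y)))"

definition free_module :: "('k::comm_ring_1, 'b) module \<Rightarrow> bool"
  where "free_module M \<longleftrightarrow>
    module (ring_of_type_algebra :: 'k ring) M \<and>
    (\<exists>E \<subseteq> carrier M. \<forall>x \<in> carrier M.
      \<exists>!c. finite {e. c e \<noteq> 0} \<and> {e. c e \<noteq> 0} \<subseteq> E \<and>
           x = (\<Oplus>\<^bsub>M\<^esub>e\<in>{e. c e \<noteq> 0}. c e \<odot>\<^bsub>M\<^esub> e))"

text \<open>The set \<open>rA\<close>; it is a two-sided ideal since scalars are central.\<close>

definition scalar_ideal :: "'k \<Rightarrow> ('k, 'b) module \<Rightarrow> 'b set"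
  where "scalar_ideal r A = (\<lambda>a. r \<odot>\<^bsub>A\<^esub> a) ` carrier A"

text \<open>For an idempotent scalar \<open>e\<close>, the ideal \<open>eA\<close> as an algebra with unit \<open>e\<close>.\<close>

definition idem_part :: "'k \<Rightarrow> ('k, 'b) module \<Rightarrow> ('k, 'b) module"
  where "idem_part e A = A\<lparr>carrier := scalar_ideal e A, one := e \<odot>\<^bsub>A\<^esub> \<one>\<^bsub>A\<^esub>\<rparr>"

definition ideal_direct_sum :: "('k, 'b) module \<Rightarrow> 'b set \<Rightarrow> 'b set \<Rightarrow> bool"
  where "ideal_direct_sum A I J \<longleftrightarrow>
    ideal I A \<and> ideal J A \<and> I \<inter> J = {\<zero>\<^bsub>A\<^esub>} \<and> I <+>\<^bsub>A\<^esub> J = carrier A"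

section \<open>Specialisation and flatness\<close>

definition restrict_scalars :: "('l \<Rightarrow> 'k) \<Rightarrow> ('k, 'b) module \<Rightarrow> ('l, 'b) module"
  where "restrict_scalars f A = ring.extend (ring.truncate A) (module.fields (\<lambda>l x. f l \<odot>\<^bsub>A\<^esub> x))"

text \<open>\<open>B/(z - c)B\<close>, as an algebra over the complex numbers, and the projection onto it.\<close>

definition specialise :: "complex \<Rightarrow> (CC2, 'b) module \<Rightarrow> (complex, 'b set) module"
  where "specialise c B = restrict_scalars const (quot_alg B (scalar_ideal (zR - const c) B))"

definition specialise_proj :: "complex \<Rightarrow> (CC2, 'b) module \<Rightarrow> 'b \<Rightarrow> 'b set"
  where "specialise_proj c B b = scalar_ideal (zR - const c) B +>\<^bsub>B\<^esub> b"

definition C2_flat_deformation ::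
  "(CC2, 'b) module \<Rightarrow> (complex, 'a) module \<Rightarrow> (complex, 'c) module \<Rightarrow> bool"
  where "C2_flat_deformation B A A' \<longleftrightarrow>
    free_module B \<and> alg_iso (specialise 1 B) A \<noteq> {} \<and> alg_iso (specialise (-1) B) A' \<noteq> {}"

section \<open>Cocycles and cocycle extensions\<close>

definition cocycles2 :: "'g monoid \<Rightarrow> 'c monoid \<Rightarrow> ('g \<Rightarrow> 'g \<Rightarrow> 'c) set"
  where "cocycles2 G \<Gamma> = {\<mu>.
     (\<forall>g \<in> carrier G. \<forall>h \<in> carrier G. \<mu> g h \<in> carrier \<Gamma>) \<and>
     (\<forall>g \<in> carrier G. \<forall>h \<in> carrier G. \<forall>k \<in> carrier G.
        \<mu> g h \<otimes>\<^bsub>\<Gamma>\<^esub> \<mu> (g \<otimes>\<^bsub>G\<^esub> h) k = \<mu> g (h \<otimes>\<^bsub>G\<^esub> k) \<otimes>\<^bsub>\<Gamma>\<^esub> \<mu> h k) \<and>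
     (\<forall>g \<in> carrier G. \<mu> \<one>\<^bsub>G\<^esub> g = \<one>\<^bsub>\<Gamma>\<^esub> \<and> \<mu> g \<one>\<^bsub>G\<^esub> = \<one>\<^bsub>\<Gamma>\<^esub>)}"

text \<open>The family of homogeneous components of \<open>a\<close> in an algebra graded by a finite group \<open>G\<close>,
  where \<open>Gr g\<close> is the set of elements of degree \<open>g\<close>.\<close>

definition comp_family :: "'g monoid \<Rightarrow> ('g \<Rightarrow> 'b set) \<Rightarrow> ('k, 'b) module \<Rightarrow> 'b \<Rightarrow> 'g \<Rightarrow> 'b"
  where "comp_family G Gr A a = (THE d. d \<in> (\<Pi>\<^sub>E g\<in>carrier G. Gr g) \<and>
     a = (\<Oplus>\<^bsub>A\<^esub>g\<in>carrier G. d g))"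

text \<open>The scalar extension \<open>R \<otimes> A\<close> of a complex algebra, where \<open>R\<close> is \<^typ>\<open>CC2\<close>: since \<open>R\<close> has basis
  \<open>{1, z}\<close>, its elements are the sums of \<open>group_elt d \<otimes> f d\<close> over all \<open>d\<close> for unique functions
  \<open>f :: bit \<Rightarrow> 'b\<close>, by which they are represented.\<close>

definition pure :: "(complex, 'b) module \<Rightarrow> CC2 \<Rightarrow> 'b \<Rightarrow> (bit \<Rightarrow> 'b)"
  where "pure A r a = (\<lambda>d. Poly_Mapping.lookup r d \<odot>\<^bsub>A\<^esub> a)"

definition base_change :: "(complex, 'b) module \<Rightarrow> (CC2, bit \<Rightarrow> 'b) module"
  where "base_change A = \<lparr>
     carrier = {f. \<forall>d. f d \<in> carrier A},
     monoid.mult = (\<lambda>f f' c. \<Oplus>\<^bsub>A\<^esub>d\<in>UNIV. f d \<otimes>\<^bsub>A\<^esub> f' (c - d)),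
     one = pure A 1 \<one>\<^bsub>A\<^esub>,
     ring.zero = (\<lambda>c. \<zero>\<^bsub>A\<^esub>),
     add = (\<lambda>f f' c. f c \<oplus>\<^bsub>A\<^esub> f' c),
     module.smult = (\<lambda>r f c. \<Oplus>\<^bsub>A\<^esub>d\<in>UNIV. Poly_Mapping.lookup r d \<odot>\<^bsub>A\<^esub> f (c - d))\<rparr>"

text \<open>The product of \<open>r \<otimes> a\<close> and \<open>s \<otimes> b\<close>, with \<open>a\<close> and \<open>b\<close> of degrees \<open>g\<close> and \<open>h\<close>, becomes
  \<open>r s \<nu>(g,h) \<otimes> ab\<close>, extended biadditively.\<close>

definition cocycle_ext :: "'g monoid \<Rightarrow> ('g \<Rightarrow> 'b set) \<Rightarrow> ('g \<Rightarrow> 'g \<Rightarrow> CC2) \<Rightarrow>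
    (complex, 'b) module \<Rightarrow> (CC2, bit \<Rightarrow> 'b) module"
  where "cocycle_ext G Gr \<nu> A = (base_change A)\<lparr>monoid.mult := (\<lambda>f f'.
     \<Oplus>\<^bsub>base_change A\<^esub>g\<in>carrier G. \<Oplus>\<^bsub>base_change A\<^esub>h\<in>carrier G. \<Oplus>\<^bsub>base_change A\<^esub>d\<in>UNIV. \<Oplus>\<^bsub>base_change A\<^esub>e\<in>UNIV.
       pure A (group_elt d * group_elt e * \<nu> g h)
         (comp_family G Gr A (f d) g \<otimes>\<^bsub>A\<^esub> comp_family G Gr A (f' e) h))\<rparr>"

section \<open>The functions \<open>q\<close>\<close>

definition transpositions :: "nat \<Rightarrow> perm set"
  where "transpositions n = {transpose i j | i j. 1 \<le> i \<and> i < j \<and> j \<le> n}"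

definition conj_perm :: "perm \<Rightarrow> perm \<Rightarrow> perm"
  where "conj_perm \<sigma> \<tau> = \<sigma> \<circ> \<tau> \<circ> inv' \<sigma>"

text \<open>The function exists and is unique for \<open>\<epsilon> \<in> {1, -1, z}\<close>. Permutations are composed as functions, and
  the invertible elements of \<^typ>\<open>'k\<close> are the divisors of \<open>1\<close>.\<close>

definition qfun :: "nat \<Rightarrow> 'k::comm_ring_1 \<Rightarrow> perm \<times> perm \<Rightarrow> 'k"
  where "qfun n \<epsilon> = (THE q.
     q \<in> carrier (sym_group n) \<times> transpositions n \<rightarrow>\<^sub>E {u. u dvd 1} \<and>
     (\<forall>\<rho> \<in> carrier (sym_group n). \<forall>\<sigma> \<in> carrier (sym_group n). \<forall>\<tau> \<in> transpositions n.
        q (\<rho> \<circ> \<sigma>, \<tau>) = q (\<rho>, conj_perm \<sigma> \<tau>) * q (\<sigma>, \<tau>)) \<and>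
     (\<forall>\<sigma> \<in> transpositions n. \<forall>i j. 1 \<le> i \<and> i < j \<and> j \<le> n \<longrightarrow>
        q (\<sigma>, transpose i j) = (if \<sigma> i < \<sigma> j then \<epsilon> else - 1)))"

section \<open>Nichols algebras\<close>

definition scale :: "'k::comm_ring_1 \<Rightarrow> ('a \<Rightarrow>\<^sub>0 'k) \<Rightarrow> ('a \<Rightarrow>\<^sub>0 'k)"
  where "scale k f = Poly_Mapping.map ((*) k) f"

definition lin_ext :: "('a \<Rightarrow> ('b \<Rightarrow>\<^sub>0 'k)) \<Rightarrow> ('a \<Rightarrow>\<^sub>0 'k) \<Rightarrow> ('b \<Rightarrow>\<^sub>0 'k::comm_ring_1)"
  where "lin_ext F f = (\<Sum>w\<in>Poly_Mapping.keys f. scale (Poly_Mapping.lookup f w) (F w))"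

text \<open>The tensor algebra of the free module with basis \<open>S\<close>: the word \<open>[x\<^sub>1, \<dots>, x\<^sub>m]\<close> stands for the
  basis element \<open>e\<^bsub>x\<^sub>1\<^esub> \<otimes> \<dots> \<otimes> e\<^bsub>x\<^sub>m\<^esub>\<close>.\<close>

definition tensor_alg :: "'x set \<Rightarrow> ('k::comm_ring_1, 'x list \<Rightarrow>\<^sub>0 'k) module"
  where "tensor_alg S = \<lparr>
     carrier = {f. Poly_Mapping.keys f \<subseteq> lists S},
     monoid.mult = (\<lambda>f g. lin_ext (\<lambda>u. lin_ext (\<lambda>v. Poly_Mapping.single (u @ v) 1) g) f),
     one = Poly_Mapping.single [] 1,
     ring.zero = 0,
     add = (+),
     module.smult = scale\<rparr>"

definition degree_part :: "nat \<Rightarrow> ('x list \<Rightarrow>\<^sub>0 'k) \<Rightarrow> ('x list \<Rightarrow>\<^sub>0 'k::comm_ring_1)"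
  where "degree_part m f =
    lin_ext (\<lambda>w. if length w = m then Poly_Mapping.single w 1 else 0) f"

text \<open>The braiding in the tensor positions \<open>i\<close> and \<open>i + 1\<close>, counted from one.\<close>

definition braiding :: "(perm \<times> perm \<Rightarrow> 'k) \<Rightarrow> nat \<Rightarrow> (perm list \<Rightarrow>\<^sub>0 'k) \<Rightarrow> (perm list \<Rightarrow>\<^sub>0 'k::comm_ring_1)"
  where "braiding q i = lin_ext (\<lambda>w. let \<tau> = w ! (i - 1); \<upsilon> = w ! i in
     Poly_Mapping.single (w[i - 1 := conj_perm \<tau> \<upsilon>, i := \<tau>]) (q (\<tau>, \<upsilon>)))"

definition is_expression :: "nat \<Rightarrow> perm \<Rightarrow> nat list \<Rightarrow> bool"
  where "is_expression m \<sigma> is \<longleftrightarrow>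
    set is \<subseteq> {1..<m} \<and> \<sigma> = foldr (\<lambda>i \<pi>. transpose i (i + 1) \<circ> \<pi>) is id"

definition is_reduced :: "nat \<Rightarrow> perm \<Rightarrow> nat list \<Rightarrow> bool"
  where "is_reduced m \<sigma> is \<longleftrightarrow>
    is_expression m \<sigma> is \<and> (\<forall>js. is_expression m \<sigma> js \<longrightarrow> length is \<le> length js)"

text \<open>By Matsumoto's theorem the operator does not depend on the choice of the reduced expression.\<close>

definition braid_perm :: "(perm \<times> perm \<Rightarrow> 'k) \<Rightarrow> nat \<Rightarrow> perm \<Rightarrow> (perm list \<Rightarrow>\<^sub>0 'k) \<Rightarrow> (perm list \<Rightarrow>\<^sub>0 'k::comm_ring_1)"
  where "braid_perm q m \<sigma> =
    foldr (\<lambda>i \<Phi>. braiding q i \<circ> \<Phi>) (SOME is. is_reduced m \<sigma> is) id"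

definition braided_factorial :: "(perm \<times> perm \<Rightarrow> 'k) \<Rightarrow> nat \<Rightarrow> (perm list \<Rightarrow>\<^sub>0 'k) \<Rightarrow> (perm list \<Rightarrow>\<^sub>0 'k::comm_ring_1)"
  where "braided_factorial q m f = (\<Sum>\<sigma>\<in>carrier (sym_group m). braid_perm q m \<sigma> f)"

text \<open>The direct sum over all \<open>m\<close> of the kernels of \<open>[m]!\<close> on the \<open>m\<close>-th tensor power.\<close>

definition nichols_ideal :: "nat \<Rightarrow> (perm \<times> perm \<Rightarrow> 'k::comm_ring_1) \<Rightarrow> (perm list \<Rightarrow>\<^sub>0 'k) set"
  where "nichols_ideal n q = {f \<in> carrier (tensor_alg (transpositions n)).
     \<forall>m. braided_factorial q m (degree_part m f) = 0}"

definition nichols_alg :: "nat \<Rightarrow> (perm \<times> perm \<Rightarrow> 'k::comm_ring_1) \<Rightarrow> ('k, (perm list \<Rightarrow>\<^sub>0 'k) set) module"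
  where "nichols_alg n q = quot_alg (tensor_alg (transpositions n)) (nichols_ideal n q)"

definition nichols_proj :: "nat \<Rightarrow> (perm \<times> perm \<Rightarrow> 'k::comm_ring_1) \<Rightarrow> (perm list \<Rightarrow>\<^sub>0 'k) \<Rightarrow> (perm list \<Rightarrow>\<^sub>0 'k) set"
  where "nichols_proj n q f =
    nichols_ideal n q +>\<^bsub>tensor_alg (transpositions n) :: ('k, _) module\<^esub> f"

definition nichols_gen :: "nat \<Rightarrow> (perm \<times> perm \<Rightarrow> 'k::comm_ring_1) \<Rightarrow> perm \<Rightarrow> (perm list \<Rightarrow>\<^sub>0 'k) set"
  where "nichols_gen n q \<tau> = nichols_proj n q (Poly_Mapping.single [\<tau>] 1)"

text \<open>The grading by the symmetric group; the degree of a word is the product of its letters.\<close>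

definition nichols_grading :: "nat \<Rightarrow> (perm \<times> perm \<Rightarrow> 'k::comm_ring_1) \<Rightarrow> perm \<Rightarrow> (perm list \<Rightarrow>\<^sub>0 'k) set set"
  where "nichols_grading n q \<sigma> = nichols_proj n q `
    {f \<in> carrier (tensor_alg (transpositions n)).
       \<forall>w \<in> Poly_Mapping.keys f. foldr (\<circ>) w id = \<sigma>}"

section \<open>The cocycle \<open>[1,z]\<close>\<close>

text \<open>Groups given by generators and relations. A letter is a pair of a generator and a sign, where
  \<^term>\<open>False\<close> marks a formal inverse.\<close>

inductive_set pres_rel :: "'a set \<Rightarrow> (('a \<times> bool) list \<times> ('a \<times> bool) list) set \<Rightarrow>
    (('a \<times> bool) list \<times> ('a \<times> bool) list) set"
  for S and Rel
  where
    rel: "(u, v) \<in> Rel \<Longrightarrow> (u, v) \<in> pres_rel S Rel"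
  | cancel: "x \<in> S \<Longrightarrow> ([(x, b), (x, \<not> b)], []) \<in> pres_rel S Rel"
  | refl: "u \<in> lists (S \<times> UNIV) \<Longrightarrow> (u, u) \<in> pres_rel S Rel"
  | sym: "(u, v) \<in> pres_rel S Rel \<Longrightarrow> (v, u) \<in> pres_rel S Rel"
  | trans: "(u, v) \<in> pres_rel S Rel \<Longrightarrow> (v, w) \<in> pres_rel S Rel \<Longrightarrow> (u, w) \<in> pres_rel S Rel"
  | mult: "(u, v) \<in> pres_rel S Rel \<Longrightarrow> (u', v') \<in> pres_rel S Rel \<Longrightarrow> (u @ u', v @ v') \<in> pres_rel S Rel"

definition presented_group :: "'a set \<Rightarrow> (('a \<times> bool) list \<times> ('a \<times> bool) list) set \<Rightarrow>
    ('a \<times> bool) list set monoid"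
  where "presented_group S Rel = \<lparr>
     carrier = lists (S \<times> UNIV) // pres_rel S Rel,
     monoid.mult = (\<lambda>A B. \<Union>u\<in>A. \<Union>v\<in>B. pres_rel S Rel `` {u @ v}),
     one = pres_rel S Rel `` {[]}\<rparr>"

datatype T_gen = Gen_t nat | Gen_z

type_synonym T_word = "(T_gen \<times> bool) list"

definition word_t :: "nat \<Rightarrow> T_word"
  where "word_t i = [(Gen_t i, True)]"

definition word_z :: T_word
  where "word_z = [(Gen_z, True)]"

definition T_gens :: "nat \<Rightarrow> T_gen set"
  where "T_gens n = insert Gen_z (Gen_t ` {1..<n})"

definition T_rels :: "nat \<Rightarrow> (T_word \<times> T_word) set"
  where "T_rels n =
     {(word_t i @ word_t i, []) | i. 1 \<le> i \<and> i < n} \<union>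
     {(word_z @ word_z, [])} \<union>
     {(word_z @ word_t i, word_t i @ word_z) | i. 1 \<le> i \<and> i < n} \<union>
     {(word_t j @ word_t (j + 1) @ word_t j, word_t (j + 1) @ word_t j @ word_t (j + 1)) | j.
        1 \<le> j \<and> j + 1 < n} \<union>
     {(word_t k @ word_t l, word_z @ word_t l @ word_t k) | k l. 1 \<le> k \<and> k + 1 < l \<and> l < n}"

definition T_group :: "nat \<Rightarrow> T_word set monoid"
  where "T_group n = presented_group (T_gens n) (T_rels n)"

definition T_class :: "nat \<Rightarrow> T_word \<Rightarrow> T_word set"
  where "T_class n w = pres_rel (T_gens n) (T_rels n) `` {w}"

fun gen_perm :: "T_gen \<Rightarrow> perm"
  where "gen_perm (Gen_t i) = transpose i (i + 1)"
      | "gen_perm Gen_z = id"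

definition word_perm :: "T_word \<Rightarrow> perm"
  where "word_perm w =
    foldr (\<lambda>(x, b) \<pi>. (if b then gen_perm x else inv' (gen_perm x)) \<circ> \<pi>) w id"

text \<open>The homomorphism from \<open>T\<^sub>n\<close> to the symmetric group; \<open>word_perm\<close> is constant on classes.\<close>

definition T_proj :: "T_word set \<Rightarrow> perm"
  where "T_proj c = the_elem (word_perm ` c)"

definition is_section :: "nat \<Rightarrow> (perm \<Rightarrow> T_word set) \<Rightarrow> bool"
  where "is_section n T \<longleftrightarrow>
     (\<forall>\<sigma> \<in> carrier (sym_group n). T \<sigma> \<in> carrier (T_group n) \<and> T_proj (T \<sigma>) = \<sigma>) \<and>
     T id = \<one>\<^bsub>T_group n\<^esub> \<and>
     (\<forall>i. 1 \<le> i \<and> i < n \<longrightarrow> T (transpose i (i + 1)) = T_class n (word_t i)) \<and>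
     (\<forall>i j. 1 \<le> i \<and> i < j \<and> j < n \<longrightarrow>
        T (transpose i (j + 1)) =
          T_class n word_z \<otimes>\<^bsub>T_group n\<^esub> T_class n (word_t j) \<otimes>\<^bsub>T_group n\<^esub>
          T (transpose i j) \<otimes>\<^bsub>T_group n\<^esub> inv\<^bsub>T_group n\<^esub> (T_class n (word_t j)))"

text \<open>\<open>T(g) T(h) T(gh)\<inverse>\<close> lies in the kernel \<open>{1, z}\<close> of \<open>T_proj\<close>, which is identified with the
  subgroup \<^const>\<open>C2\<close> of the units of the group algebra.\<close>

definition cocycle_1z :: "nat \<Rightarrow> (perm \<Rightarrow> T_word set) \<Rightarrow> perm \<Rightarrow> perm \<Rightarrow> CC2"
  where "cocycle_1z n T g h =
    (if T g \<otimes>\<^bsub>T_group n\<^esub> T h \<otimes>\<^bsub>T_group n\<^esub> inv\<^bsub>T_group n\<^esub> (T (g \<circ> h)) = \<one>\<^bsub>T_group n\<^esub>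
     then 1 else zR)"

text \<open>\<open>\<mu> \<cdot> (\<mu>|\<^bsub>z=-1\<^esub>)\<close> for a cocycle \<open>\<mu>\<close>.\<close>

definition twist_minus :: "(perm \<Rightarrow> perm \<Rightarrow> CC2) \<Rightarrow> perm \<Rightarrow> perm \<Rightarrow> CC2"
  where "twist_minus \<mu> g h = \<mu> g h * const (subst_z (-1) (\<mu> g h))"

section \<open>The three Nichols algebras\<close>

abbreviation q_plus :: "nat \<Rightarrow> perm \<times> perm \<Rightarrow> complex"
  where "q_plus n \<equiv> qfun n 1"

abbreviation q_minus :: "nat \<Rightarrow> perm \<times> perm \<Rightarrow> complex"
  where "q_minus n \<equiv> qfun n (- 1)"

abbreviation q_z :: "nat \<Rightarrow> perm \<times> perm \<Rightarrow> CC2"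
  where "q_z n \<equiv> qfun n zR"

abbreviation B_plus :: "nat \<Rightarrow> (complex, (perm list \<Rightarrow>\<^sub>0 complex) set) module"
  where "B_plus n \<equiv> nichols_alg n (q_plus n)"

abbreviation B_minus :: "nat \<Rightarrow> (complex, (perm list \<Rightarrow>\<^sub>0 complex) set) module"
  where "B_minus n \<equiv> nichols_alg n (q_minus n)"

abbreviation B_z :: "nat \<Rightarrow> (CC2, (perm list \<Rightarrow>\<^sub>0 CC2) set) module"
  where "B_z n \<equiv> nichols_alg n (q_z n)"

end

theory Submission
  imports Defs
begin

text \<open>
  Everything is computed in tensor algebras, where words in the transpositions form a basis. The operators
  \<open>\<Psi>\<^sub>\<sigma>\<close> do not depend on reduced expressions (\<open>matsumoto\<close>), so that \<open>[m + 1]!\<close> factors through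
  \<open>[m]! \<otimes> id\<close> and \<open>id \<otimes> [m]!\<close>, and the kernels form a two-sided ideal (\<open>ideal_nichols_ideal\<close>).

  The three Nichols algebras are compared by maps that change the coefficient of each word \<open>w\<close> by an additive
  map \<open>h\<^sub>w\<close>. Such a map commutes with the braidings as soon as \<open>h\<^sub>w\<close> changes in the right way when two neighbouring
  letters are braided, and then it maps one Nichols ideal into the other; a family of such maps that
  separates coefficients even detects the ideal (\<open>nichols_ideal_iff_wordwise\<close>). There are two families.

  Substituting \<open>1\<close> and \<open>-1\<close> for \<open>z\<close> turns \<open>q\<^sub>z\<close> into \<open>q\<^sub>1\<close> and \<open>q\<^bsub>-1\<^esub>\<close>. Since \<open>R\<close> is \<open>\<complex> \<times> \<complex>\<close> through these
  substitutions, the Nichols algebra over \<open>R\<close> is glued from the two complex ones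
  (\<open>gen_iso_specialise\<close>, \<open>nichols_direct_sum\<close>).

  Multiplying a word \<open>x\<^sub>1 \<dots> x\<^sub>k\<close> by the power of \<open>z\<close> by which \<open>T(x\<^sub>1) \<dots> T(x\<^sub>k)\<close> differs from \<open>T(x\<^sub>1 \<dots> x\<^sub>k)\<close> turns
  \<open>q\<^sub>z\<close> into \<open>q\<^sub>1\<close>; the compatibility with the braiding is the commutation rule \<open>T(x) T(y) = \<chi>(x,y) T(xyx\<inverse>) T(x)\<close>
  (\<open>mu_swap\<close>). This power of \<open>z\<close> is the iterated cocycle, so concatenation of words becomes the
  product of the cocycle extension (\<open>gen_iso_cocycle_ext\<close>). The second cocycle works likewise for
  \<open>q\<^bsub>-1\<^esub>\<close>. As words are only multiplied by units, a basis of the complex algebra that consists of words is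
  also a basis over \<open>R\<close> (\<open>word_complement_z\<close>), which gives flatness.

  The facts about \<open>T\<^sub>n\<close> rest on its projection to the symmetric group, whose kernel is \<open>{1, z}\<close> by the Coxeter
  presentation (\<open>T_proj_kernel\<close>), and on a spin representation in which \<open>z\<close> acts by \<open>-1\<close> and the lift of
  \<open>(i j)\<close> by the unit vector \<open>(e\<^sub>i - e\<^sub>j)/\<surd>2\<close> of a Clifford algebra (\<open>T_op_T_transpose\<close>). The representation
  distinguishes \<open>1\<close> from \<open>z\<close>, so signs can be computed there.
\<close>

abbreviation "keys \<equiv> Poly_Mapping.keys"
abbreviation "lookup \<equiv> Poly_Mapping.lookup"
abbreviation "single \<equiv> Poly_Mapping.single"

section \<open>Reduced words in the symmetric group\<close>

text \<open>The inverse of the product of the simple transpositions named by the letters. Whether multiplying by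
  a simple transposition on the left lengthens a permutation is visible in the values of its inverse.\<close>

primrec word_inv :: "nat list \<Rightarrow> perm"
  where "word_inv [] = id"
      | "word_inv (i # is) = word_inv is \<circ> transpose i (Suc i)"

text \<open>Every letter lengthens the permutation of the letters after it. These are the reduced words, in a form
  that speaks of the values of a permutation instead of comparing lengths of words.\<close>

primrec ascending :: "nat list \<Rightarrow> bool"
  where "ascending [] \<longleftrightarrow> True"
      | "ascending (i # is) \<longleftrightarrow> word_inv is i < word_inv is (Suc i) \<and> ascending is"

definition word_perm_of :: "nat list \<Rightarrow> perm"
  where "word_perm_of is = foldr (\<lambda>i \<pi>. transpose i (i + 1) \<circ> \<pi>) is id"

lemma word_inv_append: "word_inv (is @ js) = word_inv js \<circ> word_inv is"
  by (induction "is") (auto simp: o_assoc)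

lemma word_perm_of_simps [simp]:
  "word_perm_of [] = id" "word_perm_of (i # is) = transpose i (Suc i) \<circ> word_perm_of is"
  by (simp_all add: word_perm_of_def)

lemma word_perm_of_append: "word_perm_of (is @ js) = word_perm_of is \<circ> word_perm_of js"
  by (induction "is") (auto simp: o_assoc)

lemma word_inv_word_perm_of: "word_inv is \<circ> word_perm_of is = id" "word_perm_of is \<circ> word_inv is = id"
proof (induction "is")
  case (Cons i "is")
  { case 1
    have "word_inv is (transpose i (Suc i) (transpose i (Suc i) (word_perm_of is x))) = x" for x
      using Cons(1) by (simp add: fun_eq_iff)
    then show ?case by (simp add: fun_eq_iff) }
  { case 2
    have "transpose i (Suc i) (word_perm_of is (word_inv is (transpose i (Suc i) x))) = x" for x
      using Cons(2) by (simp add: fun_eq_iff)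
    then show ?case by (simp add: fun_eq_iff) }
qed auto

lemma word_inv_eq_inv: "word_inv is = inv' (word_perm_of is)"
  by (metis word_inv_word_perm_of inv_unique_comp)

lemma word_perm_of_eq_inv: "word_perm_of is = inv' (word_inv is)"
  by (metis word_inv_word_perm_of inv_unique_comp)

lemma word_perm_of_eq_iff: "word_perm_of is = word_perm_of js \<longleftrightarrow> word_inv is = word_inv js"
  by (metis word_inv_eq_inv word_perm_of_eq_inv)

lemma bij_word_inv: "bij (word_inv is)"
  by (metis word_inv_word_perm_of o_bij)

lemma word_inv_fixes: "set is \<subseteq> {1..<m} \<Longrightarrow> x \<notin> {1..m} \<Longrightarrow> word_inv is x = x"
  by (induction "is" arbitrary: x) (auto simp: transpose_def)

lemma word_perm_of_permutes:
  assumes "set is \<subseteq> {1..<m}" shows "word_perm_of is permutes {1..m}"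
proof -
  have "word_inv is permutes {1..m}"
    unfolding permutes_def using word_inv_fixes[OF assms] bij_word_inv[of "is"]
    by (auto simp: bij_iff)
  then show ?thesis by (metis permutes_inv word_perm_of_eq_inv)
qed

text \<open>The exchange condition. Following the pair \<open>a < b\<close> through the letters of the word, some letter
  has to be the one that brings the pair out of order; deleting this letter multiplies by the
  transposition of \<open>a\<close> and \<open>b\<close>.\<close>

lemma exchange:
  assumes "a < b" "word_inv is a > word_inv is b"
  shows "\<exists>js. Suc (length js) = length is \<and> set js \<subseteq> set is \<and> word_inv js = word_inv is \<circ> transpose a b"
  using assms
proof (induction "is" arbitrary: a b)
  case (Cons i "is")
  let ?s = "transpose i (Suc i)"
  show ?case
  proof (cases "a = i \<and> b = Suc i")
    case True
    then show ?thesis by (intro exI[of _ "is"]) (auto simp: comp_assoc)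
  next
    case False
    then have "?s a < ?s b" using Cons.prems(1) by (auto simp: transpose_def)
    moreover have "word_inv is (?s a) > word_inv is (?s b)" using Cons.prems(2) by simp
    ultimately obtain js where js: "Suc (length js) = length is" "set js \<subseteq> set is"
      "word_inv js = word_inv is \<circ> transpose (?s a) (?s b)" using Cons.IH by blast
    have "transpose (?s a) (?s b) \<circ> ?s = ?s \<circ> transpose a b"
      using transpose_comp_eq[of ?s "?s a" "?s b"] by simp
    then have "word_inv (i # js) = word_inv (i # is) \<circ> transpose a b"
      unfolding word_inv.simps js(3) by (simp only: o_assoc[symmetric])
    then show ?thesis using js by (intro exI[of _ "i # js"]) auto
  qed
qed simp

definition minimal_word :: "nat set \<Rightarrow> nat list \<Rightarrow> bool"
  where "minimal_word S is \<longleftrightarrow> set is \<subseteq> S \<and>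
    (\<forall>js. set js \<subseteq> S \<longrightarrow> word_inv js = word_inv is \<longrightarrow> length is \<le> length js)"

text \<open>A first letter that does not lengthen could be cancelled against a letter of the rest, by the exchange
  condition.\<close>

lemma minimal_word_ascending: "minimal_word S is \<Longrightarrow> ascending is"
proof (induction "is")
  case (Cons i "is")
  have S: "i \<in> S" "set is \<subseteq> S" using Cons.prems by (auto simp: minimal_word_def)
  have min: "Suc (length is) \<le> length js"
    if "set js \<subseteq> S" "word_inv js = word_inv is \<circ> transpose i (Suc i)" for js
    using Cons.prems that by (auto simp: minimal_word_def)
  have "minimal_word S is"
    unfolding minimal_word_def
  proof (intro conjI allI impI)
    fix js assume "set js \<subseteq> S" "word_inv js = word_inv is"
    then show "length is \<le> length js" using min[of "i # js"] S by auto
  qed (use S in auto)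
  moreover have "word_inv is i < word_inv is (Suc i)"
  proof (rule ccontr)
    assume "\<not> ?thesis"
    moreover have "word_inv is i \<noteq> word_inv is (Suc i)"
      using bij_word_inv[of "is"] by (metis bij_is_inj inj_eq n_not_Suc_n)
    ultimately obtain js where "Suc (length js) = length is" "set js \<subseteq> set is"
      "word_inv js = word_inv is \<circ> transpose i (Suc i)"
      using exchange[of i "Suc i" "is"] by auto
    then show False using min[of js] S by auto
  qed
  ultimately show ?case using Cons.IH by simp
qed simp

lemma ex_minimal_word:
  assumes "set ws \<subseteq> S"
  shows "\<exists>is. minimal_word S is \<and> word_inv is = word_inv ws"
proof -
  let ?P = "\<lambda>is. set is \<subseteq> S \<and> word_inv is = word_inv ws"
  obtain "is" where "?P is" "\<And>js. ?P js \<Longrightarrow> length is \<le> length js"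
    using ex_has_least_nat[of ?P ws length] assms by blast
  then show ?thesis by (intro exI[of _ "is"]) (auto simp: minimal_word_def)
qed

lemma ex_ascending:
  assumes "set ws \<subseteq> S"
  obtains "is" where "ascending is" "set is \<subseteq> S" "word_inv is = word_inv ws"
proof -
  obtain "is" where "minimal_word S is" "word_inv is = word_inv ws"
    using ex_minimal_word[OF assms] by blast
  then show ?thesis using that[of "is"] minimal_word_ascending by (auto simp: minimal_word_def)
qed

lemma ex_word_transpose:
  assumes "1 \<le> a" "a < b" "b \<le> m"
  shows "\<exists>ws. set ws \<subseteq> {1..<m} \<and> word_perm_of ws = transpose a b"
  using assms
proof (induction b)
  case (Suc b)
  show ?case
  proof (cases "a = b")
    case True
    then show ?thesis using Suc.prems by (intro exI[of _ "[a]"]) auto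
  next
    case False
    then obtain ws where ws: "set ws \<subseteq> {1..<m}" "word_perm_of ws = transpose a b"
      using Suc by fastforce
    have "transpose b (Suc b) \<circ> (transpose a b \<circ> transpose b (Suc b)) = transpose a (Suc b)"
      using False Suc.prems by (auto simp: fun_eq_iff transpose_def)
    then show ?thesis using ws Suc.prems False
      by (intro exI[of _ "b # ws @ [b]"]) (auto simp: word_perm_of_append)
  qed
qed simp

lemma ex_word:
  assumes "p permutes {1..m}"
  shows "\<exists>ws. set ws \<subseteq> {1..<m} \<and> word_perm_of ws = p"
proof -
  have "finite {1..m}" by simp
  from assms this show ?thesis
  proof (induction rule: permutes_induct)
    case id
    show ?case by (intro exI[of _ "[]"]) auto
  next
    case (swap a b p)
    from swap obtain ws where ws: "set ws \<subseteq> {1..<m}" "word_perm_of ws = p" by auto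
    consider "a = b" | "a < b" | "b < a" by linarith
    then have "\<exists>us. set us \<subseteq> {1..<m} \<and> word_perm_of us = transpose a b"
    proof cases
      case 1
      then show ?thesis by (intro exI[of _ "[]"]) auto
    next
      case 2
      then show ?thesis using swap ex_word_transpose[of a b m] by auto
    next
      case 3
      then show ?thesis using swap ex_word_transpose[of b a m] by (auto simp: transpose_commute)
    qed
    then obtain us where "set us \<subseteq> {1..<m}" "word_perm_of us = transpose a b" by auto
    then show ?case using ws by (intro exI[of _ "us @ ws"]) (auto simp: word_perm_of_append)
  qed
qed

lemma simple_transpositions_commute:
  assumes "Suc i < j \<or> Suc j < i"
  shows "transpose i (Suc i) (transpose j (Suc j) x) = transpose j (Suc j) (transpose i (Suc i) x)"
  using assms by (auto simp: transpose_def)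

lemma simple_transpositions_braid:
  assumes "j = Suc i \<or> i = Suc j"
  shows "transpose i (Suc i) (transpose j (Suc j) (transpose i (Suc i) x)) =
    transpose j (Suc j) (transpose i (Suc i) (transpose j (Suc j) x))"
  using assms
proof
  assume j: "j = Suc i"
  have "transpose j (Suc j) (transpose i (Suc i) (transpose j (Suc j) x)) = transpose (Suc j) i x"
    using transpose_triple[of "Suc j" i j x] j by (simp add: transpose_commute)
  then show ?thesis using transpose_triple[of i "Suc j" j x] j by (simp add: transpose_commute)
next
  assume i: "i = Suc j"
  have "transpose i (Suc i) (transpose j (Suc j) (transpose i (Suc i) x)) = transpose (Suc i) j x"
    using transpose_triple[of "Suc i" j i x] i by (simp add: transpose_commute)
  then show ?thesis using transpose_triple[of j "Suc i" i x] i by (simp add: transpose_commute)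
qed

text \<open>The combinatorics of braid moves is needed for two different congruences on words: equality of the
  operators obtained from a braiding, and equality up to the central element \<open>z\<close> of the products of
  generators of \<open>T\<^sub>n\<close>.\<close>

locale braid_congruence =
  fixes S :: "nat set" and R :: "nat list \<Rightarrow> nat list \<Rightarrow> bool"
  assumes refl: "set is \<subseteq> S \<Longrightarrow> R is is"
    and sym: "R is js \<Longrightarrow> R js is"
    and trans: "R is js \<Longrightarrow> R js ks \<Longrightarrow> R is ks"
    and cons: "i \<in> S \<Longrightarrow> set is \<subseteq> S \<Longrightarrow> set js \<subseteq> S \<Longrightarrow> R is js \<Longrightarrow> R (i # is) (i # js)"
    and commute: "i \<in> S \<Longrightarrow> j \<in> S \<Longrightarrow> set ks \<subseteq> S \<Longrightarrow> Suc i < j \<Longrightarrow> R (i # j # ks) (j # i # ks)"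
    and braid: "i \<in> S \<Longrightarrow> Suc i \<in> S \<Longrightarrow> set ks \<subseteq> S \<Longrightarrow>
      R (i # Suc i # i # ks) (Suc i # i # Suc i # ks)"
begin

text \<open>Two ascending words for the same permutation that begin with different letters \<open>i\<close> and \<open>j\<close> can both
  be compared to words which begin with the longest element of the parabolic subgroup generated by
  \<open>i\<close> and \<open>j\<close>, so that only one braid move is left.\<close>

theorem matsumoto:
  assumes "ascending is" "ascending js" "set is \<subseteq> S" "set js \<subseteq> S" "word_inv is = word_inv js"
  shows "length is = length js \<and> R is js"
  using assms
proof (induction "length is" arbitrary: "is" js)
  case 0
  show ?case
  proof (cases js)
    case (Cons j ks)
    then have "word_inv js (Suc j) < word_inv js j" using 0 by simp
    moreover have "word_inv js = id" using 0 by (metis length_0_conv word_inv.simps(1))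
    ultimately show ?thesis by simp
  qed (use 0 refl in auto)
next
  case (Suc n)
  obtain i is' where is_eq: "is = i # is'" using Suc.hyps(2) by (cases "is") auto
  have "js \<noteq> []"
  proof
    assume "js = []"
    then have id: "word_inv (i # is') = id" using Suc.prems(5) is_eq by simp
    have "word_inv (i # is') (Suc i) < word_inv (i # is') i" using Suc.prems(1) is_eq by simp
    then show False unfolding id by simp
  qed
  then obtain j js' where js_eq: "js = j # js'" by (cases js) auto
  let ?W = "word_inv is"
  have Wi: "?W (Suc i) < ?W i" using Suc.prems(1) unfolding is_eq by simp
  have Wj: "?W (Suc j) < ?W j" using Suc.prems(2) unfolding Suc.prems(5) js_eq by simp
  have sub: "i \<in> S" "j \<in> S" "set is' \<subseteq> S" "set js' \<subseteq> S" "ascending is'" "ascending js'" "n = length is'"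
    using Suc.prems(1-4) Suc.hyps(2) unfolding is_eq js_eq by auto
  have inv_is': "word_inv is' x = ?W (transpose i (Suc i) x)" for x
    unfolding is_eq by simp
  have inv_js': "word_inv js' x = ?W (transpose j (Suc j) x)" for x
    unfolding Suc.prems(5) js_eq by simp
  note IH = Suc.hyps(1)
  text \<open>It suffices to find a word \<open>us\<close> such that \<open>i us\<close> and \<open>j vs\<close> differ by a braid move.\<close>
  have step: "length is = length js \<and> R is js"
    if us: "ascending us" "set us \<subseteq> S" "word_inv us = word_inv is'"
      and vs: "ascending vs" "set vs \<subseteq> S" "word_inv vs = word_inv js'"
      and eq: "length us = length vs" "R (i # us) (j # vs)" for us vs
  proof -
    have 1: "length is' = length us" "R is' us"
      using IH[of is' us] us sub by auto
    then have 2: "length vs = length js'" "R vs js'"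
      using IH[of vs js'] vs sub eq by auto
    have "R (i # is') (i # us)" "R (j # vs) (j # js')"
      using cons sub us vs 1 2 by auto
    then have "R is js" unfolding is_eq js_eq using eq(2) trans by blast
    moreover have "length is = length js" unfolding is_eq js_eq using 1 2 eq(1) by simp
    ultimately show ?thesis by simp
  qed
  consider "i = j" | "Suc i < j \<or> Suc j < i" | "j = Suc i \<or> i = Suc j" by linarith
  then show ?case
  proof cases
    case 1
    then have "word_inv is' = word_inv js'" using inv_is' inv_js' by (simp add: fun_eq_iff)
    then have "length is' = length js' \<and> R is' js'" using IH[of is' js'] sub by auto
    then show ?thesis unfolding is_eq js_eq using 1 cons sub by auto
  next
    case 2
    have "set (j # is') \<subseteq> S" using sub by auto
    then obtain ks where ks: "ascending ks" "set ks \<subseteq> S" "word_inv ks = word_inv (j # is')"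
      by (rule ex_ascending)
    have V: "word_inv ks x = ?W (transpose i (Suc i) (transpose j (Suc j) x))" for x
      using ks(3) inv_is' by simp
    have "ascending (j # ks)" "ascending (i # ks)"
      using 2 ks(1) Wi Wj by (auto simp: V)
    moreover have "word_inv (j # ks) = word_inv is'" "word_inv (i # ks) = word_inv js'"
      using simple_transpositions_commute[of i j] 2 by (auto simp: fun_eq_iff V inv_is' inv_js')
    moreover have "R (i # j # ks) (j # i # ks)"
      using 2 commute[of i j ks] commute[of j i ks] sub(1,2) ks(2) sym by auto
    ultimately show ?thesis using step[of "j # ks" "i # ks"] sub(1,2) ks(2) by simp
  next
    case 3
    have "set (i # j # is') \<subseteq> S" using sub by auto
    then obtain ks where ks: "ascending ks" "set ks \<subseteq> S" "word_inv ks = word_inv (i # j # is')"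
      by (rule ex_ascending)
    have V: "word_inv ks x =
      ?W (transpose i (Suc i) (transpose j (Suc j) (transpose i (Suc i) x)))" for x
      using ks(3) inv_is' by simp
    have "ascending (j # i # ks)" "ascending (i # j # ks)"
      using 3 ks(1) Wi Wj by (auto simp: V)
    moreover have "word_inv (j # i # ks) = word_inv is'" "word_inv (i # j # ks) = word_inv js'"
      by (simp_all add: fun_eq_iff V inv_is' inv_js' simple_transpositions_braid[OF 3])
    moreover have "R (i # j # i # ks) (j # i # j # ks)"
      using 3 braid[of i ks] braid[of j ks] sub(1,2) ks(2) sym by auto
    ultimately show ?thesis using step[of "j # i # ks" "i # j # ks"] sub(1,2) ks(2) by simp
  qed
qed

text \<open>If moreover squares of letters can be cancelled, then the congruence is equality of
  permutations. This is the Coxeter presentation of the symmetric group.\<close>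

lemma related_ascending:
  assumes cancel: "\<And>i ks. i \<in> S \<Longrightarrow> set ks \<subseteq> S \<Longrightarrow> R (i # i # ks) ks"
    and "set is \<subseteq> S"
  shows "\<exists>js. ascending js \<and> set js \<subseteq> S \<and> word_inv js = word_inv is \<and> R is js"
  using assms(2)
proof (induction "is")
  case Nil
  show ?case using refl by (intro exI[of _ "[]"]) auto
next
  case (Cons i "is")
  then obtain js where js: "ascending js" "set js \<subseteq> S" "word_inv js = word_inv is" "R is js" by auto
  have i: "i \<in> S" "set is \<subseteq> S" using Cons.prems by auto
  have R1: "R (i # is) (i # js)" using cons js i by auto
  show ?case
  proof (cases "word_inv js i < word_inv js (Suc i)")
    case True
    then show ?thesis using js i R1 by (intro exI[of _ "i # js"]) auto
  next
    case False
    have "set (i # js) \<subseteq> S" using i js by auto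
    then obtain ks where ks: "ascending ks" "set ks \<subseteq> S" "word_inv ks = word_inv (i # js)"
      by (rule ex_ascending)
    have "word_inv js i \<noteq> word_inv js (Suc i)"
      using bij_word_inv[of js] by (metis bij_is_inj inj_eq n_not_Suc_n)
    with False ks have "ascending (i # ks)" by auto
    moreover have "word_inv (i # ks) = word_inv js" using ks by (auto simp: fun_eq_iff)
    ultimately have "R js (i # ks)" using matsumoto[of js "i # ks"] js ks i by auto
    then have "R (i # js) (i # i # ks)" using cons js ks i by auto
    then have "R (i # is) ks" using cancel[of i ks] R1 trans ks i by blast
    then show ?thesis using ks js by (intro exI[of _ ks]) auto
  qed
qed

lemma related_Nil:
  assumes "\<And>i ks. i \<in> S \<Longrightarrow> set ks \<subseteq> S \<Longrightarrow> R (i # i # ks) ks"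
    and "set is \<subseteq> S" "word_perm_of is = id"
  shows "R is []"
proof -
  obtain js where js: "ascending js" "set js \<subseteq> S" "word_inv js = word_inv is" "R is js"
    using related_ascending assms(1,2) by blast
  have "word_inv is = word_inv []" using assms(3) word_perm_of_eq_iff[of "is" "[]"] by simp
  then have "R js []" using matsumoto[of js "[]"] js by auto
  then show ?thesis using js trans by blast
qed

end

section \<open>The tensor algebra\<close>

lemma lookup_scale [simp]: "lookup (scale k f) w = k * lookup f w"
  by (simp add: scale_def Poly_Mapping.map.rep_eq when_def)

lemma scale_simps:
  "scale k (f + g) = scale k f + scale k g" "scale k (f - g) = scale k f - scale k g"
  "scale (a + b) f = scale a f + scale b f"
  "scale (a * b) f = scale a (scale b f)" "scale 1 f = f" "scale k 0 = 0" "scale 0 f = 0"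
  by (rule poly_mapping_eqI; simp add: lookup_add lookup_minus algebra_simps)+

lemma scale_single [simp]: "scale k (single w c) = single w (k * c)"
  by (rule poly_mapping_eqI) (simp add: lookup_single when_def)

lemma keys_scale: "keys (scale k f) \<subseteq> keys f"
  by (auto simp: in_keys_iff)

lemma additive_scale: "additive (scale k)"
  by (simp add: additive_def scale_simps)

lemma additive_comp: "additive f \<Longrightarrow> additive g \<Longrightarrow> additive (\<lambda>x. f (g x))"
  by (simp add: additive_def)

lemma keys_sum_subset: "(\<And>x. x \<in> A \<Longrightarrow> keys (f x) \<subseteq> B) \<Longrightarrow> keys (sum f A) \<subseteq> B"
  by (induction A rule: infinite_finite_induct) (auto dest!: subsetD[OF Poly_Mapping.keys_add])

lemma keys_add_subset: "keys f \<subseteq> B \<Longrightarrow> keys g \<subseteq> B \<Longrightarrow> keys (f + g) \<subseteq> B"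
  by (auto dest!: subsetD[OF Poly_Mapping.keys_add])

lemma keys_diff_subset:
  fixes f g :: "'a \<Rightarrow>\<^sub>0 'b::ab_group_add"
  shows "keys f \<subseteq> B \<Longrightarrow> keys g \<subseteq> B \<Longrightarrow> keys (f - g) \<subseteq> B"
  by (auto simp: in_keys_iff lookup_minus subset_iff) metis

lemma keys_single_subset: "w \<in> B \<Longrightarrow> keys (single w c) \<subseteq> B"
  by auto

lemma sum_singles: "(\<Sum>w\<in>keys f. single w (lookup f w)) = f"
  by (rule poly_mapping_eqI)
    (simp add: lookup_sum lookup_single when_def sum.delta in_keys_iff)

text \<open>Most identities below are between additive maps, so that they only need to be checked on multiples of
  words.\<close>

lemma additive_eqI:
  fixes L L' :: "('a \<Rightarrow>\<^sub>0 'k::comm_ring_1) \<Rightarrow> 'b::ab_group_add"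
  assumes "additive L" "additive L'" "keys f \<subseteq> A"
    and "\<And>w c. w \<in> A \<Longrightarrow> L (single w c) = L' (single w c)"
  shows "L f = L' f"
proof -
  have "L f = (\<Sum>w\<in>keys f. L (single w (lookup f w)))"
    using additive.sum[OF assms(1)] by (metis sum_singles)
  also have "\<dots> = (\<Sum>w\<in>keys f. L' (single w (lookup f w)))"
    using assms by (intro sum.cong) auto
  also have "\<dots> = L' f"
    using additive.sum[OF assms(2)] by (metis sum_singles)
  finally show ?thesis .
qed

lemma lookup_lin_ext:
  "lookup (lin_ext F f) v = (\<Sum>w\<in>keys f. lookup f w * lookup (F w) v)"
  by (simp add: lin_ext_def lookup_sum)

lemma lin_ext_superset:
  assumes "finite A" "keys f \<subseteq> A"
  shows "lin_ext F f = (\<Sum>w\<in>A. scale (lookup f w) (F w))"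
  unfolding lin_ext_def using assms
  by (intro sum.mono_neutral_left) (auto simp: in_keys_iff scale_simps)

lemma additive_lin_ext: "additive (lin_ext F)"
proof
  fix f g :: "'a \<Rightarrow>\<^sub>0 'b"
  let ?A = "keys f \<union> keys g"
  have "keys (f + g) \<subseteq> ?A" by (rule Poly_Mapping.keys_add)
  then show "lin_ext F (f + g) = lin_ext F f + lin_ext F g"
    using lin_ext_superset[of ?A f F] lin_ext_superset[of ?A g F] lin_ext_superset[of ?A "f + g" F]
    by (simp add: lookup_add scale_simps sum.distrib)
qed

lemma lin_ext_single [simp]: "lin_ext F (single w c) = scale c (F w)"
  using lin_ext_superset[of "{w}" "single w c" F] by simp

lemma lin_ext_scale: "lin_ext F (scale k f) = scale k (lin_ext F f)"
  using lin_ext_superset[OF _ keys_scale, of f F k]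
  by (simp add: lin_ext_def scale_simps additive.sum[OF additive_scale])

lemma keys_lin_ext_subset:
  assumes "\<And>w. w \<in> keys f \<Longrightarrow> keys (F w) \<subseteq> B"
  shows "keys (lin_ext F f) \<subseteq> B"
  unfolding lin_ext_def using assms by (intro keys_sum_subset subset_trans[OF keys_scale])

text \<open>The multiplication of the tensor algebra, stated without reference to the set of letters.\<close>

definition word_mult :: "('x list \<Rightarrow>\<^sub>0 'k) \<Rightarrow> ('x list \<Rightarrow>\<^sub>0 'k) \<Rightarrow> ('x list \<Rightarrow>\<^sub>0 'k::comm_ring_1)"
  where "word_mult f g = lin_ext (\<lambda>u. lin_ext (\<lambda>v. single (u @ v) 1) g) f"

lemma word_mult_single [simp]:
  "word_mult (single u a) (single v b) = single (u @ v) (a * b)"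
  by (simp add: word_mult_def)

lemma additive_word_mult_left: "additive (\<lambda>f. word_mult f g)"
  unfolding word_mult_def by (rule additive_lin_ext)

lemma additive_word_mult_right: "additive (word_mult f)"
proof
  fix g h :: "'a list \<Rightarrow>\<^sub>0 'b"
  show "word_mult f (g + h) = word_mult f g + word_mult f h"
    unfolding word_mult_def additive.add[OF additive_lin_ext]
    by (simp add: lin_ext_def scale_simps sum.distrib)
qed

lemma word_mult_scale_left: "word_mult (scale k f) g = scale k (word_mult f g)"
  by (simp add: word_mult_def lin_ext_scale)

lemma word_mult_scale_right: "word_mult f (scale k g) = scale k (word_mult f g)"
proof (rule additive_eqI[of "\<lambda>f. word_mult f (scale k g)" "\<lambda>f. scale k (word_mult f g)" f UNIV])
  show "additive (\<lambda>f. scale k (word_mult f g))"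
    by (rule additive_comp[OF additive_scale additive_word_mult_left])
  fix w :: "'a list" and c :: 'b
  show "word_mult (single w c) (scale k g) = scale k (word_mult (single w c) g)"
    by (simp add: word_mult_def lin_ext_scale mult.commute flip: scale_simps(4))
qed (simp_all add: additive_word_mult_left)

lemma word_mult_assoc: "word_mult (word_mult f g) h = word_mult f (word_mult g h)"
proof (rule additive_eqI[of "\<lambda>f. word_mult (word_mult f g) h" "\<lambda>f. word_mult f (word_mult g h)" f UNIV])
  show "additive (\<lambda>f. word_mult (word_mult f g) h)"
    by (rule additive_comp[OF additive_word_mult_left additive_word_mult_left])
  fix u :: "'a list" and a :: 'b
  let ?u = "single u a"
  show "word_mult (word_mult ?u g) h = word_mult ?u (word_mult g h)"
  proof (rule additive_eqI[of "\<lambda>g. word_mult (word_mult ?u g) h" "\<lambda>g. word_mult ?u (word_mult g h)" g UNIV])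
    show "additive (\<lambda>g. word_mult (word_mult ?u g) h)"
      by (rule additive_comp[OF additive_word_mult_left additive_word_mult_right])
    show "additive (\<lambda>g. word_mult ?u (word_mult g h))"
      by (rule additive_comp[OF additive_word_mult_right additive_word_mult_left])
    fix v :: "'a list" and b :: 'b
    let ?v = "single v b"
    show "word_mult (word_mult ?u ?v) h = word_mult ?u (word_mult ?v h)"
    proof (rule additive_eqI[of "word_mult (word_mult ?u ?v)" "\<lambda>h. word_mult ?u (word_mult ?v h)" h UNIV])
      show "additive (\<lambda>h. word_mult ?u (word_mult ?v h))"
        by (rule additive_comp[OF additive_word_mult_right additive_word_mult_right])
    qed (simp_all add: additive_word_mult_right mult.assoc del: word_mult_single,
        simp add: mult.assoc)
  qed simp
qed (simp_all add: additive_word_mult_left)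

lemma word_mult_one [simp]:
  "word_mult (single [] 1) f = f" "word_mult f (single [] 1) = f"
proof -
  have id: "additive (\<lambda>f::'a list \<Rightarrow>\<^sub>0 'b. f)" by (simp add: additive_def)
  show "word_mult (single [] 1) f = f"
    by (rule additive_eqI[OF additive_word_mult_right id, of f UNIV]) auto
  show "word_mult f (single [] 1) = f"
    by (rule additive_eqI[OF additive_word_mult_left id, of f UNIV]) auto
qed

lemma keys_word_mult:
  assumes "\<And>u v. u \<in> keys f \<Longrightarrow> v \<in> keys g \<Longrightarrow> u @ v \<in> B"
  shows "keys (word_mult f g) \<subseteq> B"
  unfolding word_mult_def using assms by (intro keys_lin_ext_subset) auto

lemma word_mult_lists:
  assumes "keys f \<subseteq> lists S" "keys g \<subseteq> lists S"
  shows "keys (word_mult f g) \<subseteq> lists S"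
  by (rule keys_word_mult) (meson assms append_in_lists_conv subsetD)

lemma tensor_alg_sel [simp]:
  "carrier (tensor_alg S) = {f. keys f \<subseteq> lists S}"
  "f \<otimes>\<^bsub>tensor_alg S\<^esub> g = word_mult f g"
  "\<one>\<^bsub>tensor_alg S\<^esub> = single [] 1"
  "\<zero>\<^bsub>tensor_alg S\<^esub> = 0"
  "f \<oplus>\<^bsub>tensor_alg S\<^esub> g = f + g"
  "k \<odot>\<^bsub>tensor_alg S\<^esub> f = scale k f"
  by (simp_all add: tensor_alg_def word_mult_def)

lemma ring_tensor_alg: "ring (tensor_alg S :: ('k::comm_ring_1, 'x list \<Rightarrow>\<^sub>0 'k) module)" (is "ring ?T")
proof (rule ringI)
  show "abelian_group ?T"
  proof (rule abelian_groupI)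
    fix f assume "f \<in> carrier ?T"
    then show "\<exists>g\<in>carrier ?T. g \<oplus>\<^bsub>?T\<^esub> f = \<zero>\<^bsub>?T\<^esub>"
      by (intro bexI[of _ "- f"]) (auto simp: in_keys_iff subset_iff)
  qed (simp_all add: keys_add_subset add.assoc add.commute)
  show "Group.monoid ?T"
    by (rule monoidI) (simp_all add: word_mult_assoc word_mult_lists)
qed (simp_all add: additive.add[OF additive_word_mult_left] additive.add[OF additive_word_mult_right])

lemma a_minus_tensor_alg:
  assumes "f \<in> carrier (tensor_alg S)" "g \<in> carrier (tensor_alg S)"
  shows "f \<ominus>\<^bsub>tensor_alg S\<^esub> g = f - g"
proof -
  interpret ring "tensor_alg S" by (rule ring_tensor_alg)
  have "f - g \<in> carrier (tensor_alg S)" using assms by (simp add: keys_diff_subset)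
  moreover have "f = (f - g) \<oplus>\<^bsub>tensor_alg S\<^esub> g" by simp
  ultimately show ?thesis using assms by (metis add.inv_solve_right' minus_eq)
qed

definition wordwise :: "('x list \<Rightarrow> 'k \<Rightarrow> 'l) \<Rightarrow> ('x list \<Rightarrow>\<^sub>0 'k::comm_ring_1) \<Rightarrow> ('x list \<Rightarrow>\<^sub>0 'l::comm_ring_1)"
  where "wordwise h f = (\<Sum>w\<in>keys f. single w (h w (lookup f w)))"

lemma lookup_wordwise:
  assumes "\<And>w. additive (h w)"
  shows "lookup (wordwise h f) w = h w (lookup f w)"
  using additive.zero[OF assms]
  by (simp add: wordwise_def lookup_sum lookup_single when_def sum.delta in_keys_iff)

lemma keys_wordwise: "keys (wordwise h f) \<subseteq> keys f"
  unfolding wordwise_def by (rule keys_sum_subset) auto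

lemma wordwise_single:
  assumes "\<And>w. additive (h w)"
  shows "wordwise h (single w c) = single w (h w c)"
  using additive.zero[OF assms]
  by (intro poly_mapping_eqI) (auto simp: lookup_wordwise[OF assms] lookup_single when_def)

lemma additive_wordwise:
  assumes "\<And>w. additive (h w)"
  shows "additive (wordwise h)"
  by standard (rule poly_mapping_eqI, simp add: lookup_wordwise[OF assms] lookup_add additive.add[OF assms])

section \<open>Braidings on words\<close>

lemma transpositionsE:
  assumes "\<tau> \<in> transpositions n"
  obtains i j where "\<tau> = transpose i j" "1 \<le> i" "i < j" "j \<le> n"
  using assms by (auto simp: transpositions_def)

lemma transposition_permutes: "\<tau> \<in> transpositions n \<Longrightarrow> \<tau> permutes {1..n}"
  by (elim transpositionsE) (auto intro: permutes_swap_id)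

lemma transposition_bij: "\<tau> \<in> transpositions n \<Longrightarrow> bij \<tau>"
  using transposition_permutes permutes_bij by blast

lemma conj_perm_comp: "bij \<sigma> \<Longrightarrow> conj_perm \<sigma> \<tau> \<circ> \<sigma> = \<sigma> \<circ> \<tau>"
  by (simp add: conj_perm_def comp_assoc bij_is_inj)

lemma conj_perm_conj_perm:
  "bij \<rho> \<Longrightarrow> bij \<sigma> \<Longrightarrow> conj_perm \<rho> (conj_perm \<sigma> \<tau>) = conj_perm (\<rho> \<circ> \<sigma>) \<tau>"
  by (simp add: conj_perm_def comp_assoc o_inv_distrib)

lemma conj_perm_transpose:
  assumes "bij \<sigma>" shows "conj_perm \<sigma> (transpose i j) = transpose (\<sigma> i) (\<sigma> j)"
proof -
  have "\<sigma> \<circ> transpose i j = transpose (\<sigma> i) (\<sigma> j) \<circ> \<sigma>"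
    using transpose_comp_eq[OF assms, of "\<sigma> i" "\<sigma> j"] assms by (simp add: bij_is_inj)
  then show ?thesis
    using assms by (simp add: conj_perm_def comp_assoc bij_is_surj surj_iff[THEN iffD1])
qed

lemma transpose_transpositions:
  assumes "a \<in> {1..n}" "b \<in> {1..n}" "a \<noteq> b"
  shows "transpose a b \<in> transpositions n"
proof (cases "a < b")
  case True
  then show ?thesis using assms by (auto simp: transpositions_def)
next
  case False
  then have "transpose b a \<in> transpositions n" using assms by (force simp: transpositions_def)
  then show ?thesis by (simp add: transpose_commute)
qed

lemma conj_perm_transpositions:
  assumes "\<sigma> permutes {1..n}" "\<tau> \<in> transpositions n"
  shows "conj_perm \<sigma> \<tau> \<in> transpositions n"
proof -
  obtain i j where ij: "\<tau> = transpose i j" "1 \<le> i" "i < j" "j \<le> n"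
    using assms(2) by (rule transpositionsE)
  have "\<sigma> i \<in> {1..n}" "\<sigma> j \<in> {1..n}"
    using permutes_in_image[OF assms(1)] ij by auto
  moreover have "\<sigma> i \<noteq> \<sigma> j"
    using permutes_inj[OF assms(1)] ij(3) by (auto dest: injD)
  ultimately show ?thesis
    using transpose_transpositions conj_perm_transpose[OF permutes_bij[OF assms(1)]] ij(1) by auto
qed

lemma conj_perm_transposition_closed:
  "\<sigma> \<in> transpositions n \<Longrightarrow> \<tau> \<in> transpositions n \<Longrightarrow> conj_perm \<sigma> \<tau> \<in> transpositions n"
  using conj_perm_transpositions transposition_permutes by blast

definition words :: "nat \<Rightarrow> nat \<Rightarrow> perm list set"
  where "words n m = {w \<in> lists (transpositions n). length w = m}"

lemma degree_part_lookup:
  "lookup (degree_part m f) w = (if length w = m then lookup f w else 0)"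
proof -
  have "lookup (degree_part m f) w =
    (\<Sum>v\<in>keys f. if v = w then (if length w = m then lookup f w else 0) else 0)"
    unfolding degree_part_def lookup_lin_ext by (intro sum.cong) (auto simp: lookup_single when_def)
  then show ?thesis by (simp add: in_keys_iff)
qed

lemma additive_degree_part: "additive (degree_part m)"
  unfolding degree_part_def by (rule additive_lin_ext)

lemma degree_part_single:
  "degree_part m (single w c) = (if length w = m then single w c else 0)"
  by (simp add: degree_part_def scale_simps)

lemma keys_degree_part: "keys f \<subseteq> lists (transpositions n) \<Longrightarrow> keys (degree_part m f) \<subseteq> words n m"
  by (auto simp: words_def in_keys_iff degree_part_lookup subset_iff split: if_splits)

lemma additive_braiding: "additive (braiding q i)"
  unfolding braiding_def by (rule additive_lin_ext)

text \<open>A position in a word is given below by splitting the word there, so that the list updates in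
  the braiding disappear.\<close>

lemma braiding_split:
  "braiding q (Suc (length u)) (single (u @ x # y # v) c) =
    single (u @ conj_perm x y # x # v) (c * q (x, y))"
  by (simp add: braiding_def nth_append list_update_append)

lemma words_split:
  assumes "w \<in> words n m" "1 \<le> i" "i < m"
  obtains u x y v where "w = u @ x # y # v" "i = Suc (length u)"
    "x \<in> transpositions n" "y \<in> transpositions n" "u \<in> lists (transpositions n)" "v \<in> lists (transpositions n)"
proof -
  have len: "length w = m" using assms by (simp add: words_def)
  have "w = take (i - 1) w @ drop (i - 1) w" by simp
  also have "drop (i - 1) w = w ! (i - 1) # drop i w"
    using assms len Cons_nth_drop_Suc[of "i - 1" w] by simp
  also have "drop i w = w ! i # drop (Suc i) w"
    using assms len Cons_nth_drop_Suc[of i w] by simp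
  finally have w: "w = take (i - 1) w @ w ! (i - 1) # w ! i # drop (Suc i) w" .
  moreover have "i = Suc (length (take (i - 1) w))" using assms len by simp
  moreover have "set w \<subseteq> transpositions n" using assms by (auto simp: words_def)
  moreover have "w ! (i - 1) \<in> set w" "w ! i \<in> set w" using assms len by auto
  ultimately show ?thesis
    using set_take_subset[of "i - 1" w] set_drop_subset[of "Suc i" w]
    by (intro that[of "take (i - 1) w" "w ! (i - 1)" "w ! i" "drop (Suc i) w"]) blast+
qed

definition braid_word :: "(perm \<times> perm \<Rightarrow> 'k) \<Rightarrow> nat list \<Rightarrow> (perm list \<Rightarrow>\<^sub>0 'k) \<Rightarrow> (perm list \<Rightarrow>\<^sub>0 'k::comm_ring_1)"
  where "braid_word q is = foldr (\<lambda>i \<Phi>. braiding q i \<circ> \<Phi>) is id"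

lemma braid_word_simps [simp]:
  "braid_word q [] f = f" "braid_word q (i # is) f = braiding q i (braid_word q is f)"
  by (simp_all add: braid_word_def)

lemma braid_word_append: "braid_word q (is @ js) f = braid_word q is (braid_word q js f)"
  by (induction "is") auto

lemma additive_braid_word: "additive (braid_word q is)"
proof (induction "is")
  case (Cons i "is")
  then show ?case using additive_comp[OF additive_braiding Cons] by (simp add: additive_def)
qed (simp add: additive_def)

lemma keys_braiding:
  assumes "keys f \<subseteq> words n m" "1 \<le> i" "i < m"
  shows "keys (braiding q i f) \<subseteq> words n m"
  unfolding braiding_def
proof (rule keys_lin_ext_subset)
  fix w assume "w \<in> keys f"
  then have "w \<in> words n m" using assms(1) by blast
  then obtain u x y v where *: "w = u @ x # y # v" "i = Suc (length u)"
    "x \<in> transpositions n" "y \<in> transpositions n" "u \<in> lists (transpositions n)" "v \<in> lists (transpositions n)"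
    using assms(2,3) by (rule words_split)
  have "u @ conj_perm x y # x # v \<in> words n m"
    using \<open>w \<in> words n m\<close> * conj_perm_transposition_closed by (auto simp: words_def)
  then show "keys (let \<tau> = w ! (i - 1); \<upsilon> = w ! i in
     single (w[i - 1 := conj_perm \<tau> \<upsilon>, i := \<tau>]) (q (\<tau>, \<upsilon>))) \<subseteq> words n m"
    using * by (simp add: nth_append list_update_append)
qed

lemma keys_braid_word:
  assumes "keys f \<subseteq> words n m" "set is \<subseteq> {1..<m}"
  shows "keys (braid_word q is f) \<subseteq> words n m"
  using assms(2)
proof (induction "is")
  case (Cons i "is")
  then show ?case using keys_braiding[of "braid_word q is f" n m i q] by simp
qed (simp add: assms(1))

lemma braiding_commute:
  assumes f: "keys f \<subseteq> words n m" and i: "1 \<le> i" "Suc i < j" "j < m"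
  shows "braiding q i (braiding q j f) = braiding q j (braiding q i f)"
proof (rule additive_eqI[of "\<lambda>f. braiding q i (braiding q j f)" "\<lambda>f. braiding q j (braiding q i f)" f "words n m"])
  fix w :: "perm list" and c :: 'a assume w: "w \<in> words n m"
  have "1 \<le> i" "i < m" using i by auto
  with w obtain u x y v where 1: "w = u @ x # y # v" "i = Suc (length u)"
    by (rule words_split)
  have "length w = m" using w by (simp add: words_def)
  define k where "k = j - i - 2"
  have k: "Suc k < length v" "j = Suc (length u + 2 + k)"
    using \<open>length w = m\<close> 1 i by (auto simp: k_def)
  define v1 v2 where "v1 = take k v" and "v2 = drop (Suc (Suc k)) v"
  have v: "v = v1 @ v ! k # v ! Suc k # v2"
    using k(1) by (simp add: v1_def v2_def Cons_nth_drop_Suc id_take_nth_drop[symmetric])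
  have k': "length v1 = k" using k by (simp add: v1_def)
  have A: "braiding q j (single (u @ a # b # v) c) =
    single (u @ a # b # v1 @ conj_perm (v ! k) (v ! Suc k) # v ! k # v2) (c * q (v ! k, v ! Suc k))" for a b c
    using braiding_split[of q "u @ a # b # v1" "v ! k" "v ! Suc k" v2 c] v k k' by simp
  show "braiding q i (braiding q j (single w c)) = braiding q j (braiding q i (single w c))"
    unfolding 1 by (simp only: A braiding_split mult.assoc) (simp only: mult.commute)
qed (use f in \<open>simp_all add: additive_comp[OF additive_braiding additive_braiding]\<close>)

text \<open>The conditions on \<open>q\<close> under which the braiding satisfies the braid relation; it is a consequence of
  the cocycle condition for the action of the symmetric group.\<close>

locale rack_cocycle =
  fixes n :: nat and q :: "perm \<times> perm \<Rightarrow> 'k::comm_ring_1"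
  assumes rack_cocycle: "x \<in> transpositions n \<Longrightarrow> y \<in> transpositions n \<Longrightarrow> z \<in> transpositions n \<Longrightarrow>
    q (x, z) * q (conj_perm x y, conj_perm x z) = q (y, z) * q (x, conj_perm y z)"
begin

lemma braiding_braid:
  assumes f: "keys f \<subseteq> words n m" and i: "1 \<le> i" "Suc i < m"
  shows "braiding q i (braiding q (Suc i) (braiding q i f)) =
    braiding q (Suc i) (braiding q i (braiding q (Suc i) f))"
proof (rule additive_eqI[of "\<lambda>f. braiding q i (braiding q (Suc i) (braiding q i f))"
      "\<lambda>f. braiding q (Suc i) (braiding q i (braiding q (Suc i) f))" f "words n m"])
  fix w :: "perm list" and c :: 'k assume w: "w \<in> words n m"
  have "1 \<le> i" "i < m" using i by auto
  with w obtain u x y v' where 1: "w = u @ x # y # v'" "i = Suc (length u)"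
    "x \<in> transpositions n" "y \<in> transpositions n" "v' \<in> lists (transpositions n)"
    by (rule words_split)
  moreover have "length w = m" using w by (simp add: words_def)
  ultimately obtain z v where v': "v' = z # v" using i by (cases v') auto
  have z: "z \<in> transpositions n" using 1 v' by auto
  have A: "braiding q (Suc i) (single (u @ a # b # d # v) e) =
    single (u @ a # conj_perm b d # b # v) (e * q (b, d))" for a b d e
    using braiding_split[of q "u @ [a]" b d v e] 1 by simp
  have bij: "bij x" "bij y" using 1 transposition_bij by auto
  have "bij (conj_perm x y)" using 1 conj_perm_transposition_closed transposition_bij by blast
  then have conj: "conj_perm (conj_perm x y) (conj_perm x z) = conj_perm x (conj_perm y z)"
    using bij by (simp add: conj_perm_conj_perm conj_perm_comp)
  have "c * q (x, y) * q (x, z) * q (conj_perm x y, conj_perm x z) =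
    c * q (x, y) * (q (x, z) * q (conj_perm x y, conj_perm x z))" by (simp add: mult.assoc)
  also have "\<dots> = c * q (y, z) * q (x, conj_perm y z) * q (x, y)"
    using rack_cocycle[OF 1(3,4) z] by (simp add: mult.assoc mult.commute mult.left_commute)
  finally show "braiding q i (braiding q (Suc i) (braiding q i (single w c))) =
    braiding q (Suc i) (braiding q i (braiding q (Suc i) (single w c)))"
    unfolding 1(1,2) v' by (simp only: A[unfolded 1(2)] braiding_split conj)
qed (use f in \<open>simp_all add: additive_comp[OF additive_braiding additive_comp[OF additive_braiding additive_braiding]]\<close>)

lemma braid_congruence_braid_word:
  "braid_congruence {1..<m} (\<lambda>is js. \<forall>f. keys f \<subseteq> words n m \<longrightarrow> braid_word q is f = braid_word q js f)"
proof (unfold_locales, goal_cases)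
  case (5 i j ks)
  show ?case
  proof (intro allI impI)
    fix f :: "perm list \<Rightarrow>\<^sub>0 'k" assume "keys f \<subseteq> words n m"
    then have "keys (braid_word q ks f) \<subseteq> words n m" using keys_braid_word 5 by blast
    then show "braid_word q (i # j # ks) f = braid_word q (j # i # ks) f"
      using braiding_commute[of _ n m i j q] 5 by simp
  qed
next
  case (6 i ks)
  show ?case
  proof (intro allI impI)
    fix f :: "perm list \<Rightarrow>\<^sub>0 'k" assume "keys f \<subseteq> words n m"
    then have "keys (braid_word q ks f) \<subseteq> words n m" using keys_braid_word 6 by blast
    then show "braid_word q (i # Suc i # i # ks) f = braid_word q (Suc i # i # Suc i # ks) f"
      using braiding_braid[of _ m i] 6 by simp
  qed
qed simp_all

lemma braid_word_ascending_cong: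
  assumes "ascending is" "ascending js" "set is \<subseteq> {1..<m}" "set js \<subseteq> {1..<m}"
    "word_perm_of is = word_perm_of js" "keys f \<subseteq> words n m"
  shows "braid_word q is f = braid_word q js f"
  using braid_congruence.matsumoto[OF braid_congruence_braid_word assms(1-4)] assms(5,6)
  by (simp add: word_perm_of_eq_iff)

text \<open>The choice of a reduced expression in \<open>braid_perm\<close> does not matter.\<close>

lemma braid_perm_word_perm_of:
  assumes "ascending is" "set is \<subseteq> {1..<m}" "keys f \<subseteq> words n m"
  shows "braid_perm q m (word_perm_of is) f = braid_word q is f"
proof -
  have expr: "is_expression m \<sigma> js \<longleftrightarrow> set js \<subseteq> {1..<m} \<and> \<sigma> = word_perm_of js" for \<sigma> js
    by (simp add: is_expression_def word_perm_of_def)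
  have red: "is_reduced m (word_perm_of is) js \<longleftrightarrow> minimal_word {1..<m} js \<and> word_perm_of js = word_perm_of is" for js
    unfolding is_reduced_def expr minimal_word_def word_perm_of_eq_iff by metis
  let ?js = "SOME js. is_reduced m (word_perm_of is) js"
  have "\<exists>js. is_reduced m (word_perm_of is) js"
    using ex_minimal_word[OF assms(2)] by (auto simp: red word_perm_of_eq_iff)
  then have "is_reduced m (word_perm_of is) ?js" by (rule someI_ex)
  then have "ascending ?js" "set ?js \<subseteq> {1..<m}" "word_perm_of ?js = word_perm_of is"
    using minimal_word_ascending by (auto simp: red minimal_word_def)
  then have "braid_word q ?js f = braid_word q is f"
    using braid_word_ascending_cong assms by blast
  then show ?thesis by (simp add: braid_perm_def braid_word_def)
qed

end

section \<open>Kernels of the braided factorials form an ideal\<close>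

lemma braiding_scale: "braiding q i (scale k f) = scale k (braiding q i f)"
  unfolding braiding_def by (rule lin_ext_scale)

lemma braid_word_scale: "braid_word q is (scale k f) = scale k (braid_word q is f)"
  by (induction "is") (simp_all add: braiding_scale)

lemma braid_perm_eq_braid_word: "braid_perm q m \<sigma> = braid_word q (SOME is. is_reduced m \<sigma> is)"
  by (simp add: fun_eq_iff braid_perm_def braid_word_def)

lemma additive_braided_factorial: "additive (braided_factorial q m)"
  unfolding braided_factorial_def braid_perm_eq_braid_word
  by (simp add: additive_def sum.distrib additive.add[OF additive_braid_word])

lemma braided_factorial_scale: "braided_factorial q m (scale k f) = scale k (braided_factorial q m f)"
  by (simp add: braided_factorial_def braid_perm_eq_braid_word braid_word_scale additive.sum[OF additive_scale])

lemma degree_part_scale: "degree_part m (scale k f) = scale k (degree_part m f)"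
  unfolding degree_part_def by (rule lin_ext_scale)

lemma braiding_word_mult_right:
  assumes "keys f \<subseteq> words n m" "1 \<le> i" "i < m"
  shows "braiding q i (word_mult f (single v 1)) = word_mult (braiding q i f) (single v 1)"
proof (rule additive_eqI[OF _ _ assms(1)])
  fix w :: "perm list" and c :: 'a assume "w \<in> words n m"
  then obtain u x y u' where *: "w = u @ x # y # u'" "i = Suc (length u)"
    using assms(2,3) by (rule words_split)
  show "braiding q i (word_mult (single w c) (single v 1)) =
    word_mult (braiding q i (single w c)) (single v 1)"
    unfolding * by (simp add: braiding_split)
qed (rule additive_comp[OF additive_braiding additive_word_mult_left]
    additive_comp[OF additive_word_mult_left additive_braiding])+

lemma braiding_word_mult_left:
  assumes "keys f \<subseteq> words n m" "1 \<le> i" "i < m"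
  shows "braiding q (Suc i) (word_mult (single [z] 1) f) = word_mult (single [z] 1) (braiding q i f)"
proof (rule additive_eqI[OF _ _ assms(1)])
  fix w :: "perm list" and c :: 'a assume "w \<in> words n m"
  then obtain u x y u' where *: "w = u @ x # y # u'" "i = Suc (length u)"
    using assms(2,3) by (rule words_split)
  show "braiding q (Suc i) (word_mult (single [z] 1) (single w c)) =
    word_mult (single [z] 1) (braiding q i (single w c))"
    unfolding * using braiding_split[of q "z # u" x y u' c] by (simp add: braiding_split)
qed (rule additive_comp[OF additive_braiding additive_word_mult_right]
    additive_comp[OF additive_word_mult_right additive_braiding])+

lemma braid_word_word_mult_right:
  assumes "keys f \<subseteq> words n m" "set is \<subseteq> {1..<m}"
  shows "braid_word q is (word_mult f (single v 1)) = word_mult (braid_word q is f) (single v 1)"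
  using assms(2)
proof (induction "is")
  case (Cons i "is")
  then show ?case
    using braiding_word_mult_right[OF keys_braid_word[OF assms(1)], of "is" i q q v] by simp
qed simp

lemma braid_word_word_mult_left:
  assumes "keys f \<subseteq> words n m" "set is \<subseteq> {1..<m}"
  shows "braid_word q (map Suc is) (word_mult (single [z] 1) f) =
    word_mult (single [z] 1) (braid_word q is f)"
  using assms(2)
proof (induction "is")
  case (Cons i "is")
  then show ?case
    using braiding_word_mult_left[OF keys_braid_word[OF assms(1)], of "is" i q z q] by simp
qed simp

definition asc_word :: "nat \<Rightarrow> perm \<Rightarrow> nat list"
  where "asc_word m \<sigma> = (SOME is. ascending is \<and> set is \<subseteq> {1..<m} \<and> word_perm_of is = \<sigma>)"

lemma asc_word:
  assumes "\<sigma> permutes {1..m}"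
  shows "ascending (asc_word m \<sigma>)" "set (asc_word m \<sigma>) \<subseteq> {1..<m}" "word_perm_of (asc_word m \<sigma>) = \<sigma>"
proof -
  obtain ws where ws: "set ws \<subseteq> {1..<m}" "word_perm_of ws = \<sigma>" using ex_word[OF assms] by blast
  obtain "is" where "ascending is" "set is \<subseteq> {1..<m}" "word_inv is = word_inv ws"
    using ws(1) by (rule ex_ascending)
  then have "\<exists>is. ascending is \<and> set is \<subseteq> {1..<m} \<and> word_perm_of is = \<sigma>"
    using ws by (auto simp flip: word_perm_of_eq_iff)
  from someI_ex[OF this]
  show "ascending (asc_word m \<sigma>)" "set (asc_word m \<sigma>) \<subseteq> {1..<m}" "word_perm_of (asc_word m \<sigma>) = \<sigma>"
    unfolding asc_word_def by blast+
qed

lemma word_inv_map_Suc: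
  assumes "set is \<subseteq> {1..<m}"
  shows "word_inv (map Suc is) 0 = 0" "word_inv (map Suc is) (Suc x) = Suc (word_inv is x)"
    "word_inv is 0 = 0"
  using assms by (induction "is" arbitrary: x) (auto simp: transpose_def)

lemma ascending_map_Suc: "set is \<subseteq> {1..<m} \<Longrightarrow> ascending (map Suc is) = ascending is"
  by (induction "is") (auto simp: word_inv_map_Suc)

lemma word_inv_upt: "word_inv [k..<m] x = (if k \<le> m then if x < k \<or> m < x then x else if x = k then m else x - 1 else x)"
proof (induction "m - k" arbitrary: k x)
  case (Suc d)
  then have "[k..<m] = k # [Suc k..<m]" by (simp add: upt_conv_Cons)
  then show ?case using Suc(1)[of "Suc k"] Suc(2) by (auto simp: transpose_def)
qed auto

lemma word_inv_rev_upt: "word_inv (rev [Suc 0..<k]) x = (if x = 0 \<or> k < x then x else if x = k then 1 else Suc x)"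
  if "1 \<le> k"
  using that
proof (induction k arbitrary: x rule: dec_induct)
  case base
  then show ?case by auto
next
  case (step k)
  then have "rev [Suc 0..<Suc k] = k # rev [Suc 0..<k]" by simp
  then show ?case using step by (auto simp: transpose_def)
qed

text \<open>The product \<open>s\<^sub>k \<dots> s\<^sub>m\<close> moves \<open>m + 1\<close> to \<open>k\<close> and keeps the order of all other points. It is therefore the
  shortest element of its coset of the symmetric group on \<open>m\<close> points, and lengths add up.\<close>

lemma ascending_append_upt:
  assumes "ascending is" "set is \<subseteq> {1..<m}"
  shows "ascending ([k..<Suc m] @ is)"
proof (induction "Suc m - k" arbitrary: k)
  case 0
  then show ?case using assms by simp
next
  case (Suc d)
  then have "[k..<Suc m] = k # [Suc k..<Suc m]" by (intro upt_conv_Cons) simp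
  moreover have "ascending ([Suc k..<Suc m] @ is)" using Suc(1)[of "Suc k"] Suc(2) by (simp del: upt_Suc)
  moreover have "word_inv ([Suc k..<Suc m] @ is) k = word_inv is k"
    by (simp add: word_inv_append word_inv_upt del: upt_Suc)
  moreover have "word_inv ([Suc k..<Suc m] @ is) (Suc k) = Suc m"
  proof -
    have "k \<le> m" using Suc(2) by simp
    then show ?thesis using word_inv_fixes[OF assms(2), of "Suc m"]
      by (simp add: word_inv_append word_inv_upt del: upt_Suc)
  qed
  moreover have "word_inv is k < Suc m"
  proof (cases "k \<in> {1..m}")
    case True
    have "word_inv is permutes {1..m}"
      using permutes_inv[OF word_perm_of_permutes[OF assms(2)]] by (simp add: word_inv_eq_inv)
    then show ?thesis using True permutes_in_image[of "word_inv is" "{1..m}" k] by simp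
  next
    case False
    then show ?thesis using word_inv_fixes[OF assms(2), of k] Suc by auto
  qed
  ultimately show ?case by simp
qed

text \<open>The mirror image: \<open>s\<^bsub>k-1\<^esub> \<dots> s\<^sub>1\<close> moves \<open>1\<close> to \<open>k\<close>, and the symmetric group on \<open>m\<close> points is embedded as the
  stabiliser of \<open>1\<close>.\<close>

lemma ascending_append_rev_upt:
  assumes "ascending is" "set is \<subseteq> {1..<m}"
  shows "ascending (rev [1..<k] @ map Suc is)"
proof (cases "1 \<le> k")
  case True
  then show ?thesis
  proof (induction k rule: dec_induct)
    case base
    then show ?case using assms by (simp add: ascending_map_Suc)
  next
    case (step k)
    then have "rev [1..<Suc k] = k # rev [1..<k]" by simp
    moreover have "word_inv (rev [1..<k] @ map Suc is) k = 1"
      using step word_inv_map_Suc(2)[OF assms(2), of 0] word_inv_map_Suc(3)[OF assms(2)]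
      by (simp add: word_inv_append word_inv_rev_upt)
    moreover have "word_inv (rev [1..<k] @ map Suc is) (Suc k) = Suc (word_inv is k)"
      using step word_inv_map_Suc(2)[OF assms(2), of k]
      by (simp add: word_inv_append word_inv_rev_upt)
    moreover have "word_inv is k \<noteq> 0"
      using step word_inv_map_Suc(3)[OF assms(2)] bij_word_inv[of "is"]
      by (metis bij_is_inj inj_eq not_one_le_zero)
    ultimately show ?case using step by simp
  qed
qed (use assms in \<open>simp add: ascending_map_Suc\<close>)

context rack_cocycle
begin

lemma braided_factorial_asc_word:
  assumes "keys f \<subseteq> words n m"
  shows "braided_factorial q m f = (\<Sum>\<sigma> | \<sigma> permutes {1..m}. braid_word q (asc_word m \<sigma>) f)"
  unfolding braided_factorial_def sym_group_def
  using braid_perm_word_perm_of[OF asc_word(1,2) assms] asc_word(3)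
  by (intro sum.cong) auto

text \<open>The factorisation of \<open>[m + 1]!\<close> along representatives \<open>c k\<close> of the cosets of a copy of the symmetric group
  on \<open>m\<close> letters, embedded by \<open>s\<close>. Since there are as many pairs of a coset and an element of the
  subgroup as permutations, injectivity suffices.\<close>

lemma braided_factorial_Suc:
  assumes f: "keys f \<subseteq> words n (Suc m)"
    and sub: "\<And>k \<sigma>. k \<in> {1..Suc m} \<Longrightarrow> \<sigma> permutes {1..m} \<Longrightarrow> set (c k @ s (asc_word m \<sigma>)) \<subseteq> {1..<Suc m}"
    and asc: "\<And>k \<sigma>. k \<in> {1..Suc m} \<Longrightarrow> \<sigma> permutes {1..m} \<Longrightarrow> ascending (c k @ s (asc_word m \<sigma>))"
    and inj: "inj_on (\<lambda>(k, \<sigma>). word_perm_of (c k @ s (asc_word m \<sigma>))) ({1..Suc m} \<times> {\<sigma>. \<sigma> permutes {1..m}})"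
  shows "braided_factorial q (Suc m) f =
    (\<Sum>k\<in>{1..Suc m}. braid_word q (c k) (\<Sum>\<sigma> | \<sigma> permutes {1..m}. braid_word q (s (asc_word m \<sigma>)) f))"
proof -
  let ?\<phi> = "\<lambda>(k, \<sigma>). word_perm_of (c k @ s (asc_word m \<sigma>))"
  let ?P = "{1..Suc m} \<times> {\<sigma>. \<sigma> permutes {1..m}}"
  have fin: "finite {\<sigma>. \<sigma> permutes {1..Suc m}}" by (simp add: finite_permutations)
  have "?\<phi> ` ?P \<subseteq> {\<sigma>. \<sigma> permutes {1..Suc m}}"
    using word_perm_of_permutes[OF sub] by auto
  moreover have "card (?\<phi> ` ?P) = card {\<sigma>. \<sigma> permutes {1..Suc m}}"
    unfolding card_image[OF inj] card_cartesian_product by (simp add: card_permutations)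
  ultimately have im: "?\<phi> ` ?P = {\<sigma>. \<sigma> permutes {1..Suc m}}"
    using card_subset_eq[OF fin] by blast
  have "braided_factorial q (Suc m) f = (\<Sum>\<pi>\<in>?\<phi> ` ?P. braid_word q (asc_word (Suc m) \<pi>) f)"
    unfolding braided_factorial_asc_word[OF f] im ..
  also have "\<dots> = (\<Sum>(k, \<sigma>)\<in>?P. braid_word q (c k @ s (asc_word m \<sigma>)) f)"
    unfolding sum.reindex[OF inj]
  proof (intro sum.cong, goal_cases)
    case (2 x)
    then obtain k \<sigma> where x: "x = (k, \<sigma>)" "k \<in> {1..Suc m}" "\<sigma> permutes {1..m}" by auto
    let ?w = "c k @ s (asc_word m \<sigma>)"
    have "word_perm_of ?w permutes {1..Suc m}" using word_perm_of_permutes[OF sub] x by blast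
    then have "braid_word q (asc_word (Suc m) (word_perm_of ?w)) f = braid_word q ?w f"
      using braid_word_ascending_cong[OF asc_word(1) asc asc_word(2) sub asc_word(3) f] x by blast
    then show ?case using x by simp
  qed simp
  also have "\<dots> = (\<Sum>k\<in>{1..Suc m}. \<Sum>\<sigma> | \<sigma> permutes {1..m}. braid_word q (c k) (braid_word q (s (asc_word m \<sigma>)) f))"
    by (simp add: sum.cartesian_product braid_word_append case_prod_unfold)
  finally show ?thesis by (simp add: additive.sum[OF additive_braid_word])
qed

text \<open>The operators for the subgroup do not touch the last letter and add up to \<open>[m]!\<close> on the others, so
  \<open>[m + 1]!\<close> factors through \<open>[m]! \<otimes> id\<close>. In the same way it factors through \<open>id \<otimes> [m]!\<close>.\<close>

lemma braided_factorial_word_mult_right: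
  assumes f: "keys f \<subseteq> words n m" and "x \<in> transpositions n" and "braided_factorial q m f = 0"
  shows "braided_factorial q (Suc m) (word_mult f (single [x] 1)) = 0"
proof -
  let ?g = "word_mult f (single [x] 1)"
  have g: "keys ?g \<subseteq> words n (Suc m)"
    using f assms(2) by (intro keys_word_mult) (auto simp: words_def)
  have sub: "set ([k..<Suc m] @ asc_word m \<sigma>) \<subseteq> {1..<Suc m}" if "k \<in> {1..Suc m}" "\<sigma> permutes {1..m}" for k \<sigma>
    using asc_word(2)[OF that(2)] that(1) by fastforce
  have "inj_on (\<lambda>(k, \<sigma>). word_perm_of ([k..<Suc m] @ asc_word m \<sigma>)) ({1..Suc m} \<times> {\<sigma>. \<sigma> permutes {1..m}})"
  proof (rule inj_onI, clarify)
    fix k \<sigma> l \<tau> assume k: "k \<in> {1..Suc m}" "l \<in> {1..Suc m}" and p: "\<sigma> permutes {1..m}" "\<tau> permutes {1..m}"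
      and eq: "word_perm_of ([k..<Suc m] @ asc_word m \<sigma>) = word_perm_of ([l..<Suc m] @ asc_word m \<tau>)"
    have last: "word_inv ([k..<Suc m] @ asc_word m \<sigma>) k = Suc m" if "k \<in> {1..Suc m}" "\<sigma> permutes {1..m}" for k \<sigma>
      using that word_inv_fixes[OF asc_word(2)[OF that(2)], of "Suc m"]
      by (simp add: word_inv_append word_inv_upt del: upt_Suc)
    have "word_inv ([k..<Suc m] @ asc_word m \<sigma>) k = word_inv ([k..<Suc m] @ asc_word m \<sigma>) l"
      using last[OF k(1) p(1)] last[OF k(2) p(2)] eq word_perm_of_eq_iff by metis
    then have kl: "k = l" using bij_word_inv bij_is_inj injD by metis
    have "word_perm_of [k..<Suc m] \<circ> \<sigma> = word_perm_of [k..<Suc m] \<circ> \<tau>"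
      using eq kl p by (simp add: word_perm_of_append asc_word(3) del: upt_Suc)
    then have "\<sigma> = \<tau>" using word_inv_word_perm_of(1)[of "[k..<Suc m]"]
      by (metis comp_assoc id_comp)
    with kl show "k = l \<and> \<sigma> = \<tau>" by simp
  qed
  then have "braided_factorial q (Suc m) ?g =
    (\<Sum>k\<in>{1..Suc m}. braid_word q [k..<Suc m] (\<Sum>\<sigma> | \<sigma> permutes {1..m}. braid_word q (asc_word m \<sigma>) ?g))"
    using braided_factorial_Suc[OF g, where c = "\<lambda>k. [k..<Suc m]" and s = "\<lambda>w. w"]
      sub ascending_append_upt[OF asc_word(1,2)] by blast
  also have "(\<Sum>\<sigma> | \<sigma> permutes {1..m}. braid_word q (asc_word m \<sigma>) ?g) =
    word_mult (\<Sum>\<sigma> | \<sigma> permutes {1..m}. braid_word q (asc_word m \<sigma>) f) (single [x] 1)"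
    using braid_word_word_mult_right[OF f asc_word(2)]
    by (simp add: additive.sum[OF additive_word_mult_left])
  finally show ?thesis
    using assms(3) by (simp add: braided_factorial_asc_word[OF f] additive.zero[OF additive_braid_word]
        additive.zero[OF additive_word_mult_left] del: upt_Suc)
qed

lemma braided_factorial_word_mult_left:
  assumes f: "keys f \<subseteq> words n m" and "x \<in> transpositions n" and "braided_factorial q m f = 0"
  shows "braided_factorial q (Suc m) (word_mult (single [x] 1) f) = 0"
proof -
  let ?g = "word_mult (single [x] 1) f"
  have g: "keys ?g \<subseteq> words n (Suc m)"
    using f assms(2) by (intro keys_word_mult) (auto simp: words_def)
  have sub: "set (rev [1..<k] @ map Suc (asc_word m \<sigma>)) \<subseteq> {1..<Suc m}" if "k \<in> {1..Suc m}" "\<sigma> permutes {1..m}" for k \<sigma>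
    using asc_word(2)[OF that(2)] that(1) by fastforce
  have "inj_on (\<lambda>(k, \<sigma>). word_perm_of (rev [1..<k] @ map Suc (asc_word m \<sigma>))) ({1..Suc m} \<times> {\<sigma>. \<sigma> permutes {1..m}})"
  proof (rule inj_onI, clarify)
    fix k \<sigma> l \<tau> assume k: "k \<in> {1..Suc m}" "l \<in> {1..Suc m}" and p: "\<sigma> permutes {1..m}" "\<tau> permutes {1..m}"
      and eq: "word_perm_of (rev [1..<k] @ map Suc (asc_word m \<sigma>)) = word_perm_of (rev [1..<l] @ map Suc (asc_word m \<tau>))"
    have first: "word_inv (rev [1..<k] @ map Suc (asc_word m \<sigma>)) k = 1" if "k \<in> {1..Suc m}" "\<sigma> permutes {1..m}" for k \<sigma>
      using that word_inv_map_Suc(2)[OF asc_word(2)[OF that(2)], of 0] word_inv_map_Suc(3)[OF asc_word(2)[OF that(2)]]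
      by (simp add: word_inv_append word_inv_rev_upt)
    have "word_inv (rev [1..<k] @ map Suc (asc_word m \<sigma>)) k = word_inv (rev [1..<k] @ map Suc (asc_word m \<sigma>)) l"
      using first[OF k(1) p(1)] first[OF k(2) p(2)] eq word_perm_of_eq_iff by metis
    then have kl: "k = l" using bij_word_inv bij_is_inj injD by metis
    have "word_perm_of (rev [1..<k]) \<circ> word_perm_of (map Suc (asc_word m \<sigma>)) =
      word_perm_of (rev [1..<k]) \<circ> word_perm_of (map Suc (asc_word m \<tau>))"
      using eq kl by (simp add: word_perm_of_append)
    then have "word_perm_of (map Suc (asc_word m \<sigma>)) = word_perm_of (map Suc (asc_word m \<tau>))"
      using word_inv_word_perm_of(1)[of "rev [1..<k]"] by (metis comp_assoc id_comp)
    then have "word_inv (map Suc (asc_word m \<sigma>)) (Suc y) = word_inv (map Suc (asc_word m \<tau>)) (Suc y)" for y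
      by (simp add: word_perm_of_eq_iff)
    then have "word_inv (asc_word m \<sigma>) y = word_inv (asc_word m \<tau>) y" for y
      by (simp add: word_inv_map_Suc(2)[OF asc_word(2)[OF p(1)]] word_inv_map_Suc(2)[OF asc_word(2)[OF p(2)]])
    then have "word_perm_of (asc_word m \<sigma>) = word_perm_of (asc_word m \<tau>)"
      by (auto simp: word_perm_of_eq_iff)
    with kl show "k = l \<and> \<sigma> = \<tau>" using asc_word(3)[OF p(1)] asc_word(3)[OF p(2)] by simp
  qed
  then have "braided_factorial q (Suc m) ?g =
    (\<Sum>k\<in>{1..Suc m}. braid_word q (rev [1..<k]) (\<Sum>\<sigma> | \<sigma> permutes {1..m}. braid_word q (map Suc (asc_word m \<sigma>)) ?g))"
    using braided_factorial_Suc[OF g, where c = "\<lambda>k. rev [1..<k]" and s = "map Suc"]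
      sub ascending_append_rev_upt[OF asc_word(1,2)] by blast
  also have "(\<Sum>\<sigma> | \<sigma> permutes {1..m}. braid_word q (map Suc (asc_word m \<sigma>)) ?g) =
    word_mult (single [x] 1) (\<Sum>\<sigma> | \<sigma> permutes {1..m}. braid_word q (asc_word m \<sigma>) f)"
    using braid_word_word_mult_left[OF f asc_word(2)]
    by (simp add: additive.sum[OF additive_word_mult_right])
  finally show ?thesis
    using assms(3) by (simp add: braided_factorial_asc_word[OF f] additive.zero[OF additive_braid_word]
        additive.zero[OF additive_word_mult_right] del: upt_Suc)
qed

lemma nichols_idealD: "f \<in> nichols_ideal n q \<Longrightarrow> keys f \<subseteq> lists (transpositions n)"
  by (simp add: nichols_ideal_def)

lemma nichols_ideal_add: "f \<in> nichols_ideal n q \<Longrightarrow> g \<in> nichols_ideal n q \<Longrightarrow> f + g \<in> nichols_ideal n q"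
  by (simp add: nichols_ideal_def keys_add_subset additive.add[OF additive_degree_part]
      additive.add[OF additive_braided_factorial])

lemma nichols_ideal_zero: "0 \<in> nichols_ideal n q"
  by (simp add: nichols_ideal_def additive.zero[OF additive_degree_part]
      additive.zero[OF additive_braided_factorial])

lemma nichols_ideal_scale: "f \<in> nichols_ideal n q \<Longrightarrow> scale k f \<in> nichols_ideal n q"
  by (simp add: nichols_ideal_def subset_trans[OF keys_scale] degree_part_scale braided_factorial_scale scale_simps)

lemma nichols_ideal_sum: "(\<And>x. x \<in> A \<Longrightarrow> g x \<in> nichols_ideal n q) \<Longrightarrow> sum g A \<in> nichols_ideal n q"
  by (induction A rule: infinite_finite_induct) (auto simp: nichols_ideal_zero nichols_ideal_add)

lemma degree_part_word_mult:
  "degree_part (Suc m) (word_mult f (single [x] 1)) = word_mult (degree_part m f) (single [x] 1)"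
  "degree_part (Suc m) (word_mult (single [x] 1) f) = word_mult (single [x] 1) (degree_part m f)"
  "degree_part 0 (word_mult f (single [x] 1)) = 0"
  "degree_part 0 (word_mult (single [x] 1) f) = 0"
proof -
  show "degree_part (Suc m) (word_mult f (single [x] 1)) = word_mult (degree_part m f) (single [x] 1)"
    by (rule additive_eqI[OF additive_comp[OF additive_degree_part additive_word_mult_left]
          additive_comp[OF additive_word_mult_left additive_degree_part], of f UNIV])
      (auto simp: degree_part_single additive.zero[OF additive_word_mult_left])
  show "degree_part (Suc m) (word_mult (single [x] 1) f) = word_mult (single [x] 1) (degree_part m f)"
    by (rule additive_eqI[OF additive_comp[OF additive_degree_part additive_word_mult_right]
          additive_comp[OF additive_word_mult_right additive_degree_part], of f UNIV])
      (auto simp: degree_part_single additive.zero[OF additive_word_mult_right])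
  have z: "additive (\<lambda>f::'a list \<Rightarrow>\<^sub>0 'b. 0 :: 'a list \<Rightarrow>\<^sub>0 'b)" by (simp add: additive_def)
  show "degree_part 0 (word_mult f (single [x] 1)) = 0"
    by (rule additive_eqI[OF additive_comp[OF additive_degree_part additive_word_mult_left] z, of f UNIV])
      (auto simp: degree_part_single)
  show "degree_part 0 (word_mult (single [x] 1) f) = 0"
    by (rule additive_eqI[OF additive_comp[OF additive_degree_part additive_word_mult_right] z, of f UNIV])
      (auto simp: degree_part_single)
qed

lemma nichols_ideal_letter:
  assumes "f \<in> nichols_ideal n q" "x \<in> transpositions n"
  shows "word_mult f (single [x] 1) \<in> nichols_ideal n q"
    "word_mult (single [x] 1) f \<in> nichols_ideal n q"
proof -
  have f: "keys f \<subseteq> lists (transpositions n)"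
    and zero: "\<And>m. braided_factorial q m (degree_part m f) = 0"
    using assms(1) by (auto simp: nichols_ideal_def)
  have x: "keys (single [x] 1) \<subseteq> lists (transpositions n)"
    using assms(2) by simp
  have "braided_factorial q m (degree_part m (word_mult f (single [x] 1))) = 0" for m
    using braided_factorial_word_mult_right[OF keys_degree_part[OF f] assms(2) zero]
    by (cases m) (simp_all add: degree_part_word_mult additive.zero[OF additive_braided_factorial])
  then show "word_mult f (single [x] 1) \<in> nichols_ideal n q"
    using word_mult_lists[OF f x] by (simp add: nichols_ideal_def)
  have "braided_factorial q m (degree_part m (word_mult (single [x] 1) f)) = 0" for m
    using braided_factorial_word_mult_left[OF keys_degree_part[OF f] assms(2) zero]
    by (cases m) (simp_all add: degree_part_word_mult additive.zero[OF additive_braided_factorial])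
  then show "word_mult (single [x] 1) f \<in> nichols_ideal n q"
    using word_mult_lists[OF x f] by (simp add: nichols_ideal_def)
qed

lemma nichols_ideal_word:
  assumes "f \<in> nichols_ideal n q" "w \<in> lists (transpositions n)"
  shows "word_mult f (single w 1) \<in> nichols_ideal n q"
    "word_mult (single w 1) f \<in> nichols_ideal n q"
proof -
  have cons: "single (x # v) 1 = word_mult (single [x] 1) (single v (1::'k))" for x :: perm and v
    by simp
  show "word_mult f (single w 1) \<in> nichols_ideal n q"
    using assms
  proof (induction w arbitrary: f)
    case (Cons x w)
    have x: "x \<in> transpositions n" "w \<in> lists (transpositions n)" using Cons.prems(2) by auto
    have "word_mult (word_mult f (single [x] 1)) (single w 1) \<in> nichols_ideal n q"
      by (rule Cons.IH[OF nichols_ideal_letter(1)[OF Cons.prems(1) x(1)] x(2)])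
    then show ?case by (simp only: cons[of x w] word_mult_assoc)
  qed simp
  show "word_mult (single w 1) f \<in> nichols_ideal n q"
    using assms(2)
  proof (induction w rule: list.induct)
    case (Cons x w)
    have x: "x \<in> transpositions n" "w \<in> lists (transpositions n)" using Cons.prems by auto
    have "word_mult (single [x] 1) (word_mult (single w 1) f) \<in> nichols_ideal n q"
      by (rule nichols_ideal_letter(2)[OF Cons.IH[OF x(2)] x(1)])
    then show ?case by (simp only: cons[of x w] word_mult_assoc)
  qed (simp add: assms)
qed

theorem ideal_nichols_ideal: "ideal (nichols_ideal n q) (tensor_alg (transpositions n))"
proof (rule idealI)
  let ?T = "tensor_alg (transpositions n) :: ('k, perm list \<Rightarrow>\<^sub>0 'k) module"
  show "ring ?T" by (rule ring_tensor_alg)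
  then interpret T: ring ?T .
  show "subgroup (nichols_ideal n q) (add_monoid ?T)"
  proof (rule T.add.subgroupI)
    fix f assume f: "f \<in> nichols_ideal n q"
    have "scale (- 1) f + f = 0" by (rule poly_mapping_eqI) (simp add: lookup_add)
    then have "\<ominus>\<^bsub>?T\<^esub> f = scale (- 1) f"
      using nichols_idealD[OF f] nichols_idealD[OF nichols_ideal_scale[OF f, of "- 1"]]
      by (intro T.minus_equality) simp_all
    then show "\<ominus>\<^bsub>?T\<^esub> f \<in> nichols_ideal n q" using nichols_ideal_scale[OF f] by simp
  next
    have "nichols_ideal n q \<subseteq> carrier ?T" using nichols_idealD by auto
    then show "nichols_ideal n q \<subseteq> carrier ?T" .
  qed (use nichols_ideal_zero in \<open>auto simp: nichols_ideal_add\<close>)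
  fix f g assume f: "f \<in> nichols_ideal n q" and "g \<in> carrier ?T"
  then have g: "keys g \<subseteq> lists (transpositions n)" by simp
  have single: "single w c = scale c (single w 1)" for w :: "perm list" and c :: 'k
    by simp
  have "word_mult g f = (\<Sum>w\<in>keys g. word_mult (single w (lookup g w)) f)"
    using additive.sum[OF additive_word_mult_left] by (metis sum_singles)
  also have "\<dots> \<in> nichols_ideal n q"
    using g nichols_ideal_word(2)[OF f]
    by (intro nichols_ideal_sum) (subst single, simp only: word_mult_scale_left, blast intro: nichols_ideal_scale)
  finally show "g \<otimes>\<^bsub>?T\<^esub> f \<in> nichols_ideal n q" by simp
  have "word_mult f g = (\<Sum>w\<in>keys g. word_mult f (single w (lookup g w)))"
    using additive.sum[OF additive_word_mult_right] by (metis sum_singles)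
  also have "\<dots> \<in> nichols_ideal n q"
    using g nichols_ideal_word(1)[OF f]
    by (intro nichols_ideal_sum) (subst single, simp only: word_mult_scale_right, blast intro: nichols_ideal_scale)
  finally show "f \<otimes>\<^bsub>?T\<^esub> g \<in> nichols_ideal n q" by simp
qed

end

section \<open>Quotients of algebras\<close>

text \<open>The codomain is often not known to be a ring beforehand, so preservation of zero is a separate condition.\<close>

definition alg_epi :: "('k, 'a) module \<Rightarrow> ('k, 'b) module \<Rightarrow> ('a \<Rightarrow> 'b) \<Rightarrow> bool"
  where "alg_epi A B \<phi> \<longleftrightarrow> \<phi> \<in> ring_hom A B \<and> \<phi> \<zero>\<^bsub>A\<^esub> = \<zero>\<^bsub>B\<^esub> \<and> \<phi> ` carrier A = carrier B \<and>
    (\<forall>k. \<forall>x \<in> carrier A. \<phi> (k \<odot>\<^bsub>A\<^esub> x) = k \<odot>\<^bsub>B\<^esub> \<phi> x)"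

lemma alg_epiI:
  assumes "\<And>x. x \<in> carrier A \<Longrightarrow> \<phi> x \<in> carrier B"
    and "\<And>y. y \<in> carrier B \<Longrightarrow> \<exists>x\<in>carrier A. \<phi> x = y"
    and "\<And>x y. x \<in> carrier A \<Longrightarrow> y \<in> carrier A \<Longrightarrow> \<phi> (x \<otimes>\<^bsub>A\<^esub> y) = \<phi> x \<otimes>\<^bsub>B\<^esub> \<phi> y"
    and "\<And>x y. x \<in> carrier A \<Longrightarrow> y \<in> carrier A \<Longrightarrow> \<phi> (x \<oplus>\<^bsub>A\<^esub> y) = \<phi> x \<oplus>\<^bsub>B\<^esub> \<phi> y"
    and "\<phi> \<one>\<^bsub>A\<^esub> = \<one>\<^bsub>B\<^esub>" and "\<phi> \<zero>\<^bsub>A\<^esub> = \<zero>\<^bsub>B\<^esub>"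
    and "\<And>k x. x \<in> carrier A \<Longrightarrow> \<phi> (k \<odot>\<^bsub>A\<^esub> x) = k \<odot>\<^bsub>B\<^esub> \<phi> x"
  shows "alg_epi A B \<phi>"
  unfolding alg_epi_def ring_hom_def using assms by (auto simp: image_iff)

lemma alg_epiD:
  assumes "alg_epi A B \<phi>"
  shows "x \<in> carrier A \<Longrightarrow> \<phi> x \<in> carrier B"
    and "\<phi> ` carrier A = carrier B"
    and "x \<in> carrier A \<Longrightarrow> y \<in> carrier A \<Longrightarrow> \<phi> (x \<otimes>\<^bsub>A\<^esub> y) = \<phi> x \<otimes>\<^bsub>B\<^esub> \<phi> y"
    and "x \<in> carrier A \<Longrightarrow> y \<in> carrier A \<Longrightarrow> \<phi> (x \<oplus>\<^bsub>A\<^esub> y) = \<phi> x \<oplus>\<^bsub>B\<^esub> \<phi> y"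
    and "\<phi> \<one>\<^bsub>A\<^esub> = \<one>\<^bsub>B\<^esub>" and "\<phi> \<zero>\<^bsub>A\<^esub> = \<zero>\<^bsub>B\<^esub>"
    and "x \<in> carrier A \<Longrightarrow> \<phi> (k \<odot>\<^bsub>A\<^esub> x) = k \<odot>\<^bsub>B\<^esub> \<phi> x"
  using assms by (auto simp: alg_epi_def ring_hom_def)

lemma alg_epi_comp:
  assumes "alg_epi A B \<phi>" "alg_epi B C \<psi>"
  shows "alg_epi A C (\<lambda>x. \<psi> (\<phi> x))"
proof (rule alg_epiI)
  fix z assume "z \<in> carrier C"
  then show "\<exists>x\<in>carrier A. \<psi> (\<phi> x) = z" 
    using alg_epiD(2)[OF assms(1)] alg_epiD(2)[OF assms(2)] by (metis imageE)
qed (simp_all add: alg_epiD(1,3-)[OF assms(1)] alg_epiD(1,3-)[OF assms(2)])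

locale assoc_algebra = ring A for A :: "('k::comm_ring_1, 'a) module" (structure) +
  assumes smult_closed [simp]: "x \<in> carrier A \<Longrightarrow> k \<odot> x \<in> carrier A"
    and smult_l_distr: "x \<in> carrier A \<Longrightarrow> (k + l) \<odot> x = k \<odot> x \<oplus> l \<odot> x"
    and smult_r_distr: "x \<in> carrier A \<Longrightarrow> y \<in> carrier A \<Longrightarrow> k \<odot> (x \<oplus> y) = k \<odot> x \<oplus> k \<odot> y"
    and smult_smult: "x \<in> carrier A \<Longrightarrow> (k * l) \<odot> x = k \<odot> (l \<odot> x)"
    and smult_one: "x \<in> carrier A \<Longrightarrow> 1 \<odot> x = x"
    and smult_mult_left: "x \<in> carrier A \<Longrightarrow> y \<in> carrier A \<Longrightarrow> (k \<odot> x) \<otimes> y = k \<odot> (x \<otimes> y)"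
    and smult_mult_right: "x \<in> carrier A \<Longrightarrow> y \<in> carrier A \<Longrightarrow> x \<otimes> (k \<odot> y) = k \<odot> (x \<otimes> y)"
begin

lemma smult_zero [simp]: "k \<odot> \<zero> = \<zero>"
  using smult_r_distr[of \<zero> \<zero> k] smult_closed[of \<zero> k] by (metis add.r_cancel_one l_zero zero_closed)

lemma zero_smult [simp]: "x \<in> carrier A \<Longrightarrow> 0 \<odot> x = \<zero>"
  using smult_l_distr[of x 0 0] smult_closed[of x 0] by (metis add.r_cancel_one add_0 )

lemma is_module: "module (ring_of_type_algebra :: 'k ring) A"
  by (rule moduleI)
    (auto simp: ring_of_type_algebra_def smult_l_distr smult_r_distr smult_smult smult_one
      is_abelian_group intro: cring_from_type_algebra[unfolded ring_of_type_algebra_def])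

end

text \<open>All isomorphisms below arise in this way from a tensor algebra \<open>T\<close>: an element of \<open>A\<close> is sent to the
  value of \<open>\<pi>\<close> at any of its preimages under \<open>\<phi>\<close>. The images of generators can be read off at once.\<close>

lemma alg_iso_of_epis:
  assumes T: "assoc_algebra T" and A: "alg_epi T A \<phi>" and B: "alg_epi T B \<pi>"
    and kernel: "\<And>x y. x \<in> carrier T \<Longrightarrow> y \<in> carrier T \<Longrightarrow> \<phi> x = \<phi> y \<longleftrightarrow> \<pi> x = \<pi> y"
  obtains \<psi> where "\<psi> \<in> alg_iso A B" "\<And>x. x \<in> carrier T \<Longrightarrow> \<psi> (\<phi> x) = \<pi> x"
proof -
  interpret T: assoc_algebra T by fact
  define \<psi> where "\<psi> a = \<pi> (SOME x. x \<in> carrier T \<and> \<phi> x = a)" for a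
  have \<psi>: "\<psi> (\<phi> x) = \<pi> x" if "x \<in> carrier T" for x
  proof -
    have "\<exists>y. y \<in> carrier T \<and> \<phi> y = \<phi> x" using that by blast
    from someI_ex[OF this] show ?thesis
      unfolding \<psi>_def using kernel that by auto
  qed
  have lift: "\<exists>x\<in>carrier T. \<phi> x = a" if "a \<in> carrier A" for a
    using alg_epiD(2)[OF A] that by (metis imageE)
  have "\<psi> \<in> ring_hom A B"
  proof (rule ring_hom_memI)
    fix a assume "a \<in> carrier A"
    with lift obtain x where x: "x \<in> carrier T" "\<phi> x = a" by blast
    then show "\<psi> a \<in> carrier B" using \<psi> alg_epiD(1)[OF B] by auto
    fix b assume "b \<in> carrier A"
    with lift obtain y where y: "y \<in> carrier T" "\<phi> y = b" by blast
    have "\<psi> (\<phi> x \<otimes>\<^bsub>A\<^esub> \<phi> y) = \<psi> (\<phi> x) \<otimes>\<^bsub>B\<^esub> \<psi> (\<phi> y)"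
      using \<psi>[of "x \<otimes>\<^bsub>T\<^esub> y"] \<psi> x(1) y(1) alg_epiD(3)[OF A] alg_epiD(3)[OF B] by simp
    then show "\<psi> (a \<otimes>\<^bsub>A\<^esub> b) = \<psi> a \<otimes>\<^bsub>B\<^esub> \<psi> b" using x y by simp
    have "\<psi> (\<phi> x \<oplus>\<^bsub>A\<^esub> \<phi> y) = \<psi> (\<phi> x) \<oplus>\<^bsub>B\<^esub> \<psi> (\<phi> y)"
      using \<psi>[of "x \<oplus>\<^bsub>T\<^esub> y"] \<psi> x(1) y(1) alg_epiD(4)[OF A] alg_epiD(4)[OF B] by simp
    then show "\<psi> (a \<oplus>\<^bsub>A\<^esub> b) = \<psi> a \<oplus>\<^bsub>B\<^esub> \<psi> b" using x y by simp
  next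
    show "\<psi> \<one>\<^bsub>A\<^esub> = \<one>\<^bsub>B\<^esub>" using \<psi>[of "\<one>\<^bsub>T\<^esub>"] alg_epiD(5)[OF A] alg_epiD(5)[OF B] by simp
  qed
  moreover have "bij_betw \<psi> (carrier A) (carrier B)"
  proof (rule bij_betwI')
    fix a b assume "a \<in> carrier A" "b \<in> carrier A"
    with lift obtain x y where "x \<in> carrier T" "\<phi> x = a" "y \<in> carrier T" "\<phi> y = b" by meson
    then show "\<psi> a = \<psi> b \<longleftrightarrow> a = b" using \<psi> kernel by auto
  next
    fix a assume "a \<in> carrier A"
    then show "\<psi> a \<in> carrier B" using \<open>\<psi> \<in> ring_hom A B\<close> by (rule ring_hom_closed[rotated])
  next
    fix b assume "b \<in> carrier B"
    then obtain x where "x \<in> carrier T" "\<pi> x = b" using alg_epiD(2)[OF B] by (metis imageE)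
    then show "\<exists>a\<in>carrier A. b = \<psi> a" using \<psi> alg_epiD(1)[OF A] by metis
  qed
  moreover have "\<psi> (k \<odot>\<^bsub>A\<^esub> a) = k \<odot>\<^bsub>B\<^esub> \<psi> a" if a: "a \<in> carrier A" for k a
  proof -
    from a lift obtain x where x: "x \<in> carrier T" "\<phi> x = a" by blast
    have "\<psi> (k \<odot>\<^bsub>A\<^esub> \<phi> x) = k \<odot>\<^bsub>B\<^esub> \<psi> (\<phi> x)"
      using \<psi>[of "k \<odot>\<^bsub>T\<^esub> x"] \<psi> x(1) alg_epiD(7)[OF A] alg_epiD(7)[OF B] by simp
    then show ?thesis using x by simp
  qed
  ultimately have "\<psi> \<in> alg_iso A B" by (simp add: alg_iso_def ring_iso_def)
  with \<psi> show thesis using that by blast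
qed

lemma assoc_algebra_epi:
  assumes "assoc_algebra A" "alg_epi A B \<phi>"
  shows "assoc_algebra B"
proof -
  interpret A: assoc_algebra A by fact
  note epi = alg_epiD[OF assms(2)]
  have "ring (B \<lparr>carrier := \<phi> ` carrier A, zero := \<phi> \<zero>\<^bsub>A\<^esub>\<rparr>)"
    using assms(2) by (intro A.ring_hom_imp_img_ring) (simp add: alg_epi_def)
  then have "ring B" by (simp add: epi)
  then interpret B: ring B .
  have lift: "\<exists>a\<in>carrier A. x = \<phi> a" if "x \<in> carrier B" for x
    using epi(2) that by (metis imageE)
  show ?thesis
  proof unfold_locales
    fix x k assume "x \<in> carrier B"
    with lift obtain a where a: "a \<in> carrier A" "x = \<phi> a" by blast
    then show "k \<odot>\<^bsub>B\<^esub> x \<in> carrier B" using epi(1)[of "k \<odot>\<^bsub>A\<^esub> a"] epi(7) by simp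
    show "(k + l) \<odot>\<^bsub>B\<^esub> x = k \<odot>\<^bsub>B\<^esub> x \<oplus>\<^bsub>B\<^esub> l \<odot>\<^bsub>B\<^esub> x" for l
      using a epi(4,7) by (simp flip: epi(4,7) add: A.smult_l_distr)
    show "(k * l) \<odot>\<^bsub>B\<^esub> x = k \<odot>\<^bsub>B\<^esub> (l \<odot>\<^bsub>B\<^esub> x)" for l
      using a by (simp flip: epi(4,7) add: A.smult_smult)
    show "1 \<odot>\<^bsub>B\<^esub> x = x"
      using a by (simp flip: epi(4,7) add: A.smult_one)
    fix y assume "y \<in> carrier B"
    with lift obtain b where b: "b \<in> carrier A" "y = \<phi> b" by blast
    show "k \<odot>\<^bsub>B\<^esub> (x \<oplus>\<^bsub>B\<^esub> y) = k \<odot>\<^bsub>B\<^esub> x \<oplus>\<^bsub>B\<^esub> k \<odot>\<^bsub>B\<^esub> y"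
      using a b by (simp flip: epi(4,7) add: A.smult_r_distr)
    show "(k \<odot>\<^bsub>B\<^esub> x) \<otimes>\<^bsub>B\<^esub> y = k \<odot>\<^bsub>B\<^esub> (x \<otimes>\<^bsub>B\<^esub> y)"
      using a b by (simp flip: epi(3,7) add: A.smult_mult_left)
    show "x \<otimes>\<^bsub>B\<^esub> (k \<odot>\<^bsub>B\<^esub> y) = k \<odot>\<^bsub>B\<^esub> (x \<otimes>\<^bsub>B\<^esub> y)"
      using a b by (simp flip: epi(3,7) add: A.smult_mult_right)
  qed
qed

lemma quot_alg_sel:
  "carrier (quot_alg A I) = A_RCOSETS A I"
  "monoid.mult (quot_alg A I) = rcoset_mult A I"
  "\<one>\<^bsub>quot_alg A I\<^esub> = a_r_coset A I \<one>\<^bsub>A\<^esub>"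
  "\<zero>\<^bsub>quot_alg A I\<^esub> = I"
  "add (quot_alg A I) = set_add A"
  "k \<odot>\<^bsub>quot_alg A I\<^esub> C = (\<Union>a\<in>C. a_r_coset A I (k \<odot>\<^bsub>A\<^esub> a))"
  by (simp_all add: quot_alg_def ring.defs module.defs FactRing_def)

context assoc_algebra
begin

lemma ideal_smult_closed:
  assumes "ideal I A" "x \<in> I"
  shows "k \<odot> x \<in> I"
proof -
  interpret I: ideal I A by fact
  have "k \<odot> x = (k \<odot> \<one>) \<otimes> x" using I.a_Hcarr[OF assms(2)] by (simp add: smult_mult_left)
  then show ?thesis using I.I_l_closed[OF assms(2)] by simp
qed

lemma quot_alg_epi:
  assumes "ideal I A"
  shows "alg_epi A (quot_alg A I) (\<lambda>x. I +> x)"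
proof (rule alg_epiI)
  interpret I: ideal I A by fact
  fix x y assume x: "x \<in> carrier A"
  show "I +> x \<in> carrier (quot_alg A I)"
    using x by (simp add: quot_alg_sel a_rcosetsI[OF I.a_subset])
  show "I +> k \<odot> x = k \<odot>\<^bsub>quot_alg A I\<^esub> (I +> x)" for k
  proof -
    have "I +> (k \<odot> a) = I +> (k \<odot> x)" if "a \<in> I +> x" for a
    proof -
      from that obtain h where h: "h \<in> I" "a = h \<oplus> x" by (auto simp: a_r_coset_def r_coset_def)
      have kh: "k \<odot> h \<in> I" using ideal_smult_closed[OF assms h(1)] .
      have "k \<odot> a = k \<odot> h \<oplus> k \<odot> x" using h x I.a_Hcarr by (simp add: smult_r_distr)
      also have "\<dots> \<in> I +> (k \<odot> x)"
        using kh x I.a_subset by (intro a_rcosI) auto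
      finally show ?thesis using a_repr_independence[OF _ smult_closed[OF x] I.a_subgroup] by blast
    qed
    moreover have "x \<in> I +> x" using x by (rule I.a_rcos_self)
    ultimately show ?thesis unfolding quot_alg_sel by blast
  qed
  assume y: "y \<in> carrier A"
  show "I +> x \<otimes> y = (I +> x) \<otimes>\<^bsub>quot_alg A I\<^esub> (I +> y)"
    by (simp add: quot_alg_sel I.rcoset_mult_add x y)
  show "I +> x \<oplus> y = (I +> x) \<oplus>\<^bsub>quot_alg A I\<^esub> (I +> y)"
    by (simp add: quot_alg_sel I.a_rcos_sum x y)
next
  interpret I: ideal I A by fact
  show "I +> \<zero> = \<zero>\<^bsub>quot_alg A I\<^esub>" by (simp add: quot_alg_sel I.a_subset)
  fix C assume "C \<in> carrier (quot_alg A I)"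
  then show "\<exists>x\<in>carrier A. I +> x = C"
    by (auto simp: quot_alg_sel A_RCOSETS_def RCOSETS_def a_r_coset_def)
qed (simp_all add: quot_alg_sel)

lemma scalar_ideal: "ideal (scalar_ideal r A) A"
proof (rule idealI)
  show "ring A" by (rule ring_axioms)
  show "subgroup (scalar_ideal r A) (add_monoid A)"
  proof (rule add.subgroupI)
    fix a assume "a \<in> scalar_ideal r A"
    then obtain x where x: "x \<in> carrier A" "a = r \<odot> x" by (auto simp: scalar_ideal_def)
    have "r \<odot> (\<ominus> x) \<oplus> r \<odot> x = \<zero>" using x by (simp flip: smult_r_distr add: l_neg)
    then have "\<ominus> a = r \<odot> (\<ominus> x)" using x by (intro minus_equality) auto
    then show "\<ominus> a \<in> scalar_ideal r A" using x by (auto simp: scalar_ideal_def)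
  next
    fix a b assume "a \<in> scalar_ideal r A" "b \<in> scalar_ideal r A"
    then obtain x y where "x \<in> carrier A" "a = r \<odot> x" "y \<in> carrier A" "b = r \<odot> y"
      by (auto simp: scalar_ideal_def)
    then show "a \<oplus> b \<in> scalar_ideal r A"
      unfolding scalar_ideal_def by (intro image_eqI[of _ _ "x \<oplus> y"]) (auto simp: smult_r_distr)
  qed (auto simp: scalar_ideal_def)
  fix a x assume "a \<in> scalar_ideal r A" and x: "x \<in> carrier A"
  then obtain y where y: "y \<in> carrier A" "a = r \<odot> y" by (auto simp: scalar_ideal_def)
  show "x \<otimes> a \<in> scalar_ideal r A"
    unfolding scalar_ideal_def using x y by (intro image_eqI[of _ _ "x \<otimes> y"]) (auto simp: smult_mult_right)
  show "a \<otimes> x \<in> scalar_ideal r A"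
    unfolding scalar_ideal_def using x y by (intro image_eqI[of _ _ "y \<otimes> x"]) (auto simp: smult_mult_left)
qed

end

lemma restrict_scalars_sel [simp]:
  "carrier (restrict_scalars f A) = carrier A"
  "x \<otimes>\<^bsub>restrict_scalars f A\<^esub> y = x \<otimes>\<^bsub>A\<^esub> y"
  "\<one>\<^bsub>restrict_scalars f A\<^esub> = \<one>\<^bsub>A\<^esub>"
  "\<zero>\<^bsub>restrict_scalars f A\<^esub> = \<zero>\<^bsub>A\<^esub>"
  "x \<oplus>\<^bsub>restrict_scalars f A\<^esub> y = x \<oplus>\<^bsub>A\<^esub> y"
  "l \<odot>\<^bsub>restrict_scalars f A\<^esub> x = f l \<odot>\<^bsub>A\<^esub> x"
  by (simp_all add: restrict_scalars_def ring.defs module.defs)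

lemma alg_epi_restrict_scalars:
  "alg_epi A B \<phi> \<Longrightarrow> alg_epi (restrict_scalars f A) (restrict_scalars f B) \<phi>"
  by (simp add: alg_epi_def ring_hom_def)

lemma assoc_algebra_restrict_scalars:
  assumes "assoc_algebra A" "\<And>k l. f (k + l) = f k + f l" "\<And>k l. f (k * l) = f k * f l" "f 1 = 1"
  shows "assoc_algebra (restrict_scalars f A)"
proof -
  interpret A: assoc_algebra A by fact
  have "ring (restrict_scalars f A)"
  proof (rule ringI)
    show "abelian_group (restrict_scalars f A)"
    proof (rule abelian_groupI, goal_cases)
      case (6 x)
      then show ?case using A.l_neg[of x] by (intro bexI[of _ "\<ominus>\<^bsub>A\<^esub> x"]) auto
    qed (auto simp: A.a_ac)
    show "Group.monoid (restrict_scalars f A)"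
      by (rule monoidI) (auto simp: A.m_assoc)
  qed (auto simp: A.l_distr A.r_distr)
  then show ?thesis
    by (intro assoc_algebra.intro assoc_algebra_axioms.intro)
      (auto simp: assms(2-) A.smult_l_distr A.smult_r_distr A.smult_smult A.smult_one A.smult_mult_left A.smult_mult_right)
qed

lemma assoc_algebra_tensor_alg: "assoc_algebra (tensor_alg S)"
  by (intro assoc_algebra.intro assoc_algebra_axioms.intro ring_tensor_alg)
    (auto simp: scale_simps word_mult_scale_left word_mult_scale_right subset_trans[OF keys_scale])

context rack_cocycle
begin

abbreviation "T \<equiv> tensor_alg (transpositions n) :: ('k, perm list \<Rightarrow>\<^sub>0 'k) module"

lemma nichols_epi: "alg_epi T (nichols_alg n q) (nichols_proj n q)"
  unfolding nichols_alg_def nichols_proj_def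
  using assoc_algebra.quot_alg_epi[OF assoc_algebra_tensor_alg ideal_nichols_ideal] .

lemma assoc_algebra_nichols_alg: "assoc_algebra (nichols_alg n q)"
  using assoc_algebra_epi[OF assoc_algebra_tensor_alg nichols_epi] .

lemma nichols_proj_eq_iff:
  assumes "f \<in> carrier T" "g \<in> carrier T"
  shows "nichols_proj n q f = nichols_proj n q g \<longleftrightarrow> f - g \<in> nichols_ideal n q"
  unfolding nichols_proj_def
  using ring.quotient_eq_iff_same_a_r_cos[OF ring_tensor_alg ideal_nichols_ideal assms] a_minus_tensor_alg[OF assms]
  by simp

end

section \<open>The extension \<open>T\<^sub>n\<close> of the symmetric group\<close>

lemma pres_rel_lists:
  assumes "Rel \<subseteq> lists (S \<times> UNIV) \<times> lists (S \<times> UNIV)" "(u, v) \<in> pres_rel S Rel"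
  shows "u \<in> lists (S \<times> UNIV) \<and> v \<in> lists (S \<times> UNIV)"
  using assms(2) by induction (use assms(1) in auto)

locale presentation =
  fixes S :: "'a set" and Rel :: "(('a \<times> bool) list \<times> ('a \<times> bool) list) set"
  assumes Rel_lists: "Rel \<subseteq> lists (S \<times> UNIV) \<times> lists (S \<times> UNIV)"
begin

abbreviation "G \<equiv> presented_group S Rel"

definition cls :: "('a \<times> bool) list \<Rightarrow> ('a \<times> bool) list set"
  where "cls w = pres_rel S Rel `` {w}"

lemma equiv_pres_rel: "equiv (lists (S \<times> UNIV)) (pres_rel S Rel)"
proof (rule equivI)
  show "pres_rel S Rel \<subseteq> lists (S \<times> UNIV) \<times> lists (S \<times> UNIV)"
    by (intro subrelI SigmaI) (auto dest: pres_rel_lists[OF Rel_lists] simp del: in_lists_conv_set)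
qed (auto intro!: refl_onI symI transI intro: pres_rel.refl pres_rel.sym pres_rel.trans)

lemma carrier_G: "carrier G = cls ` lists (S \<times> UNIV)"
  by (auto simp: presented_group_def quotient_def cls_def)

lemma cls_closed [simp]: "w \<in> lists (S \<times> UNIV) \<Longrightarrow> cls w \<in> carrier G"
  by (simp add: carrier_G)

lemma cls_eqI: "(u, v) \<in> pres_rel S Rel \<Longrightarrow> cls u = cls v"
  unfolding cls_def by (rule equiv_class_eq[OF equiv_pres_rel])

lemma one_G: "\<one>\<^bsub>G\<^esub> = cls []"
  by (simp add: presented_group_def cls_def)

lemma mult_G:
  assumes "u \<in> lists (S \<times> UNIV)" "v \<in> lists (S \<times> UNIV)"
  shows "cls u \<otimes>\<^bsub>G\<^esub> cls v = cls (u @ v)"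
proof -
  have *: "pres_rel S Rel `` {u' @ v'} = cls (u @ v)"
    if "(u, u') \<in> pres_rel S Rel" "(v, v') \<in> pres_rel S Rel" for u' v'
    using cls_eqI[OF pres_rel.mult[OF that]] by (simp add: cls_def)
  have ne: "cls u \<noteq> {}" "cls v \<noteq> {}" using assms by (auto simp: cls_def intro: pres_rel.refl)
  have "cls u \<otimes>\<^bsub>G\<^esub> cls v = (\<Union>u'\<in>cls u. \<Union>v'\<in>cls v. pres_rel S Rel `` {u' @ v'})"
    by (simp add: presented_group_def)
  also have "\<dots> = (\<Union>u'\<in>cls u. \<Union>v'\<in>cls v. cls (u @ v))"
    by (intro SUP_cong HOL.refl *) (simp_all add: cls_def)
  also have "\<dots> = cls (u @ v)" using ne by simp
  finally show ?thesis .
qed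

lemma inverse_word:
  "w \<in> lists (S \<times> UNIV) \<Longrightarrow> (rev (map (\<lambda>(x, b). (x, \<not> b)) w) @ w, []) \<in> pres_rel S Rel"
proof (induction w rule: list.induct)
  case (Cons p w)
  obtain x b where p: "p = (x, b)" by fastforce
  let ?r = "rev (map (\<lambda>(x, b). (x, \<not> b)) w)"
  have w: "w \<in> lists (S \<times> UNIV)" "x \<in> S" using Cons.prems p by auto
  then have r: "?r \<in> lists (S \<times> UNIV)" by (auto simp: in_lists_conv_set)
  have "([(x, \<not> b), (x, b)], []) \<in> pres_rel S Rel"
    using pres_rel.cancel[OF w(2), of "\<not> b" Rel] by simp
  from pres_rel.mult[OF pres_rel.mult[OF pres_rel.refl[OF r] this] pres_rel.refl[OF w(1)]]
  have "(?r @ [(x, \<not> b), (x, b)] @ w, ?r @ w) \<in> pres_rel S Rel" by simp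
  then show ?case using Cons.IH[OF w(1)] p by (auto intro: pres_rel.trans)
qed (auto intro: pres_rel.refl)

lemma carrier_GE:
  assumes "x \<in> carrier G"
  obtains w where "w \<in> lists (S \<times> UNIV)" "x = cls w"
  using assms unfolding carrier_G by blast

lemma group_G: "group G"
proof (rule groupI)
  fix x assume "x \<in> carrier G"
  then obtain u where u: "u \<in> lists (S \<times> UNIV)" "x = cls u" by (rule carrier_GE)
  let ?r = "rev (map (\<lambda>(x, b). (x, \<not> b)) u)"
  have r: "?r \<in> lists (S \<times> UNIV)" using u(1) by (auto simp: in_lists_conv_set)
  then show "\<exists>y\<in>carrier G. y \<otimes>\<^bsub>G\<^esub> x = \<one>\<^bsub>G\<^esub>"
    using u cls_eqI[OF inverse_word[OF u(1)]] by (intro bexI[of _ "cls ?r"]) (simp_all only: mult_G one_G cls_closed)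
  show "\<one>\<^bsub>G\<^esub> \<otimes>\<^bsub>G\<^esub> x = x" using u by (simp add: one_G mult_G)
  fix y assume "y \<in> carrier G"
  then obtain v where v: "v \<in> lists (S \<times> UNIV)" "y = cls v" by (rule carrier_GE)
  show "x \<otimes>\<^bsub>G\<^esub> y \<in> carrier G" using u v by (simp add: mult_G)
  fix z assume "z \<in> carrier G"
  then obtain w where w: "w \<in> lists (S \<times> UNIV)" "z = cls w" by (rule carrier_GE)
  have "u @ v \<in> lists (S \<times> UNIV)" "v @ w \<in> lists (S \<times> UNIV)" using u v w by simp_all
  then show "x \<otimes>\<^bsub>G\<^esub> y \<otimes>\<^bsub>G\<^esub> z = x \<otimes>\<^bsub>G\<^esub> (y \<otimes>\<^bsub>G\<^esub> z)"
    using u(1) v(1) w(1) unfolding u(2) v(2) w(2) by (simp only: mult_G append_assoc)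
qed (simp add: one_G)

end

lemma T_rels_lists: "T_rels n \<subseteq> lists (T_gens n \<times> UNIV) \<times> lists (T_gens n \<times> UNIV)"
  by (auto simp: T_rels_def T_gens_def word_t_def word_z_def)

interpretation T_group: presentation "T_gens n" "T_rels n" for n
  by unfold_locales (rule T_rels_lists)

lemma T_class_eq_cls: "T_class n w = T_group.cls n w"
  by (simp add: T_class_def T_group.cls_def)

lemma group_T_group: "group (T_group n)"
  unfolding T_group_def by (rule T_group.group_G)

definition tau :: "nat \<Rightarrow> nat \<Rightarrow> T_word set"
  where "tau n i = T_class n (word_t i)"

definition zeta :: "nat \<Rightarrow> T_word set"
  where "zeta n = T_class n word_z"

lemma word_t_lists: "i \<in> {1..<n} \<Longrightarrow> word_t i \<in> lists (T_gens n \<times> UNIV)"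
  by (simp add: word_t_def T_gens_def)

lemma word_z_lists: "word_z \<in> lists (T_gens n \<times> UNIV)"
  by (simp add: word_z_def T_gens_def)

lemma T_class_closed [simp]: "w \<in> lists (T_gens n \<times> UNIV) \<Longrightarrow> T_class n w \<in> carrier (T_group n)"
  unfolding T_class_eq_cls T_group_def by (rule T_group.cls_closed)

lemma tau_closed [simp]: "i \<in> {1..<n} \<Longrightarrow> tau n i \<in> carrier (T_group n)"
  by (simp add: tau_def word_t_lists)

lemma zeta_closed [simp]: "zeta n \<in> carrier (T_group n)"
  by (simp add: zeta_def word_z_lists)

lemma T_class_mult:
  "u \<in> lists (T_gens n \<times> UNIV) \<Longrightarrow> v \<in> lists (T_gens n \<times> UNIV) \<Longrightarrow>
    T_class n u \<otimes>\<^bsub>T_group n\<^esub> T_class n v = T_class n (u @ v)"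
  unfolding T_class_eq_cls T_group_def by (rule T_group.mult_G)

lemma T_class_Nil: "T_class n [] = \<one>\<^bsub>T_group n\<^esub>"
  unfolding T_class_eq_cls T_group_def by (rule T_group.one_G[symmetric])

lemma T_class_rel: "(u, v) \<in> T_rels n \<Longrightarrow> T_class n u = T_class n v"
  unfolding T_class_eq_cls by (rule T_group.cls_eqI[OF pres_rel.rel])

context
  fixes n :: nat
begin

interpretation T: group "T_group n" by (rule group_T_group)

lemma tau_square:
  assumes "i \<in> {1..<n}" shows "tau n i \<otimes>\<^bsub>T_group n\<^esub> tau n i = \<one>\<^bsub>T_group n\<^esub>"
proof -
  have "1 \<le> i \<and> i < n" using assms by simp
  then have "(word_t i @ word_t i, []) \<in> T_rels n" unfolding T_rels_def by blast
  from T_class_rel[OF this] show ?thesis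
    using word_t_lists[OF assms] by (simp only: tau_def T_class_mult T_class_Nil)
qed

lemma zeta_square: "zeta n \<otimes>\<^bsub>T_group n\<^esub> zeta n = \<one>\<^bsub>T_group n\<^esub>"
proof -
  have "(word_z @ word_z, []) \<in> T_rels n" unfolding T_rels_def by blast
  from T_class_rel[OF this] show ?thesis
    by (simp only: zeta_def T_class_mult T_class_Nil word_z_lists)
qed

lemma zeta_tau:
  assumes "i \<in> {1..<n}" shows "zeta n \<otimes>\<^bsub>T_group n\<^esub> tau n i = tau n i \<otimes>\<^bsub>T_group n\<^esub> zeta n"
proof -
  have "1 \<le> i \<and> i < n" using assms by simp
  then have "(word_z @ word_t i, word_t i @ word_z) \<in> T_rels n" unfolding T_rels_def by blast
  from T_class_rel[OF this] show ?thesis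
    using word_t_lists[OF assms] word_z_lists by (simp only: zeta_def tau_def T_class_mult)
qed

lemma tau_braid:
  assumes "i \<in> {1..<n}" "Suc i \<in> {1..<n}"
  shows "tau n i \<otimes>\<^bsub>T_group n\<^esub> (tau n (Suc i) \<otimes>\<^bsub>T_group n\<^esub> tau n i) =
    tau n (Suc i) \<otimes>\<^bsub>T_group n\<^esub> (tau n i \<otimes>\<^bsub>T_group n\<^esub> tau n (Suc i))"
proof -
  have "1 \<le> i \<and> i + 1 < n" using assms by simp
  then have "(word_t i @ word_t (i + 1) @ word_t i, word_t (i + 1) @ word_t i @ word_t (i + 1)) \<in> T_rels n"
    unfolding T_rels_def by blast
  from T_class_rel[OF this] show ?thesis
    using word_t_lists[OF assms(1)] word_t_lists[OF assms(2)]
    by (simp only: tau_def T_class_mult append_in_lists_conv Suc_eq_plus1)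
qed

lemma tau_commute:
  assumes "k \<in> {1..<n}" "l \<in> {1..<n}" "Suc k < l"
  shows "tau n k \<otimes>\<^bsub>T_group n\<^esub> tau n l = zeta n \<otimes>\<^bsub>T_group n\<^esub> (tau n l \<otimes>\<^bsub>T_group n\<^esub> tau n k)"
proof -
  have "1 \<le> k \<and> k + 1 < l \<and> l < n" using assms by simp
  then have "(word_t k @ word_t l, word_z @ word_t l @ word_t k) \<in> T_rels n"
    unfolding T_rels_def by blast
  from T_class_rel[OF this] show ?thesis
    using word_t_lists[OF assms(1)] word_t_lists[OF assms(2)] word_z_lists
    by (simp only: tau_def zeta_def T_class_mult append_in_lists_conv)
qed

definition tau_word :: "nat list \<Rightarrow> T_word set"
  where "tau_word is = foldr (\<lambda>i g. tau n i \<otimes>\<^bsub>T_group n\<^esub> g) is \<one>\<^bsub>T_group n\<^esub>"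

lemma tau_word_simps [simp]:
  "tau_word [] = \<one>\<^bsub>T_group n\<^esub>" "tau_word (i # is) = tau n i \<otimes>\<^bsub>T_group n\<^esub> tau_word is"
  by (simp_all add: tau_word_def)

lemma tau_word_closed [simp]: "set is \<subseteq> {1..<n} \<Longrightarrow> tau_word is \<in> carrier (T_group n)"
  by (induction "is") auto

lemma zeta_zeta: "g \<in> carrier (T_group n) \<Longrightarrow> zeta n \<otimes>\<^bsub>T_group n\<^esub> (zeta n \<otimes>\<^bsub>T_group n\<^esub> g) = g"
  by (simp add: zeta_square flip: T.m_assoc)

lemma tau_zeta: "i \<in> {1..<n} \<Longrightarrow> g \<in> carrier (T_group n) \<Longrightarrow>
    tau n i \<otimes>\<^bsub>T_group n\<^esub> (zeta n \<otimes>\<^bsub>T_group n\<^esub> g) = zeta n \<otimes>\<^bsub>T_group n\<^esub> (tau n i \<otimes>\<^bsub>T_group n\<^esub> g)"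
  by (simp add: zeta_tau flip: T.m_assoc)

text \<open>Modulo \<open>z\<close> the generators \<open>t\<^sub>i\<close> satisfy the relations of the simple transpositions.\<close>

definition tau_rel :: "nat list \<Rightarrow> nat list \<Rightarrow> bool"
  where "tau_rel is js \<longleftrightarrow> set is \<subseteq> {1..<n} \<and> set js \<subseteq> {1..<n} \<and>
    (tau_word is = tau_word js \<or> tau_word is = zeta n \<otimes>\<^bsub>T_group n\<^esub> tau_word js)"

lemma braid_congruence_tau_rel: "braid_congruence {1..<n} tau_rel"
proof (unfold_locales, goal_cases)
  case (2 "is" js)
  then show ?case unfolding tau_rel_def using zeta_zeta[of "tau_word js"] by auto
next
  case (3 "is" js ks)
  then show ?case unfolding tau_rel_def using zeta_zeta[of "tau_word ks"] by auto
next
  case (4 i "is" js)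
  then show ?case unfolding tau_rel_def using tau_zeta[of i "tau_word js"] by auto
next
  case (5 i j ks)
  have "tau n i \<otimes>\<^bsub>T_group n\<^esub> (tau n j \<otimes>\<^bsub>T_group n\<^esub> tau_word ks) =
    (tau n i \<otimes>\<^bsub>T_group n\<^esub> tau n j) \<otimes>\<^bsub>T_group n\<^esub> tau_word ks"
    using 5 by (simp add: T.m_assoc)
  also have "\<dots> = zeta n \<otimes>\<^bsub>T_group n\<^esub> (tau n j \<otimes>\<^bsub>T_group n\<^esub> (tau n i \<otimes>\<^bsub>T_group n\<^esub> tau_word ks))"
    using 5 by (simp add: tau_commute T.m_assoc)
  finally show ?case using 5 unfolding tau_rel_def by simp
next
  case (6 i ks)
  have "tau n i \<otimes>\<^bsub>T_group n\<^esub> (tau n (Suc i) \<otimes>\<^bsub>T_group n\<^esub> (tau n i \<otimes>\<^bsub>T_group n\<^esub> tau_word ks)) =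
    (tau n i \<otimes>\<^bsub>T_group n\<^esub> (tau n (Suc i) \<otimes>\<^bsub>T_group n\<^esub> tau n i)) \<otimes>\<^bsub>T_group n\<^esub> tau_word ks"
    using 6 by (simp add: T.m_assoc)
  also have "\<dots> = tau n (Suc i) \<otimes>\<^bsub>T_group n\<^esub> (tau n i \<otimes>\<^bsub>T_group n\<^esub> (tau n (Suc i) \<otimes>\<^bsub>T_group n\<^esub> tau_word ks))"
    using 6 by (simp add: tau_braid T.m_assoc)
  finally show ?case using 6 unfolding tau_rel_def by simp
qed (simp add: tau_rel_def)

lemma tau_word_perm_id:
  assumes "set is \<subseteq> {1..<n}" "word_perm_of is = id"
  shows "tau_word is = \<one>\<^bsub>T_group n\<^esub> \<or> tau_word is = zeta n"
proof -
  have "tau_rel is []"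
  proof (rule braid_congruence.related_Nil[OF braid_congruence_tau_rel _ assms])
    fix i ks assume *: "i \<in> {1..<n}" "set ks \<subseteq> {1..<n}"
    then have "tau n i \<otimes>\<^bsub>T_group n\<^esub> (tau n i \<otimes>\<^bsub>T_group n\<^esub> tau_word ks) = tau_word ks"
      by (simp add: tau_square flip: T.m_assoc)
    with * show "tau_rel (i # i # ks) ks" by (simp add: tau_rel_def)
  qed
  then show ?thesis by (simp add: tau_rel_def)
qed

text \<open>The generators are involutions, which removes formal inverses, and powers of \<open>z\<close> can be collected.\<close>

lemma T_group_elements:
  assumes "w \<in> lists (T_gens n \<times> UNIV)"
  shows "\<exists>is. set is \<subseteq> {1..<n} \<and> word_perm w = word_perm_of is \<and>
    (T_class n w = tau_word is \<or> T_class n w = zeta n \<otimes>\<^bsub>T_group n\<^esub> tau_word is)"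
  using assms
proof (induction w rule: list.induct)
  case Nil
  then show ?case by (intro exI[of _ "[]"]) (simp add: T_class_Nil word_perm_def)
next
  case (Cons p w)
  obtain x b where p: "p = (x, b)" by fastforce
  have w: "w \<in> lists (T_gens n \<times> UNIV)" "[p] \<in> lists (T_gens n \<times> UNIV)" "x \<in> T_gens n"
    using Cons.prems p by auto
  with Cons.IH obtain "is" where "is": "set is \<subseteq> {1..<n}" "word_perm w = word_perm_of is"
    "T_class n w = tau_word is \<or> T_class n w = zeta n \<otimes>\<^bsub>T_group n\<^esub> tau_word is" by blast
  have mult: "T_class n (p # w) = T_class n [p] \<otimes>\<^bsub>T_group n\<^esub> T_class n w"
    using T_class_mult[OF w(2,1)] by simp
  have inverse: "T_class n [(x, b)] = T_class n [(x, True)]"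
    if "T_class n [(x, True)] \<otimes>\<^bsub>T_group n\<^esub> T_class n [(x, True)] = \<one>\<^bsub>T_group n\<^esub>"
  proof (cases b)
    case False
    have x: "[(x, True)] \<in> lists (T_gens n \<times> UNIV)" "[(x, False)] \<in> lists (T_gens n \<times> UNIV)"
      using w by auto
    have "T_class n [(x, False)] \<otimes>\<^bsub>T_group n\<^esub> T_class n [(x, True)] = \<one>\<^bsub>T_group n\<^esub>"
      using T_class_mult[OF x(2,1)] T_group.cls_eqI[OF pres_rel.cancel[OF w(3), of False]]
      by (simp add: T_class_eq_cls flip: T_class_Nil)
    then show ?thesis using that False x by (metis T.inv_equality T_class_closed)
  qed simp
  show ?case
  proof (cases x)
    case (Gen_t i)
    then have i: "i \<in> {1..<n}" using w by (auto simp: T_gens_def)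
    have "T_class n [p] = tau n i"
      using inverse tau_square[OF i] Gen_t p by (simp add: tau_def word_t_def)
    moreover have "word_perm (p # w) = word_perm_of (i # is)"
      using "is" p Gen_t by (auto simp: word_perm_def)
    ultimately show ?thesis
      using "is" i mult tau_zeta[OF i tau_word_closed[of "is"]] by (intro exI[of _ "i # is"]) auto
  next
    case Gen_z
    have "T_class n [p] = zeta n"
      using inverse zeta_square Gen_z p by (simp add: zeta_def word_z_def)
    moreover have "word_perm (p # w) = word_perm_of is"
      using "is" p Gen_z by (auto simp: word_perm_def inv_id)
    ultimately show ?thesis
      using "is" mult zeta_zeta[OF tau_word_closed[of "is"]] by (intro exI[of _ "is"]) auto
  qed
qed

lemma zeta_central:
  assumes "g \<in> carrier (T_group n)"
  shows "zeta n \<otimes>\<^bsub>T_group n\<^esub> g = g \<otimes>\<^bsub>T_group n\<^esub> zeta n"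
proof -
  have *: "zeta n \<otimes>\<^bsub>T_group n\<^esub> tau_word is = tau_word is \<otimes>\<^bsub>T_group n\<^esub> zeta n" if "set is \<subseteq> {1..<n}" for "is"
    using that by (induction "is") (simp_all add: T.m_assoc flip: tau_zeta)
  obtain w where w: "w \<in> lists (T_gens n \<times> UNIV)" "g = T_class n w"
    using assms by (auto simp: T_group_def T_group.carrier_G T_class_eq_cls)
  then obtain "is" where "is": "set is \<subseteq> {1..<n}"
    "g = tau_word is \<or> g = zeta n \<otimes>\<^bsub>T_group n\<^esub> tau_word is"
    using T_group_elements by blast
  from "is"(2) show ?thesis
  proof
    assume "g = tau_word is"
    then show ?thesis using *[OF "is"(1)] by simp
  next
    assume g: "g = zeta n \<otimes>\<^bsub>T_group n\<^esub> tau_word is"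
    show ?thesis unfolding g using "is"(1) by (simp add: T.m_assoc flip: *[OF "is"(1)])
  qed
qed

end

lemma word_perm_append: "word_perm (u @ v) = word_perm u \<circ> word_perm v"
  by (induction u) (auto simp: word_perm_def o_assoc split_def)

lemma word_perm_cong: "(u, v) \<in> pres_rel (T_gens n) (T_rels n) \<Longrightarrow> word_perm u = word_perm v"
proof (induction rule: pres_rel.induct)
  case (rel u v)
  then consider
    (square) i where "u = word_t i @ word_t i" "v = []" | (z) "u = word_z @ word_z" "v = []"
    | (central) i where "u = word_z @ word_t i" "v = word_t i @ word_z"
    | (braid) j where "u = word_t j @ word_t (j + 1) @ word_t j" "v = word_t (j + 1) @ word_t j @ word_t (j + 1)"
    | (commute) k l where "u = word_t k @ word_t l" "v = word_z @ word_t l @ word_t k" "k + 1 < l"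
    unfolding T_rels_def by blast
  then show ?case
  proof cases
    case (braid j)
    then show ?thesis using simple_transpositions_braid[of "Suc j" j]
      by (simp add: word_perm_def word_t_def fun_eq_iff)
  next
    case (commute k l)
    then show ?thesis using simple_transpositions_commute[of k l]
      by (simp add: word_perm_def word_t_def word_z_def fun_eq_iff)
  qed (simp_all add: word_perm_def word_t_def word_z_def)
next
  case (cancel x b)
  then show ?case by (cases x; cases b) (auto simp: word_perm_def inv_id)
qed (auto simp: word_perm_append)

lemma T_group_lift:
  assumes "\<And>u v. (u, v) \<in> pres_rel (T_gens n) (T_rels n) \<Longrightarrow> F u = F v" "w \<in> lists (T_gens n \<times> UNIV)"
  shows "the_elem (F ` T_class n w) = F w"
proof -
  have "F x = F w" if "x \<in> T_class n w" for x
    using assms(1)[of w x] that by (simp add: T_class_def)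
  moreover have "w \<in> T_class n w"
    using pres_rel.refl[OF assms(2)] by (simp add: T_class_def)
  ultimately have "F ` T_class n w = {F w}" by blast
  then show ?thesis by simp
qed

lemma T_proj_class: "w \<in> lists (T_gens n \<times> UNIV) \<Longrightarrow> T_proj (T_class n w) = word_perm w"
  unfolding T_proj_def using word_perm_cong by (rule T_group_lift)

lemma T_group_classE:
  assumes "g \<in> carrier (T_group n)"
  obtains w where "w \<in> lists (T_gens n \<times> UNIV)" "g = T_class n w"
  using assms by (auto simp: T_group_def T_group.carrier_G T_class_eq_cls)

lemma T_proj_mult:
  assumes "g \<in> carrier (T_group n)" "h \<in> carrier (T_group n)"
  shows "T_proj (g \<otimes>\<^bsub>T_group n\<^esub> h) = T_proj g \<circ> T_proj h"
proof -
  obtain u v where uv: "u \<in> lists (T_gens n \<times> UNIV)" "g = T_class n u" "v \<in> lists (T_gens n \<times> UNIV)" "h = T_class n v"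
    using assms T_group_classE by metis
  then have "u @ v \<in> lists (T_gens n \<times> UNIV)" by simp
  with uv show ?thesis by (simp add: T_class_mult T_proj_class word_perm_append)
qed

text \<open>Here the Coxeter presentation enters, through \<open>related_Nil\<close>.\<close>

lemma T_proj_kernel:
  assumes "g \<in> carrier (T_group n)" "T_proj g = id"
  shows "g = \<one>\<^bsub>T_group n\<^esub> \<or> g = zeta n"
proof -
  interpret T: group "T_group n" by (rule group_T_group)
  obtain w where w: "w \<in> lists (T_gens n \<times> UNIV)" "g = T_class n w" using assms(1) by (rule T_group_classE)
  then obtain "is" where "is": "set is \<subseteq> {1..<n}" "word_perm w = word_perm_of is"
    "g = tau_word n is \<or> g = zeta n \<otimes>\<^bsub>T_group n\<^esub> tau_word n is"
    using T_group_elements by blast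
  moreover have "word_perm_of is = id" using assms(2) w "is"(2) T_proj_class by simp
  ultimately show ?thesis using tau_word_perm_id[of "is" n] zeta_square[of n] by auto
qed

section \<open>A spin representation\<close>

definition flip :: "nat \<Rightarrow> nat set \<Rightarrow> nat set"
  where "flip i A = (if i \<in> A then A - {i} else insert i A)"

definition sign_below :: "nat \<Rightarrow> nat set \<Rightarrow> real"
  where "sign_below i A = (- 1) ^ card (A \<inter> {..<i})"

text \<open>The unit vector \<open>e\<^sub>i\<close> of a Clifford algebra, acting on its spin module: the module has a basis indexed by sets
  of natural numbers, and the sign counts the vectors that \<open>e\<^sub>i\<close> has to pass.\<close>

definition clifford :: "nat \<Rightarrow> (nat set \<Rightarrow> real) \<Rightarrow> (nat set \<Rightarrow> real)"
  where "clifford i f = (\<lambda>A. sign_below i A * f (flip i A))"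

lemma flip_flip [simp]: "flip i (flip i A) = A"
  by (auto simp: flip_def)

lemma flip_commute: "flip i (flip j A) = flip j (flip i A)"
  by (auto simp: flip_def)

lemma sign_below_flip:
  "sign_below j (flip i A) = (if i < j then - sign_below j A else sign_below j A)"
proof (cases "i < j")
  case True
  show ?thesis
  proof (cases "i \<in> A")
    case in_A: True
    have "A \<inter> {..<j} = insert i ((A - {i}) \<inter> {..<j})" using True in_A by auto
    then have "card (A \<inter> {..<j}) = Suc (card ((A - {i}) \<inter> {..<j}))" by simp
    then show ?thesis using True in_A by (simp add: sign_below_def flip_def)
  next
    case notin: False
    have "insert i A \<inter> {..<j} = insert i (A \<inter> {..<j})" using True by auto
    then have "card (insert i A \<inter> {..<j}) = Suc (card (A \<inter> {..<j}))" using notin by simp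
    then show ?thesis using True notin by (simp add: sign_below_def flip_def)
  qed
next
  case False
  then have "flip i A \<inter> {..<j} = A \<inter> {..<j}" by (auto simp: flip_def)
  then show ?thesis using False by (simp add: sign_below_def)
qed

lemma clifford_square: "clifford i (clifford i f) = f"
  by (simp add: clifford_def sign_below_flip) (simp add: sign_below_def flip: power_add mult.assoc)

lemma clifford_anticommute: "i \<noteq> j \<Longrightarrow> clifford i (clifford j f) A = - clifford j (clifford i f) A"
  by (cases "i < j") (auto simp: clifford_def sign_below_flip flip_commute)

text \<open>The unit vector \<open>(e\<^sub>a - e\<^sub>b)/\<surd>2\<close>, which will represent the lift of the transposition of \<open>a\<close> and \<open>b\<close>.\<close>

definition root_op :: "nat \<Rightarrow> nat \<Rightarrow> (nat set \<Rightarrow> real) \<Rightarrow> (nat set \<Rightarrow> real)"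
  where "root_op a b f = (\<lambda>A. (clifford a f A - clifford b f A) / sqrt 2)"

lemma clifford_root_op: "clifford c (root_op a b f) A = (clifford c (clifford a f) A - clifford c (clifford b f) A) / sqrt 2"
  by (simp add: clifford_def root_op_def diff_divide_distrib right_diff_distrib)

text \<open>Conjugation by a root vector is the negative of the reflection in this vector.\<close>

lemma root_op_clifford:
  assumes "a \<noteq> b"
  shows "root_op a b (clifford c f) A = - clifford (transpose a b c) (root_op a b f) A"
proof -
  consider "c = a" | "c = b" | "c \<noteq> a" "c \<noteq> b" by blast
  then show ?thesis
  proof cases
    case 1
    then show ?thesis using assms clifford_anticommute[of a b f A]
      by (simp add: clifford_root_op root_op_def[of a b "clifford a f"] clifford_square) (simp add: field_simps)
  next
    case 2
    then show ?thesis using assms clifford_anticommute[of a b f A]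
      by (simp add: clifford_root_op root_op_def[of a b "clifford b f"] clifford_square) (simp add: field_simps)
  next
    case 3
    then show ?thesis using clifford_anticommute[of a c f A] clifford_anticommute[of b c f A]
      by (simp add: clifford_root_op root_op_def[of a b "clifford c f"]) (simp add: field_simps)
  qed
qed

lemma root_op_root_op:
  assumes "a \<noteq> b"
  shows "root_op a b (root_op c d f) = - root_op (transpose a b c) (transpose a b d) (root_op a b f)"
proof
  fix A
  have "root_op a b (root_op c d f) A = (root_op a b (clifford c f) A - root_op a b (clifford d f) A) / sqrt 2"
    by (simp add: root_op_def[of a b] clifford_root_op) (simp add: field_simps)
  also have "\<dots> = - root_op (transpose a b c) (transpose a b d) (root_op a b f) A"
    unfolding root_op_clifford[OF assms] root_op_def[of "transpose a b c" "transpose a b d"]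
    by (simp add: field_simps)
  finally show "root_op a b (root_op c d f) A = (- root_op (transpose a b c) (transpose a b d) (root_op a b f)) A"
    by simp
qed

lemma root_op_square: "a \<noteq> b \<Longrightarrow> root_op a b (root_op a b f) = f"
proof
  fix A assume "a \<noteq> b"
  then show "root_op a b (root_op a b f) A = f A"
    using clifford_anticommute[of a b f A]
    by (simp add: root_op_def[of a b "root_op a b f"] clifford_root_op clifford_square) (simp add: field_simps)
qed

lemma root_op_swap: "root_op b a f = - root_op a b f"
  by (rule ext) (simp add: root_op_def field_simps)

lemma root_op_uminus: "root_op a b (- f) = - root_op a b f"
  by (rule ext) (simp add: root_op_def clifford_def field_simps)

text \<open>The element \<open>z\<close> is represented by \<open>-1\<close>, so that it cannot be trivial in \<open>T\<^sub>n\<close>.\<close>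

fun gen_op :: "T_gen \<Rightarrow> (nat set \<Rightarrow> real) \<Rightarrow> (nat set \<Rightarrow> real)"
  where "gen_op (Gen_t i) = root_op i (Suc i)"
      | "gen_op Gen_z = uminus"

lemma uminus_uminus_fun [simp]: "- (- f) = (f :: 'a \<Rightarrow> real)"
  by (rule ext) simp

lemma gen_op_square: "gen_op x (gen_op x f) = f"
  by (cases x) (simp_all add: root_op_square)

definition word_op :: "T_word \<Rightarrow> (nat set \<Rightarrow> real) \<Rightarrow> (nat set \<Rightarrow> real)"
  where "word_op w = foldr (\<lambda>(x, b) \<Phi>. gen_op x \<circ> \<Phi>) w id"

lemma word_op_simps [simp]: "word_op [] f = f" "word_op ((x, b) # w) f = gen_op x (word_op w f)"
  by (simp_all add: word_op_def)

lemma word_op_append: "word_op (u @ v) f = word_op u (word_op v f)"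
  by (induction u) (auto simp del: gen_op.simps)

text \<open>The braid and commutation relations are instances of \<open>root_op_root_op\<close>.\<close>

lemma word_op_cong: "(u, v) \<in> pres_rel (T_gens n) (T_rels n) \<Longrightarrow> word_op u f = word_op v f"
proof (induction arbitrary: f rule: pres_rel.induct)
  case (rel u v)
  then consider
    (square) i where "u = word_t i @ word_t i" "v = []" | (z) "u = word_z @ word_z" "v = []"
    | (central) i where "u = word_z @ word_t i" "v = word_t i @ word_z"
    | (braid) j where "u = word_t j @ word_t (j + 1) @ word_t j" "v = word_t (j + 1) @ word_t j @ word_t (j + 1)"
    | (commute) k l where "u = word_t k @ word_t l" "v = word_z @ word_t l @ word_t k" "k + 1 < l"
    unfolding T_rels_def by blast
  then show ?case
  proof cases
    case square
    then show ?thesis by (simp add: word_t_def gen_op_square del: gen_op.simps)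
  next
    case z
    then show ?thesis by (simp add: word_z_def gen_op_square del: gen_op.simps)
  next
    case central
    then show ?thesis by (simp only: word_t_def word_z_def append.simps word_op_simps gen_op.simps root_op_uminus)
  next
    case (braid j)
    have "root_op j (Suc j) (root_op (Suc j) (Suc (Suc j)) (root_op j (Suc j) f)) =
      - root_op j (Suc (Suc j)) (root_op j (Suc j) (root_op j (Suc j) f))"
      using root_op_root_op[of j "Suc j" "Suc j" "Suc (Suc j)" "root_op j (Suc j) f"] by simp
    also have "root_op j (Suc j) (root_op j (Suc j) f) = f"
      by (rule root_op_square) simp
    also have "- root_op j (Suc (Suc j)) f =
      - root_op j (Suc (Suc j)) (root_op (Suc j) (Suc (Suc j)) (root_op (Suc j) (Suc (Suc j)) f))"
      by (subst root_op_square[of "Suc j" "Suc (Suc j)" f]) simp_all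
    also have "\<dots> = root_op (Suc j) (Suc (Suc j)) (root_op j (Suc j) (root_op (Suc j) (Suc (Suc j)) f))"
      using root_op_root_op[of "Suc j" "Suc (Suc j)" j "Suc j" "root_op (Suc j) (Suc (Suc j)) f"] by simp
    finally show ?thesis
      using braid by (simp only: word_t_def append.simps word_op_simps gen_op.simps Suc_eq_plus1)
  next
    case (commute k l)
    then have "root_op k (Suc k) (root_op l (Suc l) f) = - root_op l (Suc l) (root_op k (Suc k) f)"
      using root_op_root_op[of k "Suc k" l "Suc l" f] by simp
    with commute show ?thesis
      by (simp only: word_t_def word_z_def append.simps word_op_simps gen_op.simps)
  qed
next
  case (cancel x b)
  then show ?case by (simp add: gen_op_square del: gen_op.simps)
qed (auto simp: word_op_append)

definition T_op :: "T_word set \<Rightarrow> (nat set \<Rightarrow> real) \<Rightarrow> (nat set \<Rightarrow> real)"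
  where "T_op c = the_elem (word_op ` c)"

lemma T_op_class: "w \<in> lists (T_gens n \<times> UNIV) \<Longrightarrow> T_op (T_class n w) = word_op w"
  
  unfolding T_op_def by (rule T_group_lift) (simp_all add: word_op_cong fun_eq_iff)

lemma T_op_mult:
  assumes "g \<in> carrier (T_group n)" "h \<in> carrier (T_group n)"
  shows "T_op (g \<otimes>\<^bsub>T_group n\<^esub> h) f = T_op g (T_op h f)"
proof -
  obtain u v where uv: "u \<in> lists (T_gens n \<times> UNIV)" "g = T_class n u" "v \<in> lists (T_gens n \<times> UNIV)" "h = T_class n v"
    using assms T_group_classE by metis
  then have "u @ v \<in> lists (T_gens n \<times> UNIV)" by simp
  with uv show ?thesis by (simp add: T_class_mult T_op_class word_op_append)
qed

lemma T_op_one: "T_op \<one>\<^bsub>T_group n\<^esub> f = f"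
  using T_op_class[of "[]" n] by (simp add: T_class_Nil word_op_def)

lemma T_op_zeta: "T_op (zeta n) f = - f"
  using T_op_class[OF word_z_lists, of n] by (simp add: zeta_def word_op_def word_z_def)

lemma T_op_tau: "i \<in> {1..<n} \<Longrightarrow> T_op (tau n i) f = root_op i (Suc i) f"
  using T_op_class[OF word_t_lists, of i n] by (simp add: tau_def word_op_def word_t_def)

lemma zeta_neq_one: "zeta n \<noteq> \<one>\<^bsub>T_group n\<^esub>"
proof
  assume eq: "zeta n = \<one>\<^bsub>T_group n\<^esub>"
  have "(\<lambda>A :: nat set. 1 :: real) = - (\<lambda>A. 1)"
    using T_op_zeta[of n "\<lambda>A. 1"] T_op_one[of n "\<lambda>A. 1"] unfolding eq by (simp only:)
  from fun_cong[OF this, of "{}"] show False by simp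
qed

section \<open>Arithmetic in the group algebra of the group of order two\<close>

lemma bit_cases: "(d :: bit) = 0 \<or> d = 1"
  by (cases d) auto

lemma UNIV_bit: "(UNIV :: bit set) = {0, 1}"
  using bit_cases by auto

lemma CC2_eqI: "lookup r 0 = lookup s 0 \<Longrightarrow> lookup r 1 = lookup s 1 \<Longrightarrow> r = (s :: CC2)"
  using bit_cases by (intro poly_mapping_eqI) metis

lemma lookup_zR: "lookup zR 0 = 0" "lookup zR 1 = 1"
  by (simp_all add: zR_def group_elt_def lookup_single)

lemma lookup_const: "lookup (const c) 0 = c" "lookup (const c) 1 = 0"
  by (simp_all add: const_def lookup_single)

lemma zR_square: "zR * zR = 1"
  by (simp add: zR_def group_elt_def mult_single)

lemma zR_neq_one: "zR \<noteq> 1" "1 \<noteq> zR"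
proof -
  have "lookup zR 0 \<noteq> lookup (1 :: CC2) 0" by (simp add: lookup_zR lookup_one)
  then show "zR \<noteq> 1" "1 \<noteq> zR" by auto
qed

lemma const_simps: "const (a + b) = const a + const b" "const (a * b) = const a * const b" "const 1 = 1" "const 0 = 0"
  "const (- a) = - const a" "const (a - b) = const a - const b"
  by (simp_all add: const_def single_add mult_single single_uminus single_diff)

lemma CC2_expand: "r = const (lookup r 0) + const (lookup r 1) * zR"
proof -
  have "const c * zR = single 1 c" for c
    by (simp add: const_def zR_def group_elt_def mult_single)
  then show ?thesis by (intro CC2_eqI) (simp_all add: lookup_add lookup_const lookup_single)
qed

lemma lookup_mult_CC2:
  fixes r s :: CC2
  shows "lookup (r * s) c = (\<Sum>d\<in>UNIV. lookup r d * lookup s (c - d))"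
proof -
  define r0 r1 s0 s1 where "r0 = lookup r 0" "r1 = lookup r 1"
    "s0 = lookup s 0" "s1 = lookup s 1"
  have r: "r = single 0 r0 + single 1 r1"
    by (rule CC2_eqI) (simp_all add: r0_r1_s0_s1_def lookup_add lookup_single)
  have s: "s = single 0 s0 + single 1 s1"
    by (rule CC2_eqI) (simp_all add: r0_r1_s0_s1_def lookup_add lookup_single)
  have "r * s = single 0 (r0 * s0 + r1 * s1) + single 1 (r0 * s1 + r1 * s0)"
    unfolding r s by (simp add: algebra_simps mult_single single_add)
  then have "lookup (r * s) 0 = r0 * s0 + r1 * s1" "lookup (r * s) 1 = r0 * s1 + r1 * s0"
    by (simp_all add: lookup_add lookup_single)
  then show ?thesis
    using bit_cases[of c] by (auto simp: UNIV_bit r0_r1_s0_s1_def)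
qed

lemma subst_z_simps:
  "subst_z c (r + s) = subst_z c r + subst_z c s" "subst_z c (r - s) = subst_z c r - subst_z c s"
  "subst_z c 1 = 1" "subst_z c 0 = 0" "subst_z c zR = c" "subst_z c (const a) = a" "subst_z c (- r) = - subst_z c r"
  by (simp_all add: subst_z_def lookup_add lookup_minus lookup_one lookup_zR lookup_const algebra_simps)

lemma subst_z_mult: "c * c = 1 \<Longrightarrow> subst_z c (r * s) = subst_z c r * subst_z c s"
  unfolding subst_z_def lookup_mult_CC2 
proof -
  assume c: "c * c = 1"
  have c': "c * (c * a) = a" for a using c by (simp flip: mult.assoc)
  show "(\<Sum>d\<in>UNIV. lookup r d * lookup s (0 - d)) + c * (\<Sum>d\<in>UNIV. lookup r d * lookup s (1 - d)) =
    (lookup r 0 + c * lookup r 1) * (lookup s 0 + c * lookup s 1)"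
    by (simp add: UNIV_bit c' algebra_simps)
qed

lemma subst_z_inject: "subst_z 1 r = subst_z 1 s \<Longrightarrow> subst_z (- 1) r = subst_z (- 1) s \<Longrightarrow> r = s"
proof (rule CC2_eqI)
  have lookup: "lookup t 0 = (subst_z 1 t + subst_z (- 1) t) / 2"
    "lookup t 1 = (subst_z 1 t - subst_z (- 1) t) / 2" for t
    by (simp_all add: subst_z_def)
  show "subst_z 1 r = subst_z 1 s \<Longrightarrow> subst_z (- 1) r = subst_z (- 1) s \<Longrightarrow> lookup r 0 = lookup s 0"
    "subst_z 1 r = subst_z 1 s \<Longrightarrow> subst_z (- 1) r = subst_z (- 1) s \<Longrightarrow> lookup r 1 = lookup s 1"
    by (simp_all only: lookup)
qed

lemma subst_z_idem:
  "subst_z 1 idem_plus = 1" "subst_z (- 1) idem_plus = 0" "subst_z 1 idem_minus = 0" "subst_z (- 1) idem_minus = 1"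
  by (simp_all add: idem_plus_def idem_minus_def subst_z_mult subst_z_simps)

section \<open>The functions \<open>q\<close>\<close>

definition is_qfun :: "nat \<Rightarrow> 'k::comm_ring_1 \<Rightarrow> (perm \<times> perm \<Rightarrow> 'k) \<Rightarrow> bool"
  where "is_qfun n \<epsilon> q \<longleftrightarrow>
     q \<in> carrier (sym_group n) \<times> transpositions n \<rightarrow>\<^sub>E {u. u dvd 1} \<and>
     (\<forall>\<rho> \<in> carrier (sym_group n). \<forall>\<sigma> \<in> carrier (sym_group n). \<forall>\<tau> \<in> transpositions n.
        q (\<rho> \<circ> \<sigma>, \<tau>) = q (\<rho>, conj_perm \<sigma> \<tau>) * q (\<sigma>, \<tau>)) \<and>
     (\<forall>\<sigma> \<in> transpositions n. \<forall>i j. 1 \<le> i \<and> i < j \<and> j \<le> n \<longrightarrow>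
        q (\<sigma>, transpose i j) = (if \<sigma> i < \<sigma> j then \<epsilon> else - 1))"

lemma transpose_eq_transpose:
  assumes "i < j" "k < l" "transpose i j = transpose k (l :: nat)"
  shows "i = k \<and> j = l"
  using assms by (metis less_imp_neq nat_less_le not_less_iff_gr_or_eq transpose_apply_first transpose_apply_other transpose_apply_second)

lemma is_qfun_mult:
  assumes "is_qfun n \<epsilon> q" "\<rho> \<in> carrier (sym_group n)" "\<sigma> \<in> carrier (sym_group n)" "\<tau> \<in> transpositions n"
  shows "q (\<rho> \<circ> \<sigma>, \<tau>) = q (\<rho>, conj_perm \<sigma> \<tau>) * q (\<sigma>, \<tau>)"
  using assms unfolding is_qfun_def by blast

text \<open>The symmetric group is generated by transpositions, and at the identity the equation forces an
  idempotent unit, that is, \<open>1\<close>.\<close>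

lemma is_qfun_unique:
  assumes p: "is_qfun n \<epsilon> p" and q: "is_qfun n \<epsilon> q"
  shows "p = q"
proof (rule PiE_ext)
  show "p \<in> carrier (sym_group n) \<times> transpositions n \<rightarrow>\<^sub>E {u. u dvd 1}"
    "q \<in> carrier (sym_group n) \<times> transpositions n \<rightarrow>\<^sub>E {u. u dvd 1}"
    using p q by (auto simp: is_qfun_def)
  have one: "r (id, \<tau>) = 1" if "is_qfun n \<epsilon> r" "\<tau> \<in> transpositions n" for r and \<tau>
  proof -
    have id: "id \<in> carrier (sym_group n)" by (simp add: sym_group_def permutes_id)
    have "conj_perm id \<tau> = \<tau>" by (simp add: conj_perm_def inv_id)
    then have "r (id, \<tau>) = r (id, \<tau>) * r (id, \<tau>)"
      using that id unfolding is_qfun_def by (metis comp_id)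
    moreover have "r (id, \<tau>) dvd 1" using that id unfolding is_qfun_def by blast
    then obtain u where "1 = r (id, \<tau>) * u" by (rule dvdE)
    ultimately show ?thesis by (metis mult.assoc mult.right_neutral)
  qed
  have "p (\<sigma>, \<tau>) = q (\<sigma>, \<tau>)" if "\<sigma> permutes {1..n}" "\<tau> \<in> transpositions n" for \<sigma> \<tau>
    using that(1) finite_atLeastAtMost[of 1 n]
  proof (induction rule: permutes_induct)
    case id
    show ?case by (simp only: one[OF p that(2)] one[OF q that(2)])
  next
    case (swap a b \<pi>)
    have ab: "transpose a b \<in> transpositions n" using swap by (intro transpose_transpositions)
    then have ab': "transpose a b \<in> carrier (sym_group n)"
      using transposition_permutes by (simp add: sym_group_def)
    have \<pi>: "\<pi> \<in> carrier (sym_group n)" using swap by (simp add: sym_group_def)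
    have conj: "conj_perm \<pi> \<tau> \<in> transpositions n" using swap that(2) by (intro conj_perm_transpositions)
    then obtain i j where ij: "conj_perm \<pi> \<tau> = transpose i j" "1 \<le> i" "i < j" "j \<le> n" by (rule transpositionsE)
    have eq: "p (transpose a b, conj_perm \<pi> \<tau>) = q (transpose a b, conj_perm \<pi> \<tau>)"
      using p q ab ij unfolding is_qfun_def by simp
    show ?case
      by (simp only: is_qfun_mult[OF p ab' \<pi> that(2)] is_qfun_mult[OF q ab' \<pi> that(2)] eq swap.IH)
  qed
  then show "p x = q x" if "x \<in> carrier (sym_group n) \<times> transpositions n" for x
    using that by (auto simp: sym_group_def)
qed

text \<open>The function is a product of two solutions of the multiplicative equation: a power of \<open>\<epsilon>\<close> given by the
  sign of \<open>\<sigma>\<close>, and the factor \<open>-\<epsilon>\<close> when \<open>\<sigma>\<close> inverts the pair that \<open>\<tau>\<close> exchanges. On transpositions, which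
  are odd, the values are \<open>\<epsilon>\<close> and \<open>-\<epsilon>\<^sup>2 = -1\<close>.\<close>

lemma ex_qfun:
  assumes "\<epsilon> * \<epsilon> = (1 :: 'k::comm_ring_1)"
  shows "\<exists>q. is_qfun n \<epsilon> q"
proof -
  define asc where "asc \<sigma> \<tau> \<longleftrightarrow> (\<exists>i j. 1 \<le> i \<and> i < j \<and> j \<le> n \<and> \<tau> = transpose i j \<and> \<sigma> i < \<sigma> j)" for \<sigma> \<tau> :: perm
  have asc: "asc \<sigma> (transpose i j) \<longleftrightarrow> \<sigma> i < \<sigma> j" if "1 \<le> i" "i < j" "j \<le> n" for \<sigma> i j
    unfolding asc_def using that transpose_eq_transpose by blast
  define q :: "perm \<times> perm \<Rightarrow> 'k" where
    "q = (\<lambda>(\<sigma>, \<tau>) \<in> carrier (sym_group n) \<times> transpositions n.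
       (if evenperm \<sigma> then 1 else \<epsilon>) * (if asc \<sigma> \<tau> then 1 else - \<epsilon>))"
  have q: "q (\<sigma>, \<tau>) = (if evenperm \<sigma> then 1 else \<epsilon>) * (if asc \<sigma> \<tau> then 1 else - \<epsilon>)"
    if "\<sigma> permutes {1..n}" "\<tau> \<in> transpositions n" for \<sigma> \<tau>
    using that by (simp add: q_def sym_group_def)
  have "is_qfun n \<epsilon> q"
    unfolding is_qfun_def
  proof (intro conjI ballI allI impI)
    have "u * u = 1 \<Longrightarrow> u dvd 1" for u :: 'k by (metis dvd_triv_left)
    moreover have "((if b then 1 else \<epsilon>) * (if c then 1 else - \<epsilon>)) * ((if b then 1 else \<epsilon>) * (if c then 1 else - \<epsilon>)) = 1" for b c
      using assms by (auto simp: algebra_simps)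
    ultimately show "q \<in> carrier (sym_group n) \<times> transpositions n \<rightarrow>\<^sub>E {u. u dvd 1}"
      unfolding q_def by auto
  next
    fix \<rho> \<sigma> \<tau> assume "\<rho> \<in> carrier (sym_group n)" "\<sigma> \<in> carrier (sym_group n)" and \<tau>: "\<tau> \<in> transpositions n"
    then have \<rho>: "\<rho> permutes {1..n}" and \<sigma>: "\<sigma> permutes {1..n}" by (auto simp: sym_group_def)
    obtain i j where ij: "\<tau> = transpose i j" "1 \<le> i" "i < j" "j \<le> n" using \<tau> by (rule transpositionsE)
    have even: "evenperm (\<rho> \<circ> \<sigma>) \<longleftrightarrow> (evenperm \<rho> \<longleftrightarrow> evenperm \<sigma>)"
      using \<rho> \<sigma> by (intro evenperm_comp) (auto simp: permutation_permutes)
    have conj: "conj_perm \<sigma> \<tau> = transpose (\<sigma> i) (\<sigma> j)" using ij(1) permutes_bij[OF \<sigma>] by (simp add: conj_perm_transpose)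
    have in1: "\<sigma> i \<in> {1..n}" "\<sigma> j \<in> {1..n}" using ij permutes_in_image[OF \<sigma>] by auto
    have neq: "\<sigma> i \<noteq> \<sigma> j" "\<rho> (\<sigma> i) \<noteq> \<rho> (\<sigma> j)"
      using ij permutes_inj[OF \<rho>] permutes_inj[OF \<sigma>] by (auto dest: injD)
    have "asc \<rho> (conj_perm \<sigma> \<tau>) \<longleftrightarrow> (\<sigma> i < \<sigma> j \<longleftrightarrow> \<rho> (\<sigma> i) < \<rho> (\<sigma> j))"
    proof (cases "\<sigma> i < \<sigma> j")
      case True
      then show ?thesis unfolding conj using asc[of "\<sigma> i" "\<sigma> j" \<rho>] in1 by auto
    next
      case False
      then show ?thesis unfolding conj transpose_commute[of "\<sigma> j" "\<sigma> i", symmetric]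
        using asc[of "\<sigma> j" "\<sigma> i" \<rho>] in1 neq by auto
    qed
    moreover have "asc \<sigma> \<tau> \<longleftrightarrow> \<sigma> i < \<sigma> j" "asc (\<rho> \<circ> \<sigma>) \<tau> \<longleftrightarrow> \<rho> (\<sigma> i) < \<rho> (\<sigma> j)"
      using asc ij by auto
    moreover have "a * (\<epsilon> * \<epsilon>) = a" for a using assms by simp
    ultimately show "q (\<rho> \<circ> \<sigma>, \<tau>) = q (\<rho>, conj_perm \<sigma> \<tau>) * q (\<sigma>, \<tau>)"
      using q[OF permutes_compose[OF \<sigma> \<rho>] \<tau>] q[OF \<rho> conj_perm_transpositions[OF \<sigma> \<tau>]] q[OF \<sigma> \<tau>] assms even
      by (auto simp: algebra_simps)
  next
    fix \<sigma> i j assume \<sigma>: "\<sigma> \<in> transpositions n" and ij: "1 \<le> i \<and> i < j \<and> j \<le> n"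
    have "\<not> evenperm \<sigma>" using \<sigma> by (elim transpositionsE) (simp add: evenperm_swap)
    moreover have "transpose i j \<in> transpositions n" using ij by (auto simp: transpositions_def)
    ultimately show "q (\<sigma>, transpose i j) = (if \<sigma> i < \<sigma> j then \<epsilon> else - 1)"
      using q[OF transposition_permutes[OF \<sigma>]] asc[of i j \<sigma>] ij assms by auto
  qed
  then show ?thesis by blast
qed

lemma is_qfun_qfun:
  assumes "\<epsilon> * \<epsilon> = 1" shows "is_qfun n \<epsilon> (qfun n \<epsilon>)"
proof -
  have "qfun n \<epsilon> = (THE q. is_qfun n \<epsilon> q)" by (simp add: qfun_def is_qfun_def)
  moreover obtain q where q: "is_qfun n \<epsilon> q" using ex_qfun[OF assms] by blast
  have "is_qfun n \<epsilon> (THE q. is_qfun n \<epsilon> q)"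
    by (rule theI[of "is_qfun n \<epsilon>", OF q is_qfun_unique[OF _ q]])
  ultimately show ?thesis by simp
qed

lemma qfun_transpose:
  assumes "\<epsilon> * \<epsilon> = 1" "\<sigma> \<in> transpositions n" "1 \<le> i" "i < j" "j \<le> n"
  shows "qfun n \<epsilon> (\<sigma>, transpose i j) = (if \<sigma> i < \<sigma> j then \<epsilon> else - 1)"
  using is_qfun_qfun[OF assms(1), of n] assms(2-) unfolding is_qfun_def by blast

text \<open>Both sides are the value at \<open>(xy, z)\<close>, computed from \<open>xy = (xyx\<inverse>)x\<close> and from \<open>xy\<close> itself.\<close>

lemma rack_cocycle_qfun:
  assumes "\<epsilon> * \<epsilon> = 1"
  shows "rack_cocycle n (qfun n \<epsilon>)"
proof
  fix x y z assume *: "x \<in> transpositions n" "y \<in> transpositions n" "z \<in> transpositions n"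
  have mult: "qfun n \<epsilon> (\<rho> \<circ> \<sigma>, z) = qfun n \<epsilon> (\<rho>, conj_perm \<sigma> z) * qfun n \<epsilon> (\<sigma>, z)"
    if "\<rho> \<in> transpositions n" "\<sigma> \<in> transpositions n" for \<rho> \<sigma>
    using transposition_permutes[OF that(1)] transposition_permutes[OF that(2)]
    by (intro is_qfun_mult[OF is_qfun_qfun[OF assms] _ _ *(3)]) (simp_all add: sym_group_def)
  have "qfun n \<epsilon> (conj_perm x y \<circ> x, z) = qfun n \<epsilon> (x \<circ> y, z)"
    using transposition_bij[OF *(1)] by (simp add: conj_perm_comp)
  then show "qfun n \<epsilon> (x, z) * qfun n \<epsilon> (conj_perm x y, conj_perm x z) = qfun n \<epsilon> (y, z) * qfun n \<epsilon> (x, conj_perm y z)"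
    using mult[of "conj_perm x y" x] mult[of x y] * conj_perm_transposition_closed by (simp add: mult.commute)
qed

section \<open>The cocycle of a section\<close>

locale T_section =
  fixes n :: nat and T :: "perm \<Rightarrow> T_word set"
  assumes is_section: "is_section n T"
begin

abbreviation "G \<equiv> T_group n"
abbreviation "\<mu> \<equiv> cocycle_1z n T"

sublocale G: group G by (rule group_T_group)

lemma T_closed [simp]: "\<sigma> permutes {1..n} \<Longrightarrow> T \<sigma> \<in> carrier G"
  and T_proj_T: "\<sigma> permutes {1..n} \<Longrightarrow> T_proj (T \<sigma>) = \<sigma>"
  and T_id: "T id = \<one>\<^bsub>G\<^esub>"
  using is_section by (auto simp: is_section_def sym_group_def)

text \<open>The subgroup \<open>{1, z}\<close> of the units of \<open>R\<close>, embedded in \<open>T\<^sub>n\<close> as the kernel of the projection.\<close>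

definition z_power :: "CC2 \<Rightarrow> T_word set"
  where "z_power u = (if u = 1 then \<one>\<^bsub>G\<^esub> else zeta n)"

lemma z_power_closed [simp]: "z_power u \<in> carrier G"
  by (simp add: z_power_def)

lemma z_power_central: "g \<in> carrier G \<Longrightarrow> z_power u \<otimes>\<^bsub>G\<^esub> g = g \<otimes>\<^bsub>G\<^esub> z_power u"
  by (simp add: z_power_def zeta_central)

lemma z_power_mult: "u \<in> {1, zR} \<Longrightarrow> v \<in> {1, zR} \<Longrightarrow> z_power (u * v) = z_power u \<otimes>\<^bsub>G\<^esub> z_power v"
  by (auto simp: z_power_def zR_square zeta_square)

lemma z_power_inject: "u \<in> {1, zR} \<Longrightarrow> v \<in> {1, zR} \<Longrightarrow> z_power u = z_power v \<Longrightarrow> u = v"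
  using zeta_neq_one[of n] zR_neq_one by (auto simp: z_power_def split: if_splits)

lemma mu_values: "\<mu> g h \<in> {1, zR}"
  by (simp add: cocycle_1z_def)

lemma T_mult:
  assumes g: "g permutes {1..n}" and h: "h permutes {1..n}"
  shows "T g \<otimes>\<^bsub>G\<^esub> T h = z_power (\<mu> g h) \<otimes>\<^bsub>G\<^esub> T (g \<circ> h)"
proof -
  have gh: "g \<circ> h permutes {1..n}" using g h by (simp add: permutes_compose)
  define k where "k = T g \<otimes>\<^bsub>G\<^esub> T h \<otimes>\<^bsub>G\<^esub> inv\<^bsub>G\<^esub> T (g \<circ> h)"
  have k: "k \<in> carrier G" "k \<otimes>\<^bsub>G\<^esub> T (g \<circ> h) = T g \<otimes>\<^bsub>G\<^esub> T h"
    using g h gh by (simp_all add: k_def G.m_assoc)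
  have "T_proj k \<circ> (g \<circ> h) = g \<circ> h"
    using T_proj_mult[OF k(1) T_closed[OF gh]] k(2) T_proj_mult[of "T g" n "T h"] g h gh by (simp add: T_proj_T)
  then have "T_proj k = id"
    using permutes_bij[OF gh] by (metis bij_is_surj comp_assoc comp_id surj_iff)
  then have "k = \<one>\<^bsub>G\<^esub> \<or> k = zeta n" using k(1) T_proj_kernel by blast
  then have "k = z_power (\<mu> g h)"
    using zeta_neq_one[of n] zR_neq_one by (auto simp: z_power_def cocycle_1z_def k_def)
  then show ?thesis using k(2) by simp
qed

text \<open>Compare the two ways to bracket \<open>T(g) T(h) T(k)\<close>.\<close>

lemma mu_cocycle:
  assumes g: "g permutes {1..n}" and h: "h permutes {1..n}" and k: "k permutes {1..n}"
  shows "\<mu> g h * \<mu> (g \<circ> h) k = \<mu> g (h \<circ> k) * \<mu> h k"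
proof -
  have gh: "g \<circ> h permutes {1..n}" and hk: "h \<circ> k permutes {1..n}" and ghk: "g \<circ> h \<circ> k permutes {1..n}"
    using g h k by (auto intro: permutes_compose)
  have "T g \<otimes>\<^bsub>G\<^esub> T h \<otimes>\<^bsub>G\<^esub> T k = z_power (\<mu> g h * \<mu> (g \<circ> h) k) \<otimes>\<^bsub>G\<^esub> T (g \<circ> h \<circ> k)"
    using g h k gh ghk by (simp add: T_mult G.m_assoc z_power_mult[OF mu_values mu_values])
  moreover have "T g \<otimes>\<^bsub>G\<^esub> (T h \<otimes>\<^bsub>G\<^esub> T k) = z_power (\<mu> g (h \<circ> k) * \<mu> h k) \<otimes>\<^bsub>G\<^esub> T (g \<circ> h \<circ> k)"
  proof -
    have "T g \<otimes>\<^bsub>G\<^esub> (T h \<otimes>\<^bsub>G\<^esub> T k) = T g \<otimes>\<^bsub>G\<^esub> z_power (\<mu> h k) \<otimes>\<^bsub>G\<^esub> T (h \<circ> k)"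
      using g h k hk by (simp add: T_mult G.m_assoc)
    also have "\<dots> = z_power (\<mu> h k) \<otimes>\<^bsub>G\<^esub> (T g \<otimes>\<^bsub>G\<^esub> T (h \<circ> k))"
      using g hk by (simp add: G.m_assoc flip: z_power_central)
    also have "\<dots> = z_power (\<mu> h k * \<mu> g (h \<circ> k)) \<otimes>\<^bsub>G\<^esub> T (g \<circ> h \<circ> k)"
      using g hk ghk T_mult[OF g hk] by (simp add: G.m_assoc z_power_mult[OF mu_values mu_values] o_assoc)
    finally show ?thesis by (simp add: mult.commute)
  qed
  ultimately have "z_power (\<mu> g h * \<mu> (g \<circ> h) k) = z_power (\<mu> g (h \<circ> k) * \<mu> h k)"
    using G.m_assoc[of "T g" "T h" "T k"] g h k ghk by simp
  moreover have closed: "u * v \<in> {1, zR}" if "u \<in> {1, zR}" "v \<in> {1, zR}" for u v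
    using that by (auto simp: zR_square)
  ultimately show ?thesis
    using z_power_inject[OF closed[OF mu_values mu_values] closed[OF mu_values mu_values]] by simp
qed

lemma mu_normalised:
  assumes "g permutes {1..n}"
  shows "\<mu> id g = 1" "\<mu> g id = 1"
  using assms by (simp_all add: cocycle_1z_def T_id)

lemma mu_cocycles2: "\<mu> \<in> cocycles2 (sym_group n) C2"
  using mu_values mu_cocycle mu_normalised by (auto simp: cocycles2_def C2_def sym_group_def)

text \<open>Conjugation by \<open>t\<^sub>j\<close> is minus a reflection; the factor \<open>z\<close> in the recursion for the section cancels this
  sign.\<close>

lemma T_op_T_transpose:
  assumes "1 \<le> i" "i < j" "j \<le> n"
  shows "T_op (T (transpose i j)) f = root_op i j f"
  using assms(2,3)
proof (induction j arbitrary: f)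
  case (Suc j)
  show ?case
  proof (cases "i = j")
    case True
    then have "T (transpose i (Suc j)) = tau n i"
      using is_section assms(1) Suc.prems by (auto simp: is_section_def tau_def)
    then show ?thesis using T_op_tau[of i n f] assms(1) Suc.prems True by simp
  next
    case False
    then have ij: "i < j" "j < n" using Suc.prems by auto
    then have j: "j \<in> {1..<n}" using assms(1) by simp
    have "transpose i j permutes {1..n}" using assms(1) ij by (intro permutes_swap_id) auto
    note Tij = T_closed[OF this]
    have "inv\<^bsub>G\<^esub> tau n j = tau n j" using j tau_square by (intro G.inv_equality) auto
    then have "T (transpose i (Suc j)) =
      zeta n \<otimes>\<^bsub>G\<^esub> tau n j \<otimes>\<^bsub>G\<^esub> T (transpose i j) \<otimes>\<^bsub>G\<^esub> tau n j"
      using is_section assms(1) ij by (auto simp: is_section_def tau_def zeta_def)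
    also have "\<dots> = zeta n \<otimes>\<^bsub>G\<^esub> (tau n j \<otimes>\<^bsub>G\<^esub> (T (transpose i j) \<otimes>\<^bsub>G\<^esub> tau n j))"
      using Tij j by (simp add: G.m_assoc)
    finally have "T_op (T (transpose i (Suc j))) f = - root_op j (Suc j) (root_op i j (root_op j (Suc j) f))"
      using Tij j Suc.IH[of "root_op j (Suc j) f"] ij by (simp add: T_op_mult T_op_zeta T_op_tau)
    also have "\<dots> = root_op i (Suc j) f"
      using root_op_root_op[of j "Suc j" i j "root_op j (Suc j) f"] root_op_square[of j "Suc j" f] ij by simp
    finally show ?thesis .
  qed
qed simp

text \<open>In terms of the group \<open>T\<^sub>n\<close> this is the commutation rule for lifted transpositions. Both products
  \<open>T(x) T(y)\<close> and \<open>T(xyx\<inverse>) T(x)\<close> lie over \<open>xy\<close>, so they differ by a power of \<open>z\<close>, and the spin representation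
  tells which one: there the reflection \<open>x\<close> sends the vector of \<open>y\<close> to plus or minus that of \<open>xyx\<inverse>\<close>,
  according to whether \<open>x\<close> preserves the order of the two points that \<open>y\<close> exchanges.\<close>

lemma mu_swap:
  assumes x: "x \<in> transpositions n" and y: "1 \<le> i" "i < j" "j \<le> n"
  shows "\<mu> x (transpose i j) = (if x i < x j then zR else 1) * \<mu> (conj_perm x (transpose i j)) x"
proof -
  let ?y = "transpose i j" and ?c = "conj_perm x (transpose i j)"
  have y': "?y \<in> transpositions n" using y by (auto simp: transpositions_def)
  have c: "?c \<in> transpositions n" "?c = transpose (x i) (x j)" "?c \<circ> x = x \<circ> ?y"
    using conj_perm_transposition_closed[OF x y'] transposition_bij[OF x] conj_perm_comp conj_perm_transpose
    by blast+
  note perm = transposition_permutes[OF x] transposition_permutes[OF y'] transposition_permutes[OF c(1)]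
  have xy: "x \<circ> ?y permutes {1..n}" using perm by (intro permutes_compose)
  \<comment> \<open>chosen so that \<open>F\<close> is a nonzero vector, on which a sign can be seen\<close>
  define f where "f = T_op (inv\<^bsub>G\<^esub> T (x \<circ> ?y)) (\<lambda>A. 1)"
  define F where "F = T_op (T (x \<circ> ?y)) f"
  have "F = T_op (T (x \<circ> ?y) \<otimes>\<^bsub>G\<^esub> inv\<^bsub>G\<^esub> T (x \<circ> ?y)) (\<lambda>A. 1)"
    unfolding F_def f_def using T_op_mult[OF T_closed[OF xy] G.inv_closed[OF T_closed[OF xy]]] by (rule HOL.sym)
  also have "\<dots> = (\<lambda>A. 1)" unfolding G.r_inv[OF T_closed[OF xy]] by (rule T_op_one)
  finally have "F = (\<lambda>A. 1)" .
  then have F: "F \<noteq> - F" "- F \<noteq> F" by (auto dest: fun_cong)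
  have sign: "T_op (z_power u) f' = (if u = 1 then f' else - f')" for u f'
    by (simp add: z_power_def T_op_one T_op_zeta)
  have lift: "T_op (T g) (T_op (T h) f) = (if \<mu> g h = 1 then F else - F)"
    if "g permutes {1..n}" "h permutes {1..n}" "g \<circ> h = x \<circ> ?y" for g h
  proof -
    have "T_op (T g) (T_op (T h) f) = T_op (T g \<otimes>\<^bsub>G\<^esub> T h) f"
      using T_op_mult[OF T_closed[OF that(1)] T_closed[OF that(2)]] by (rule HOL.sym)
    also have "\<dots> = T_op (z_power (\<mu> g h)) F"
      unfolding T_mult[OF that(1,2)] that(3) F_def using T_op_mult[OF z_power_closed T_closed[OF xy]] .
    finally show ?thesis unfolding sign .
  qed
  note 1 = lift[OF perm(1,2) HOL.refl] and 2 = lift[OF perm(3,1) c(3)]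
  obtain a b where ab: "x = transpose a b" "1 \<le> a" "a < b" "b \<le> n" using x by (rule transpositionsE)
  have Tx: "T_op (T x) h = root_op a b h" for h
    using T_op_T_transpose[OF ab(2-4)] ab(1) by simp
  have Ty: "T_op (T ?y) h = root_op i j h" for h
    using T_op_T_transpose[OF y] .
  have refl: "T_op (T x) (T_op (T ?y) f) = - root_op (x i) (x j) (T_op (T x) f)"
    unfolding Tx Ty using root_op_root_op[of a b i j f] ab by simp
  have range: "x i \<in> {1..n}" "x j \<in> {1..n}" "x i \<noteq> x j"
    using permutes_in_image[OF perm(1)] y permutes_inj[OF perm(1)] by (auto dest: injD)
  show ?thesis
  proof (cases "x i < x j")
    case True
    then have "T_op (T x) (T_op (T ?y) f) = - T_op (T ?c) (T_op (T x) f)"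
      unfolding refl c(2) using range by (subst T_op_T_transpose) auto
    then have "\<mu> x ?y = 1 \<longleftrightarrow> \<mu> ?c x \<noteq> 1" unfolding 1 2 using F by (auto split: if_splits)
    then show ?thesis
      using True mu_values[of x ?y] mu_values[of ?c x] zR_neq_one by (auto simp: zR_square)
  next
    case False
    then have "T_op (T ?c) (T_op (T x) f) = root_op (x j) (x i) (T_op (T x) f)"
      unfolding c(2) transpose_commute[of "x j" "x i", symmetric] using range by (subst T_op_T_transpose) auto
    then have "T_op (T x) (T_op (T ?y) f) = T_op (T ?c) (T_op (T x) f)"
      unfolding refl root_op_swap[of "x i" "x j"] by simp
    then have "\<mu> x ?y = 1 \<longleftrightarrow> \<mu> ?c x = 1" unfolding 1 2 using F by (auto split: if_splits)
    then show ?thesis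
      using False mu_values[of x ?y] mu_values[of ?c x] zR_neq_one by auto
  qed
qed

end

section \<open>Rescaling the coefficients of words\<close>

text \<open>The coefficient of the word \<open>w\<close> is changed by \<open>h w\<close>. The condition says that this intertwines the two
  braidings at one place of a word.\<close>

definition braid_compatible ::
    "nat \<Rightarrow> (perm \<times> perm \<Rightarrow> 'k::comm_ring_1) \<Rightarrow> (perm \<times> perm \<Rightarrow> 'l::comm_ring_1) \<Rightarrow> (perm list \<Rightarrow> 'k \<Rightarrow> 'l) \<Rightarrow> bool"
  where "braid_compatible n q q' h \<longleftrightarrow> (\<forall>w. additive (h w)) \<and>
    (\<forall>u \<in> lists (transpositions n). \<forall>v \<in> lists (transpositions n). \<forall>x \<in> transpositions n. \<forall>y \<in> transpositions n. \<forall>c.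
       h (u @ conj_perm x y # x # v) (c * q (x, y)) = h (u @ x # y # v) c * q' (x, y))"

lemma wordwise_braiding:
  assumes h: "braid_compatible n q q' h" and f: "keys f \<subseteq> words n m" and i: "1 \<le> i" "i < m"
  shows "wordwise h (braiding q i f) = braiding q' i (wordwise h f)"
proof (rule additive_eqI[OF _ _ f])
  have add: "\<And>w. additive (h w)" using h by (simp add: braid_compatible_def)
  show "additive (\<lambda>f. wordwise h (braiding q i f))" "additive (\<lambda>f. braiding q' i (wordwise h f))"
    by (rule additive_comp[OF additive_wordwise[OF add] additive_braiding]
        additive_comp[OF additive_braiding additive_wordwise[OF add]])+
  fix w :: "perm list" and c :: 'a assume "w \<in> words n m"
  then obtain u x y v where *: "w = u @ x # y # v" "i = Suc (length u)" "x \<in> transpositions n" "y \<in> transpositions n"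
    "u \<in> lists (transpositions n)" "v \<in> lists (transpositions n)" using i by (rule words_split)
  have "h (u @ conj_perm x y # x # v) (c * q (x, y)) = h (u @ x # y # v) c * q' (x, y)"
    using h *(3-6) unfolding braid_compatible_def by blast
  then show "wordwise h (braiding q i (single w c)) = braiding q' i (wordwise h (single w c))"
    unfolding *(1,2) by (simp only: braiding_split wordwise_single[OF add])
qed

lemma wordwise_braid_word:
  assumes h: "braid_compatible n q q' h" and f: "keys f \<subseteq> words n m" and "set is \<subseteq> {1..<m}"
  shows "wordwise h (braid_word q is f) = braid_word q' is (wordwise h f)"
  using assms(3)
proof (induction "is")
  case (Cons i "is")
  then show ?case using wordwise_braiding[OF h keys_braid_word[OF f], of "is" i q] by simp
qed simp

lemma wordwise_braided_factorial:
  assumes q: "rack_cocycle n q" and q': "rack_cocycle n q'"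
    and h: "braid_compatible n q q' h" and f: "keys f \<subseteq> words n m"
  shows "wordwise h (braided_factorial q m f) = braided_factorial q' m (wordwise h f)"
proof -
  have add: "\<And>w. additive (h w)" using h by (simp add: braid_compatible_def)
  have f': "keys (wordwise h f) \<subseteq> words n m" using keys_wordwise f by blast
  show ?thesis
    unfolding rack_cocycle.braided_factorial_asc_word[OF q f] rack_cocycle.braided_factorial_asc_word[OF q' f']
      additive.sum[OF additive_wordwise[OF add]]
    by (intro sum.cong HOL.refl wordwise_braid_word[OF h f] asc_word(2)) simp
qed

lemma degree_part_wordwise:
  assumes "\<And>w. additive (h w)"
  shows "degree_part m (wordwise h f) = wordwise h (degree_part m f)"
  using additive.zero[OF assms]
  by (intro poly_mapping_eqI) (simp add: degree_part_lookup lookup_wordwise[OF assms])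

text \<open>Compatible maps commute with \<open>[m]!\<close>, hence carry its kernel into the corresponding kernel. If the family
  separates coefficients, then \<open>[m]!\<close> vanishes on an element as soon as it does on all of its images.\<close>

lemma nichols_ideal_iff_wordwise:
  assumes q: "rack_cocycle n q" and q': "\<And>d. d \<in> D \<Longrightarrow> rack_cocycle n (q' d)"
    and h: "\<And>d. d \<in> D \<Longrightarrow> braid_compatible n q (q' d) (h d)"
    and sep: "\<And>w c. w \<in> lists (transpositions n) \<Longrightarrow> \<forall>d\<in>D. h d w c = 0 \<Longrightarrow> c = 0"
    and f: "keys f \<subseteq> lists (transpositions n)"
  shows "f \<in> nichols_ideal n q \<longleftrightarrow> (\<forall>d\<in>D. wordwise (h d) f \<in> nichols_ideal n (q' d))"
proof -
  have keys: "keys (degree_part m f) \<subseteq> words n m" for m by (rule keys_degree_part[OF f])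
  have add: "\<And>w. additive (h d w)" if "d \<in> D" for d using h[OF that] by (simp add: braid_compatible_def)
  have "wordwise (h d) f \<in> nichols_ideal n (q' d) \<longleftrightarrow> (\<forall>m. wordwise (h d) (braided_factorial q m (degree_part m f)) = 0)"
    if d: "d \<in> D" for d
  proof -
    have "keys (wordwise (h d) f) \<subseteq> lists (transpositions n)" using keys_wordwise f by blast
    then show ?thesis
      using wordwise_braided_factorial[OF q q'[OF d] h[OF d] keys]
      by (simp add: nichols_ideal_def degree_part_wordwise[OF add[OF d]])
  qed
  moreover have "g = 0 \<longleftrightarrow> (\<forall>d\<in>D. wordwise (h d) g = 0)" if "keys g \<subseteq> lists (transpositions n)" for g
  proof
    assume "g = 0"
    then show "\<forall>d\<in>D. wordwise (h d) g = 0" by (simp add: wordwise_def)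
  next
    assume *: "\<forall>d\<in>D. wordwise (h d) g = 0"
    show "g = 0"
    proof (rule poly_mapping_eqI)
      fix w
      show "lookup g w = lookup 0 w"
      proof (cases "w \<in> lists (transpositions n)")
        case True
        have "h d w (lookup g w) = 0" if "d \<in> D" for d
          using * that lookup_wordwise[where h = "h d" and f = g and w = w, OF add[OF that]] by simp
        then show ?thesis using sep[OF True] by simp
      next
        case False
        then have "w \<notin> keys g" using that by blast
        then show ?thesis by (simp add: in_keys_iff)
      qed
    qed
  qed
  moreover have "keys (braided_factorial q m (degree_part m f)) \<subseteq> lists (transpositions n)" for m
  proof -
    have "keys (braided_factorial q m (degree_part m f)) \<subseteq> words n m"
      unfolding rack_cocycle.braided_factorial_asc_word[OF q keys]
      by (intro keys_sum_subset keys_braid_word[OF keys] asc_word(2)) simp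
    also have "\<dots> \<subseteq> lists (transpositions n)" by (auto simp: words_def)
    finally show ?thesis .
  qed
  ultimately show ?thesis using f by (simp add: nichols_ideal_def) blast
qed

lemma nichols_ideal_wordwise:
  assumes "rack_cocycle n q" "rack_cocycle n q'" "braid_compatible n q q' h" "f \<in> nichols_ideal n q"
  shows "wordwise h f \<in> nichols_ideal n q'"
proof -
  have f: "keys f \<subseteq> lists (transpositions n)" using assms(4) by (simp add: nichols_ideal_def)
  have add: "\<And>w. additive (h w)" using assms(3) by (simp add: braid_compatible_def)
  have "braided_factorial q' m (degree_part m (wordwise h f)) = 0" for m
    using wordwise_braided_factorial[OF assms(1-3) keys_degree_part[OF f], of m] assms(4)
    by (simp add: nichols_ideal_def degree_part_wordwise[OF add] additive.zero[OF additive_wordwise[OF add]])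
  then show ?thesis using subset_trans[OF keys_wordwise f] by (simp add: nichols_ideal_def)
qed

lemma wordwise_word_mult:
  assumes "\<And>w. additive (h w)" "\<And>w. additive (h' w)" "\<And>w. additive (k w)"
    and "\<And>u v a b. u \<in> lists S \<Longrightarrow> v \<in> lists S \<Longrightarrow> k (u @ v) (a * b) = h u a * h' v b"
    and "keys f \<subseteq> lists S" "keys g \<subseteq> lists S"
  shows "wordwise k (word_mult f g) = word_mult (wordwise h f) (wordwise h' g)"
proof (rule additive_eqI[OF _ _ assms(5)])
  fix u a assume u: "u \<in> lists S"
  show "wordwise k (word_mult (single u a) g) = word_mult (wordwise h (single u a)) (wordwise h' g)"
  proof (rule additive_eqI[OF _ _ assms(6)])
    fix v b assume "v \<in> lists S"
    then show "wordwise k (word_mult (single u a) (single v b)) =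
      word_mult (wordwise h (single u a)) (wordwise h' (single v b))"
      using assms(4)[OF u] by (simp add: wordwise_single[OF assms(1)] wordwise_single[OF assms(2)] wordwise_single[OF assms(3)])
  qed (rule additive_comp[OF additive_wordwise[OF assms(3)] additive_word_mult_right]
      additive_comp[OF additive_word_mult_right additive_wordwise[OF assms(2)]])+
qed (rule additive_comp[OF additive_wordwise[OF assms(3)] additive_word_mult_left]
    additive_comp[OF additive_word_mult_left additive_wordwise[OF assms(1)]])+

section \<open>Specialisation\<close>

lemma rack_cocycle_z: "rack_cocycle n (q_z n)"
  by (rule rack_cocycle_qfun[OF zR_square])

lemma rack_cocycle_sign: "c * c = 1 \<Longrightarrow> rack_cocycle n (qfun n (c :: complex))"
  by (rule rack_cocycle_qfun)

definition spec :: "complex \<Rightarrow> (perm list \<Rightarrow>\<^sub>0 CC2) \<Rightarrow> (perm list \<Rightarrow>\<^sub>0 complex)"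
  where "spec c = wordwise (\<lambda>w. subst_z c)"

abbreviation "TR n \<equiv> tensor_alg (transpositions n) :: (CC2, perm list \<Rightarrow>\<^sub>0 CC2) module"
abbreviation "TC n \<equiv> tensor_alg (transpositions n) :: (complex, perm list \<Rightarrow>\<^sub>0 complex) module"

lemma additive_subst_z: "additive (subst_z c)"
  by (simp add: additive_def subst_z_simps)

lemma additive_spec: "additive (spec c)"
  unfolding spec_def by (rule additive_wordwise[OF additive_subst_z])

lemma lookup_spec: "lookup (spec c f) w = subst_z c (lookup f w)"
  unfolding spec_def by (rule lookup_wordwise[OF additive_subst_z])

lemma spec_single: "spec c (single w r) = single w (subst_z c r)"
  unfolding spec_def by (rule wordwise_single[OF additive_subst_z])

lemma keys_spec: "keys f \<subseteq> A \<Longrightarrow> keys (spec c f) \<subseteq> A"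
  unfolding spec_def using keys_wordwise by blast

lemma spec_scale: "c * c = 1 \<Longrightarrow> spec c (scale r f) = scale (subst_z c r) (spec c f)"
  by (rule poly_mapping_eqI) (simp add: lookup_spec subst_z_mult)

lemma braid_compatible_spec:
  assumes c: "c * c = 1"
  shows "braid_compatible n (q_z n) (qfun n c) (\<lambda>w. subst_z c)"
  unfolding braid_compatible_def
proof (intro conjI allI ballI additive_subst_z)
  fix u v x y r assume x: "x \<in> transpositions n" and "y \<in> transpositions n"
  then obtain i j where y: "y = transpose i j" "1 \<le> i" "i < j" "j \<le> n" by (elim transpositionsE)
  have "subst_z c (q_z n (x, y)) = qfun n c (x, y)"
    using qfun_transpose[OF zR_square x y(2-4)] qfun_transpose[OF c x y(2-4)] y(1) by (simp add: subst_z_simps)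
  then show "subst_z c (r * q_z n (x, y)) = subst_z c r * qfun n c (x, y)"
    by (simp add: subst_z_mult[OF c])
qed

text \<open>The two specialisations identify \<open>R\<close> with \<open>\<complex> \<times> \<complex>\<close>.\<close>

lemma spec_nichols_ideal_iff:
  assumes c: "c = 1 \<or> c = - 1" and f: "keys f \<subseteq> lists (transpositions n)"
  shows "f \<in> nichols_ideal n (q_z n) \<longleftrightarrow>
    spec c f \<in> nichols_ideal n (qfun n c) \<and> spec (- c) f \<in> nichols_ideal n (qfun n (- c))"
proof -
  have sq: "d * d = 1" if "d \<in> {c, - c}" for d using c that by auto
  have "f \<in> nichols_ideal n (q_z n) \<longleftrightarrow> (\<forall>d\<in>{c, - c}. wordwise (\<lambda>w. subst_z d) f \<in> nichols_ideal n (qfun n d))"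
  proof (rule nichols_ideal_iff_wordwise[OF rack_cocycle_z rack_cocycle_sign[OF sq] braid_compatible_spec[OF sq] _ f])
    fix r assume "\<forall>d\<in>{c, - c}. subst_z d r = 0"
    then have "subst_z 1 r = 0" "subst_z (- 1) r = 0" using c by auto
    then show "r = 0" using subst_z_inject[of r 0] by (simp add: subst_z_simps)
  qed
  then show ?thesis by (simp add: spec_def)
qed

definition embed :: "(perm list \<Rightarrow>\<^sub>0 complex) \<Rightarrow> (perm list \<Rightarrow>\<^sub>0 CC2)"
  where "embed = wordwise (\<lambda>w. const)"

lemma additive_const: "additive const"
  by (simp add: additive_def const_simps)

lemma lookup_embed: "lookup (embed f) w = const (lookup f w)"
  unfolding embed_def by (rule lookup_wordwise[OF additive_const])

lemma keys_embed: "keys f \<subseteq> A \<Longrightarrow> keys (embed f) \<subseteq> A"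
  unfolding embed_def using keys_wordwise by blast

lemma spec_embed: "spec c (embed f) = f"
  by (rule poly_mapping_eqI) (simp add: lookup_spec lookup_embed subst_z_simps)

lemma nichols_alg_epi:
  "alg_epi (TR n) (B_z n) (nichols_proj n (q_z n))"
  "c * c = 1 \<Longrightarrow> alg_epi (TC n) (nichols_alg n (qfun n c)) (nichols_proj n (qfun n c))"
  using rack_cocycle.nichols_epi rack_cocycle_z rack_cocycle_sign by blast+

lemma assoc_algebra_nichols:
  "assoc_algebra (B_z n)" "c * c = 1 \<Longrightarrow> assoc_algebra (nichols_alg n (qfun n (c :: complex)))"
  using rack_cocycle.assoc_algebra_nichols_alg rack_cocycle_z rack_cocycle_sign by blast+

lemma spec_epi:
  assumes c: "c * c = 1"
  shows "alg_epi (restrict_scalars const (TR n)) (TC n) (spec c)"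
proof (rule alg_epiI)
  fix f assume f: "f \<in> carrier (restrict_scalars const (TR n))"
  then show "spec c f \<in> carrier (TC n)" by (simp add: keys_spec)
  show "spec c (k \<odot>\<^bsub>restrict_scalars const (TR n)\<^esub> f) = k \<odot>\<^bsub>TC n\<^esub> spec c f" for k
    by (simp add: spec_scale[OF c] subst_z_simps)
  fix g assume g: "g \<in> carrier (restrict_scalars const (TR n))"
  show "spec c (f \<otimes>\<^bsub>restrict_scalars const (TR n)\<^esub> g) = spec c f \<otimes>\<^bsub>TC n\<^esub> spec c g"
    using f g unfolding spec_def
    by (simp add: wordwise_word_mult[OF additive_subst_z additive_subst_z additive_subst_z subst_z_mult[OF c]])
next
  fix g assume "g \<in> carrier (TC n)"
  then show "\<exists>f\<in>carrier (restrict_scalars const (TR n)). spec c f = g"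
    by (intro bexI[of _ "embed g"]) (simp_all add: spec_embed keys_embed)
qed (simp_all add: additive.add[OF additive_spec] additive.zero[OF additive_spec] spec_single subst_z_simps)

lemma nichols_spec_epi:
  assumes c: "c * c = 1"
  shows "alg_epi (restrict_scalars const (TR n)) (nichols_alg n (qfun n c)) (\<lambda>f. nichols_proj n (qfun n c) (spec c f))"
  using alg_epi_comp[OF spec_epi[OF c] nichols_alg_epi(2)[OF c]] .

lemma nichols_proj_eq:
  assumes "rack_cocycle n q" "keys f \<subseteq> lists (transpositions n)" "keys g \<subseteq> lists (transpositions n)"
  shows "nichols_proj n q f = nichols_proj n q g \<longleftrightarrow> f - g \<in> nichols_ideal n q"
  using rack_cocycle.nichols_proj_eq_iff[OF assms(1)] assms(2,3) by simp

lemma specialise_epi: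
  "alg_epi (restrict_scalars const (TR n)) (specialise c (B_z n)) (\<lambda>f. specialise_proj c (B_z n) (nichols_proj n (q_z n) f))"
proof -
  interpret B: assoc_algebra "B_z n" by (rule assoc_algebra_nichols)
  have "alg_epi (B_z n) (quot_alg (B_z n) (scalar_ideal (zR - const c) (B_z n))) (specialise_proj c (B_z n))"
    using B.quot_alg_epi[OF B.scalar_ideal] by (simp add: specialise_proj_def[abs_def])
  from alg_epi_restrict_scalars[OF alg_epi_comp[OF nichols_alg_epi(1) this]]
  show ?thesis by (simp add: specialise_def)
qed

text \<open>In degree zero this says that the ideal generated by \<open>z - c\<close> is the kernel of the substitution of \<open>c\<close>;
  the inclusion that needs an argument uses that \<open>z\<close> acts by \<open>-c\<close> on a complement.\<close>

lemma specialise_kernel: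
  assumes c: "c = 1 \<or> c = - 1" and f: "f \<in> carrier (TR n)" and g: "g \<in> carrier (TR n)"
  shows "specialise_proj c (B_z n) (nichols_proj n (q_z n) f) = specialise_proj c (B_z n) (nichols_proj n (q_z n) g) \<longleftrightarrow>
    nichols_proj n (qfun n c) (spec c f) = nichols_proj n (qfun n c) (spec c g)"
    (is "?l \<longleftrightarrow> ?r")
proof -
  interpret B: assoc_algebra "B_z n" by (rule assoc_algebra_nichols)
  interpret T: ring "TR n" by (rule ring_tensor_alg)
  let ?p = "nichols_proj n (q_z n)" and ?J = "scalar_ideal (zR - const c) (B_z n)"
  note epi = alg_epiD[OF nichols_alg_epi(1)[of n]]
  have sq: "c * c = 1" "(- c) * (- c) = 1" using c by auto
  have fg: "f - g \<in> carrier (TR n)" using f g by (simp add: keys_diff_subset)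
  have "?p f = ?p (f - g) \<oplus>\<^bsub>B_z n\<^esub> ?p g" using epi(4)[OF fg g] by simp
  then have minus: "?p f \<ominus>\<^bsub>B_z n\<^esub> ?p g = ?p (f - g)"
    using epi(1)[OF f] epi(1)[OF g] epi(1)[OF fg]
    by (metis B.add.inv_solve_right' B.minus_eq)
  have "?l \<longleftrightarrow> ?p (f - g) \<in> ?J"
    unfolding specialise_proj_def
    using B.quotient_eq_iff_same_a_r_cos[OF B.scalar_ideal epi(1)[OF f] epi(1)[OF g]] minus by simp
  also have "\<dots> \<longleftrightarrow> (\<exists>h\<in>carrier (TR n). ?p (f - g) = ?p (scale (zR - const c) h))"
    unfolding scalar_ideal_def epi(2)[symmetric] image_image using epi(7) by (auto simp: image_iff)
  also have "\<dots> \<longleftrightarrow> (\<exists>h\<in>carrier (TR n). (f - g) - scale (zR - const c) h \<in> nichols_ideal n (q_z n))"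
    using fg by (intro bex_cong HOL.refl nichols_proj_eq[OF rack_cocycle_z]) (simp_all add: subset_trans[OF keys_scale])
  also have "\<dots> \<longleftrightarrow> spec c (f - g) \<in> nichols_ideal n (qfun n c)"
  proof
    assume "\<exists>h\<in>carrier (TR n). (f - g) - scale (zR - const c) h \<in> nichols_ideal n (q_z n)"
    then obtain h where h: "(f - g) - scale (zR - const c) h \<in> nichols_ideal n (q_z n)" by blast
    then have "keys ((f - g) - scale (zR - const c) h) \<subseteq> lists (transpositions n)"
      by (simp add: nichols_ideal_def)
    with h have "spec c ((f - g) - scale (zR - const c) h) \<in> nichols_ideal n (qfun n c)"
      using spec_nichols_ideal_iff[OF c] by blast
    then show "spec c (f - g) \<in> nichols_ideal n (qfun n c)"
      by (simp add: additive.diff[OF additive_spec] spec_scale[OF sq(1)] subst_z_simps scale_simps)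
  next
    assume *: "spec c (f - g) \<in> nichols_ideal n (qfun n c)"
    \<comment> \<open>the multiple of \<open>z - c\<close> is the part of \<open>f - g\<close> on which \<open>z\<close> acts by \<open>-c\<close>\<close>
    let ?h = "scale (const (- c / 2)) (f - g)"
    let ?d = "(f - g) - scale (zR - const c) ?h"
    have d: "keys ?d \<subseteq> lists (transpositions n)" and h: "?h \<in> carrier (TR n)"
      using fg by (simp_all add: keys_diff_subset subset_trans[OF keys_scale])
    have "spec c ?d = spec c (f - g)"
      by (simp add: additive.diff[OF additive_spec] spec_scale[OF sq(1)] subst_z_simps scale_simps)
    have "subst_z (- c) (zR - const c) * subst_z (- c) (const (- c / 2)) = 1"
      using c by (auto simp: subst_z_simps)
    then have "scale (subst_z (- c) (zR - const c)) (scale (subst_z (- c) (const (- c / 2))) t) = t"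
      for t :: "perm list \<Rightarrow>\<^sub>0 complex"
      by (simp only: scale_simps(4)[symmetric] scale_simps(5))
    then have "spec (- c) ?d = 0"
      by (simp only: additive.diff[OF additive_spec] spec_scale[OF sq(2)] diff_self)
    moreover have "0 \<in> nichols_ideal n (qfun n (- c))"
      by (rule rack_cocycle.nichols_ideal_zero[OF rack_cocycle_sign[OF sq(2)]])
    ultimately have "?d \<in> nichols_ideal n (q_z n)"
      using \<open>spec c ?d = spec c (f - g)\<close> * spec_nichols_ideal_iff[OF c d] by simp
    with h show "\<exists>h\<in>carrier (TR n). (f - g) - scale (zR - const c) h \<in> nichols_ideal n (q_z n)" by blast
  qed
  also have "\<dots> \<longleftrightarrow> ?r"
    using f g nichols_proj_eq[OF rack_cocycle_sign[OF sq(1)], of "spec c f" n "spec c g"]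
    by (simp add: keys_spec additive.diff[OF additive_spec])
  finally show ?thesis .
qed

lemma gen_iso_of_epis:
  assumes "assoc_algebra T" "alg_epi T A \<phi>" "alg_epi T B \<pi>"
    and "\<And>x y. x \<in> carrier T \<Longrightarrow> y \<in> carrier T \<Longrightarrow> \<phi> x = \<phi> y \<longleftrightarrow> \<pi> x = \<pi> y"
    and "\<And>s. s \<in> S \<Longrightarrow> t s \<in> carrier T \<and> \<phi> (t s) = a s \<and> \<pi> (t s) = b s"
  shows "gen_iso S A a B b"
proof -
  obtain \<psi> where "\<psi> \<in> alg_iso A B" "\<And>x. x \<in> carrier T \<Longrightarrow> \<psi> (\<phi> x) = \<pi> x"
    using alg_iso_of_epis[OF assms(1-4)] by blast
  then show ?thesis unfolding gen_iso_def using assms(5) by metis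
qed

lemma assoc_algebra_TR_const: "assoc_algebra (restrict_scalars const (TR n))"
  by (rule assoc_algebra_restrict_scalars[OF assoc_algebra_tensor_alg]) (simp_all add: const_simps)

theorem gen_iso_specialise:
  assumes c: "c = 1 \<or> c = - 1"
  shows "gen_iso (transpositions n)
    (specialise c (B_z n)) (\<lambda>\<tau>. specialise_proj c (B_z n) (nichols_gen n (q_z n) \<tau>))
    (nichols_alg n (qfun n c)) (nichols_gen n (qfun n c))"
proof (rule gen_iso_of_epis[OF assoc_algebra_TR_const specialise_epi nichols_spec_epi])
  show "c * c = 1" using c by auto
  show "specialise_proj c (B_z n) (nichols_proj n (q_z n) f) = specialise_proj c (B_z n) (nichols_proj n (q_z n) g) \<longleftrightarrow>
    nichols_proj n (qfun n c) (spec c f) = nichols_proj n (qfun n c) (spec c g)"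
    if "f \<in> carrier (restrict_scalars const (TR n))" "g \<in> carrier (restrict_scalars const (TR n))" for f g
    using specialise_kernel[OF c] that by simp
  show "single [\<tau>] 1 \<in> carrier (restrict_scalars const (TR n)) \<and>
    specialise_proj c (B_z n) (nichols_proj n (q_z n) (single [\<tau>] 1)) = specialise_proj c (B_z n) (nichols_gen n (q_z n) \<tau>) \<and>
    nichols_proj n (qfun n c) (spec c (single [\<tau>] 1)) = nichols_gen n (qfun n c) \<tau>"
    if "\<tau> \<in> transpositions n" for \<tau>
    using that by (simp add: nichols_gen_def spec_single subst_z_simps)
qed

lemma finsum_epi:
  assumes "ring A" "ring B" "alg_epi A B \<phi>" "\<And>x. x \<in> S \<Longrightarrow> f x \<in> carrier A"
  shows "\<phi> (finsum A f S) = finsum B (\<lambda>x. \<phi> (f x)) S"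
proof -
  interpret A: ring A by fact
  interpret B: ring B by fact
  show ?thesis using assms(4)
  proof (induction S rule: infinite_finite_induct)
    case (infinite S)
    then show ?case using alg_epiD(6)[OF assms(3)] by (simp add: A.finsum_infinite B.finsum_infinite)
  next
    case empty
    show ?case using alg_epiD(6)[OF assms(3)] by simp
  next
    case (insert x S)
    then have "f \<in> S \<rightarrow> carrier A" "(\<lambda>x. \<phi> (f x)) \<in> S \<rightarrow> carrier B"
      using alg_epiD(1)[OF assms(3)] by auto
    then show ?case
      using insert alg_epiD(1)[OF assms(3)] alg_epiD(4)[OF assms(3)] by (simp add: A.finsum_closed)
  qed
qed

lemma finsum_tensor_alg:
  fixes f :: "'s \<Rightarrow> 'x list \<Rightarrow>\<^sub>0 'k::comm_ring_1"
  assumes "\<And>x. x \<in> S \<Longrightarrow> keys (f x) \<subseteq> lists Y"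
  shows "finsum (tensor_alg Y :: ('k, 'x list \<Rightarrow>\<^sub>0 'k) module) f S = (\<Sum>x\<in>S. f x)"
proof -
  interpret T: ring "tensor_alg Y :: ('k, 'x list \<Rightarrow>\<^sub>0 'k) module" by (rule ring_tensor_alg)
  show ?thesis using assms
  proof (induction S rule: infinite_finite_induct)
    case (infinite S)
    then show ?case by (simp add: T.finsum_infinite)
  next
    case (insert x S)
    then have "f \<in> S \<rightarrow> carrier (tensor_alg Y)" by (simp add: Pi_def)
    then show ?case using insert by simp
  qed simp
qed

section \<open>Extension of scalars\<close>

locale complex_algebra = assoc_algebra A for A :: "(complex, 'a) module" (structure)
begin

abbreviation "BC \<equiv> base_change A"

lemma finsum_bit:
  assumes "\<And>d. f d \<in> carrier A"
  shows "(\<Oplus>d\<in>(UNIV :: bit set). f d) = f 0 \<oplus> f 1"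
  unfolding UNIV_bit using assms by (simp add: finsum_insert Pi_def)

lemma base_change_sel:
  "carrier BC = {f. \<forall>d. f d \<in> carrier A}"
  "\<one>\<^bsub>BC\<^esub> = pure A 1 \<one>"
  "\<zero>\<^bsub>BC\<^esub> = (\<lambda>c. \<zero>)"
  "f \<oplus>\<^bsub>BC\<^esub> g = (\<lambda>c. f c \<oplus> g c)"
  "f \<otimes>\<^bsub>BC\<^esub> g = (\<lambda>c. \<Oplus>d\<in>UNIV. f d \<otimes> g (c - d))"
  "r \<odot>\<^bsub>BC\<^esub> f = (\<lambda>c. \<Oplus>d\<in>UNIV. lookup r d \<odot> f (c - d))"
  by (simp_all add: base_change_def)

lemma abelian_group_base_change: "abelian_group BC"
proof (rule abelian_groupI, goal_cases)
  case (6 f)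
  then show ?case
    by (intro bexI[of _ "\<lambda>c. \<ominus> f c"]) (auto simp: base_change_sel l_neg)
qed (auto simp: base_change_sel a_ac)

lemma pure_closed [simp]: "a \<in> carrier A \<Longrightarrow> pure A r a \<in> carrier BC"
  by (simp add: pure_def base_change_sel)

lemma pure_add: "a \<in> carrier A \<Longrightarrow> b \<in> carrier A \<Longrightarrow> pure A r (a \<oplus> b) = pure A r a \<oplus>\<^bsub>BC\<^esub> pure A r b"
  by (simp add: pure_def base_change_sel smult_r_distr)

lemma pure_zero [simp]: "pure A r \<zero> = \<zero>\<^bsub>BC\<^esub>"
  by (simp add: pure_def base_change_sel)

lemma pure_smult: "a \<in> carrier A \<Longrightarrow> pure A r (c \<odot> a) = pure A (const c * r) a"
  by (rule ext) (simp add: pure_def lookup_mult_CC2 UNIV_bit lookup_const smult_smult[symmetric] mult.commute)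

lemma smult_pure:
  assumes "a \<in> carrier A"
  shows "r \<odot>\<^bsub>BC\<^esub> pure A s a = pure A (r * s) a"
proof
  fix c
  have "(r \<odot>\<^bsub>BC\<^esub> pure A s a) c =
    lookup r 0 \<odot> (lookup s c \<odot> a) \<oplus> lookup r 1 \<odot> (lookup s (c - 1) \<odot> a)"
    using assms by (simp add: base_change_sel pure_def finsum_bit)
  then show "(r \<odot>\<^bsub>BC\<^esub> pure A s a) c = pure A (r * s) a c"
    using assms by (simp add: pure_def lookup_mult_CC2 UNIV_bit smult_smult smult_l_distr)
qed

lemma pure_mult:
  assumes "a \<in> carrier A" "b \<in> carrier A"
  shows "pure A r a \<otimes>\<^bsub>BC\<^esub> pure A s b = pure A (r * s) (a \<otimes> b)"
proof
  fix c
  have "(pure A r a \<otimes>\<^bsub>BC\<^esub> pure A s b) c =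
    lookup r 0 \<odot> (lookup s c \<odot> (a \<otimes> b)) \<oplus> lookup r 1 \<odot> (lookup s (c - 1) \<odot> (a \<otimes> b))"
    using assms by (simp add: base_change_sel pure_def finsum_bit smult_mult_left smult_mult_right mult.commute
        flip: smult_smult)
  then show "(pure A r a \<otimes>\<^bsub>BC\<^esub> pure A s b) c = pure A (r * s) (a \<otimes> b) c"
    using assms by (simp add: pure_def lookup_mult_CC2 UNIV_bit smult_smult smult_l_distr)
qed

text \<open>If \<open>z\<close> acts on \<open>e\<close> by the scalar \<open>c\<close>, then every element of \<open>e(R \<otimes> A)\<close> is \<open>e \<otimes> a\<close> for some \<open>a\<close>.\<close>

lemma scalar_ideal_base_change:
  assumes "e * zR = const c * e"
  shows "scalar_ideal e BC = pure A e ` carrier A"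
proof
  show "pure A e ` carrier A \<subseteq> scalar_ideal e BC"
  proof
    fix F assume "F \<in> pure A e ` carrier A"
    then obtain a where a: "a \<in> carrier A" "F = pure A e a" by blast
    have "pure A e a = e \<odot>\<^bsub>BC\<^esub> pure A 1 a" using a(1) by (simp add: smult_pure)
    then show "F \<in> scalar_ideal e BC" using a by (auto simp: scalar_ideal_def)
  qed
  show "scalar_ideal e BC \<subseteq> pure A e ` carrier A"
  proof
    fix F assume "F \<in> scalar_ideal e BC"
    then obtain f where f: "f \<in> carrier BC" "F = e \<odot>\<^bsub>BC\<^esub> f" by (auto simp: scalar_ideal_def)
    have fd: "f 0 \<in> carrier A" "f 1 \<in> carrier A" using f(1) by (auto simp: base_change_sel)
    have "F = pure A e (f 0) \<oplus>\<^bsub>BC\<^esub> pure A (e * zR) (f 1)"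
    proof
      fix d show "F d = (pure A e (f 0) \<oplus>\<^bsub>BC\<^esub> pure A (e * zR) (f 1)) d"
        using bit_cases[of d] fd f(1) unfolding f(2)
        by (auto simp: base_change_sel finsum_bit pure_def lookup_mult_CC2 UNIV_bit lookup_zR a_comm)
    qed
    also have "\<dots> = pure A e (f 0 \<oplus> c \<odot> f 1)"
      using fd by (simp add: assms pure_add pure_smult)
    finally show "F \<in> pure A e ` carrier A" using fd by auto
  qed
qed

text \<open>For an idempotent \<open>e\<close> as above one has \<open>Re = \<complex>e\<close>, so \<open>e(R \<otimes> A)\<close> is a copy of \<open>A\<close> on which \<open>R\<close> acts through
  the substitution of \<open>c\<close> for \<open>z\<close>.\<close>

lemma pure_idem_epi:
  assumes e: "e * e = e" "e * zR = const c * e" and lookup: "lookup e 0 \<noteq> 0"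
    and T: "alg_epi (restrict_scalars const T) A \<phi>" "c * c = 1"
    and smult: "\<And>k x. x \<in> carrier T \<Longrightarrow> \<phi> (k \<odot>\<^bsub>T\<^esub> x) = subst_z c k \<odot> \<phi> x"
  shows "alg_epi T (idem_part e BC) (\<lambda>x. pure A e (\<phi> x))"
    and "a \<in> carrier A \<Longrightarrow> b \<in> carrier A \<Longrightarrow> pure A e a = pure A e b \<longleftrightarrow> a = b"
proof -
  have sel: "carrier (idem_part e BC) = pure A e ` carrier A" "monoid.mult (idem_part e BC) = monoid.mult BC"
    "add (idem_part e BC) = add BC" "\<zero>\<^bsub>idem_part e BC\<^esub> = \<zero>\<^bsub>BC\<^esub>" "\<one>\<^bsub>idem_part e BC\<^esub> = e \<odot>\<^bsub>BC\<^esub> pure A 1 \<one>"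
    "k \<odot>\<^bsub>idem_part e BC\<^esub> f = k \<odot>\<^bsub>BC\<^esub> f" for k f
    by (simp_all add: idem_part_def scalar_ideal_base_change[OF e(2)] base_change_sel(2))
  note \<phi> = alg_epiD[OF T(1), simplified]
  have ke: "k * e = const (subst_z c k) * e" for k
  proof -
    have "k * e = const (lookup k 0) * e + const (lookup k 1) * (e * zR)"
      by (subst CC2_expand[of k]) (simp add: algebra_simps)
    then have "k * e = const (lookup k 0) * e + const (lookup k 1) * (const c * e)"
      by (simp only: e(2))
    then show ?thesis by (simp add: subst_z_def const_simps algebra_simps)
  qed
  show "alg_epi T (idem_part e BC) (\<lambda>x. pure A e (\<phi> x))"
  proof (rule alg_epiI)
    fix F assume "F \<in> carrier (idem_part e BC)"
    then show "\<exists>x\<in>carrier T. pure A e (\<phi> x) = F" unfolding sel \<phi>(2)[symmetric] by auto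
  next
    fix k x assume x: "x \<in> carrier T"
    then show "pure A e (\<phi> (k \<odot>\<^bsub>T\<^esub> x)) = k \<odot>\<^bsub>idem_part e BC\<^esub> pure A e (\<phi> x)"
      using \<phi>(1)[OF x] unfolding sel by (simp add: smult pure_smult smult_pure ke[of k])
  next
    show "pure A e (\<phi> \<one>\<^bsub>T\<^esub>) = \<one>\<^bsub>idem_part e BC\<^esub>" unfolding sel using \<phi>(5) by (simp add: smult_pure)
  qed (simp_all add: sel \<phi> pure_mult pure_add e(1))
  assume ab: "a \<in> carrier A" "b \<in> carrier A"
  show "pure A e a = pure A e b \<longleftrightarrow> a = b"
  proof
    assume "pure A e a = pure A e b"
    then have "lookup e 0 \<odot> a = lookup e 0 \<odot> b"
      unfolding pure_def by (rule fun_cong)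
    then have "(1 / lookup e 0) \<odot> (lookup e 0 \<odot> a) = (1 / lookup e 0) \<odot> (lookup e 0 \<odot> b)"
      by simp
    then show "a = b" using ab lookup by (simp add: smult_one flip: smult_smult)
  qed simp
qed

end

lemma idem_simps:
  "idem_plus * idem_plus = idem_plus" "idem_minus * idem_minus = idem_minus"
  "idem_plus * idem_minus = 0" "idem_plus + idem_minus = 1"
  "idem_plus * zR = const 1 * idem_plus" "idem_minus * zR = const (- 1) * idem_minus"
  by (rule subst_z_inject; simp add: subst_z_simps subst_z_mult subst_z_idem)+

lemma lookup_idem: "lookup idem_plus 0 \<noteq> 0" "lookup idem_minus 0 \<noteq> 0"
  by (simp_all add: idem_plus_def idem_minus_def lookup_mult_CC2 UNIV_bit lookup_const lookup_add lookup_minus lookup_one lookup_zR)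

lemma ideal_direct_sum_idem:
  fixes B :: "(CC2, 'b) module"
  assumes "assoc_algebra B"
  shows "ideal_direct_sum B (scalar_ideal idem_plus B) (scalar_ideal idem_minus B)"
proof -
  interpret B: assoc_algebra B by fact
  have zero: "\<zero>\<^bsub>B\<^esub> \<in> scalar_ideal r B" for r
    unfolding scalar_ideal_def by (intro image_eqI[of _ _ "\<zero>\<^bsub>B\<^esub>"]) auto
  have "x = \<zero>\<^bsub>B\<^esub>" if "x \<in> scalar_ideal idem_plus B" "x \<in> scalar_ideal idem_minus B" for x
  proof -
    from that obtain a b where ab: "a \<in> carrier B" "x = idem_plus \<odot>\<^bsub>B\<^esub> a" "b \<in> carrier B" "x = idem_minus \<odot>\<^bsub>B\<^esub> b"
      by (auto simp: scalar_ideal_def)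
    have "x = idem_plus \<odot>\<^bsub>B\<^esub> x"
      using ab(1,2) by (simp add: idem_simps flip: B.smult_smult)
    also have "\<dots> = \<zero>\<^bsub>B\<^esub>"
      using ab(3,4) by (simp add: idem_simps flip: B.smult_smult)
    finally show ?thesis .
  qed
  then have inter: "scalar_ideal idem_plus B \<inter> scalar_ideal idem_minus B = {\<zero>\<^bsub>B\<^esub>}"
    using zero by blast
  have "x \<in> scalar_ideal idem_plus B <+>\<^bsub>B\<^esub> scalar_ideal idem_minus B" if x: "x \<in> carrier B" for x
  proof -
    have "x = idem_plus \<odot>\<^bsub>B\<^esub> x \<oplus>\<^bsub>B\<^esub> idem_minus \<odot>\<^bsub>B\<^esub> x"
      using x by (simp add: idem_simps B.smult_one flip: B.smult_l_distr)
    then show ?thesis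
      unfolding set_add_def set_mult_def scalar_ideal_def using x by fastforce
  qed
  moreover have "scalar_ideal idem_plus B <+>\<^bsub>B\<^esub> scalar_ideal idem_minus B \<subseteq> carrier B"
    unfolding set_add_def set_mult_def scalar_ideal_def by auto
  ultimately have "scalar_ideal idem_plus B <+>\<^bsub>B\<^esub> scalar_ideal idem_minus B = carrier B" by blast
  with inter show ?thesis by (simp add: ideal_direct_sum_def B.scalar_ideal)
qed

lemma dsum_alg_sel:
  "carrier (dsum_alg A B) = carrier A \<times> carrier B"
  "(x, y) \<otimes>\<^bsub>dsum_alg A B\<^esub> (x', y') = (x \<otimes>\<^bsub>A\<^esub> x', y \<otimes>\<^bsub>B\<^esub> y')"
  "(x, y) \<oplus>\<^bsub>dsum_alg A B\<^esub> (x', y') = (x \<oplus>\<^bsub>A\<^esub> x', y \<oplus>\<^bsub>B\<^esub> y')"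
  "\<one>\<^bsub>dsum_alg A B\<^esub> = (\<one>\<^bsub>A\<^esub>, \<one>\<^bsub>B\<^esub>)" "\<zero>\<^bsub>dsum_alg A B\<^esub> = (\<zero>\<^bsub>A\<^esub>, \<zero>\<^bsub>B\<^esub>)"
  "k \<odot>\<^bsub>dsum_alg A B\<^esub> (x, y) = (k \<odot>\<^bsub>A\<^esub> x, k \<odot>\<^bsub>B\<^esub> y)"
  by (simp_all add: dsum_alg_def RDirProd_def DirProd_def ring.defs monoid.defs module.defs)

text \<open>The isomorphism is induced by the two specialisations; each summand detects one of the two conditions
  in \<open>spec_nichols_ideal_iff\<close>.\<close>

theorem nichols_direct_sum:
  defines "P \<equiv> \<lambda>n. idem_part idem_plus (base_change (B_plus n))"
    and "M \<equiv> \<lambda>n. idem_part idem_minus (base_change (B_minus n))"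
  shows "\<exists>\<psi> \<in> alg_iso (B_z n) (dsum_alg (P n) (M n)).
     (\<forall>\<tau> \<in> transpositions n. \<psi> (nichols_gen n (q_z n) \<tau>) =
        (pure (B_plus n) idem_plus (nichols_gen n (q_plus n) \<tau>),
         pure (B_minus n) idem_minus (nichols_gen n (q_minus n) \<tau>)))
     \<and> \<psi> ` scalar_ideal idem_plus (B_z n) = carrier (P n) \<times> {\<zero>\<^bsub>M n\<^esub>}
     \<and> \<psi> ` scalar_ideal idem_minus (B_z n) = {\<zero>\<^bsub>P n\<^esub>} \<times> carrier (M n)"
proof -
  interpret Bp: complex_algebra "B_plus n"
    unfolding complex_algebra_def by (rule assoc_algebra_nichols) simp
  interpret Bm: complex_algebra "B_minus n"
    unfolding complex_algebra_def by (rule assoc_algebra_nichols) simp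
  interpret Tz: assoc_algebra "TR n" by (rule assoc_algebra_tensor_alg)
  let ?p = "\<lambda>f. nichols_proj n (q_plus n) (spec 1 f)" and ?m = "\<lambda>f. nichols_proj n (q_minus n) (spec (- 1) f)"
  have epi: "alg_epi (restrict_scalars const (TR n)) (B_plus n) ?p" "alg_epi (restrict_scalars const (TR n)) (B_minus n) ?m"
    by (rule nichols_spec_epi; simp)+
  have smult: "?p (k \<odot>\<^bsub>TR n\<^esub> f) = subst_z 1 k \<odot>\<^bsub>B_plus n\<^esub> ?p f" "?m (k \<odot>\<^bsub>TR n\<^esub> f) = subst_z (- 1) k \<odot>\<^bsub>B_minus n\<^esub> ?m f"
    if "f \<in> carrier (TR n)" for f k
    using that alg_epiD(7)[OF nichols_alg_epi(2), of 1 "spec 1 f" n] alg_epiD(7)[OF nichols_alg_epi(2), of "- 1" "spec (- 1) f" n]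
    by (simp_all add: spec_scale keys_spec)
  let ?P = "\<lambda>f. pure (B_plus n) idem_plus (?p f)" and ?M = "\<lambda>f. pure (B_minus n) idem_minus (?m f)"
  have P: "alg_epi (TR n) (P n) ?P" and M: "alg_epi (TR n) (M n) ?M"
    unfolding P_def M_def
    by (rule Bp.pure_idem_epi[OF idem_simps(1,5) lookup_idem(1) epi(1)] Bm.pure_idem_epi[OF idem_simps(2,6) lookup_idem(2) epi(2)];
        simp add: smult[simplified])+
  have inj: "?P f = ?P g \<longleftrightarrow> ?p f = ?p g" "?M f = ?M g \<longleftrightarrow> ?m f = ?m g"
    if "f \<in> carrier (TR n)" "g \<in> carrier (TR n)" for f g
  proof -
    show "?P f = ?P g \<longleftrightarrow> ?p f = ?p g"
      by (rule Bp.pure_idem_epi(2)[OF idem_simps(1,5) lookup_idem(1) epi(1)])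
        (use that alg_epiD(1)[OF epi(1)] smult in simp_all)
    show "?M f = ?M g \<longleftrightarrow> ?m f = ?m g"
      by (rule Bm.pure_idem_epi(2)[OF idem_simps(2,6) lookup_idem(2) epi(2)])
        (use that alg_epiD(1)[OF epi(2)] smult in simp_all)
  qed
  have spec_idem: "spec 1 (scale idem_plus f) = spec 1 f" "spec (- 1) (scale idem_plus f) = 0"
    "spec 1 (scale idem_minus f) = 0" "spec (- 1) (scale idem_minus f) = spec (- 1) f" for f
    by (simp_all add: spec_scale subst_z_idem scale_simps)
  have zero: "?P 0 = \<zero>\<^bsub>P n\<^esub>" "?M 0 = \<zero>\<^bsub>M n\<^esub>"
    using alg_epiD(6)[OF P] alg_epiD(6)[OF M] by simp_all
  have PM_idem: "?P (scale idem_plus f) = ?P f" "?M (scale idem_plus f) = \<zero>\<^bsub>M n\<^esub>"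
    "?P (scale idem_minus f) = \<zero>\<^bsub>P n\<^esub>" "?M (scale idem_minus f) = ?M f" for f
    using zero by (simp_all add: spec_idem additive.zero[OF additive_spec])
  have sum_idem: "?P (scale idem_plus f + scale idem_minus g) = ?P f" "?M (scale idem_plus f + scale idem_minus g) = ?M g" for f g
    by (simp_all add: additive.add[OF additive_spec] spec_idem)
  have dsum: "alg_epi (TR n) (dsum_alg (P n) (M n)) (\<lambda>f. (?P f, ?M f))"
  proof (rule alg_epiI)
    fix y assume "y \<in> carrier (dsum_alg (P n) (M n))"
    then obtain f g where fg: "f \<in> carrier (TR n)" "g \<in> carrier (TR n)" "y = (?P f, ?M g)"
      unfolding dsum_alg_sel alg_epiD(2)[OF P, symmetric] alg_epiD(2)[OF M, symmetric] by blast
    then show "\<exists>f\<in>carrier (TR n). (?P f, ?M f) = y"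
      by (intro bexI[of _ "scale idem_plus f + scale idem_minus g"])
        (simp_all add: sum_idem keys_add_subset subset_trans[OF keys_scale])
  next
    fix f assume f: "f \<in> carrier (TR n)"
    show "(?P f, ?M f) \<in> carrier (dsum_alg (P n) (M n))"
      using alg_epiD(1)[OF P f] alg_epiD(1)[OF M f] by (simp add: dsum_alg_sel)
    show "(?P (k \<odot>\<^bsub>TR n\<^esub> f), ?M (k \<odot>\<^bsub>TR n\<^esub> f)) = k \<odot>\<^bsub>dsum_alg (P n) (M n)\<^esub> (?P f, ?M f)" for k
      by (simp only: dsum_alg_sel alg_epiD(7)[OF P f] alg_epiD(7)[OF M f])
    fix g assume g: "g \<in> carrier (TR n)"
    show "(?P (f \<otimes>\<^bsub>TR n\<^esub> g), ?M (f \<otimes>\<^bsub>TR n\<^esub> g)) = (?P f, ?M f) \<otimes>\<^bsub>dsum_alg (P n) (M n)\<^esub> (?P g, ?M g)"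
      by (simp only: dsum_alg_sel alg_epiD(3)[OF P f g] alg_epiD(3)[OF M f g])
    show "(?P (f \<oplus>\<^bsub>TR n\<^esub> g), ?M (f \<oplus>\<^bsub>TR n\<^esub> g)) = (?P f, ?M f) \<oplus>\<^bsub>dsum_alg (P n) (M n)\<^esub> (?P g, ?M g)"
      by (simp only: dsum_alg_sel alg_epiD(4)[OF P f g] alg_epiD(4)[OF M f g])
  next
    show "(?P \<one>\<^bsub>TR n\<^esub>, ?M \<one>\<^bsub>TR n\<^esub>) = \<one>\<^bsub>dsum_alg (P n) (M n)\<^esub>" "(?P \<zero>\<^bsub>TR n\<^esub>, ?M \<zero>\<^bsub>TR n\<^esub>) = \<zero>\<^bsub>dsum_alg (P n) (M n)\<^esub>"
      by (simp_all only: dsum_alg_sel alg_epiD(5)[OF P] alg_epiD(5)[OF M] alg_epiD(6)[OF P] alg_epiD(6)[OF M])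
  qed
  have kernel: "nichols_proj n (q_z n) f = nichols_proj n (q_z n) g \<longleftrightarrow> (?P f, ?M f) = (?P g, ?M g)"
    if f: "f \<in> carrier (TR n)" and g: "g \<in> carrier (TR n)" for f g
  proof -
    have fg: "keys (f - g) \<subseteq> lists (transpositions n)" using f g by (simp add: keys_diff_subset)
    have "nichols_proj n (q_z n) f = nichols_proj n (q_z n) g \<longleftrightarrow> f - g \<in> nichols_ideal n (q_z n)"
      using f g by (intro nichols_proj_eq[OF rack_cocycle_z]) simp_all
    also have "\<dots> \<longleftrightarrow> ?p f = ?p g \<and> ?m f = ?m g"
      using spec_nichols_ideal_iff[OF _ fg, of 1] f g
        nichols_proj_eq[OF rack_cocycle_sign, of 1 "spec 1 f" n "spec 1 g"]
        nichols_proj_eq[OF rack_cocycle_sign, of "- 1" "spec (- 1) f" n "spec (- 1) g"]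
      by (simp add: keys_spec additive.diff[OF additive_spec])
    finally show ?thesis using inj[OF f g] by simp
  qed
  obtain \<psi> where \<psi>: "\<psi> \<in> alg_iso (B_z n) (dsum_alg (P n) (M n))"
    and \<psi>_proj: "\<And>f. f \<in> carrier (TR n) \<Longrightarrow> \<psi> (nichols_proj n (q_z n) f) = (?P f, ?M f)"
    using alg_iso_of_epis[OF assoc_algebra_tensor_alg nichols_alg_epi(1) dsum kernel] by blast
  have ideal: "\<psi> ` scalar_ideal r (B_z n) = (\<lambda>f. (?P (scale r f), ?M (scale r f))) ` carrier (TR n)" for r
  proof -
    have "scalar_ideal r (B_z n) = (\<lambda>f. nichols_proj n (q_z n) (r \<odot>\<^bsub>TR n\<^esub> f)) ` carrier (TR n)"
      unfolding scalar_ideal_def alg_epiD(2)[OF nichols_alg_epi(1), symmetric] image_image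
      by (intro image_cong HOL.refl alg_epiD(7)[OF nichols_alg_epi(1), symmetric])
    then show ?thesis unfolding image_image
      by (auto simp: image_image intro!: image_cong \<psi>_proj subset_trans[OF keys_scale])
  qed
  have "\<psi> ` scalar_ideal idem_plus (B_z n) = carrier (P n) \<times> {\<zero>\<^bsub>M n\<^esub>}"
    unfolding ideal PM_idem alg_epiD(2)[OF P, symmetric] by auto
  moreover have "\<psi> ` scalar_ideal idem_minus (B_z n) = {\<zero>\<^bsub>P n\<^esub>} \<times> carrier (M n)"
    unfolding ideal PM_idem alg_epiD(2)[OF M, symmetric] by auto
  moreover have "\<psi> (nichols_gen n (q_z n) \<tau>) = (pure (B_plus n) idem_plus (nichols_gen n (q_plus n) \<tau>),
         pure (B_minus n) idem_minus (nichols_gen n (q_minus n) \<tau>))" if "\<tau> \<in> transpositions n" for \<tau>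
    using \<psi>_proj[of "single [\<tau>] 1"] that by (simp add: nichols_gen_def spec_single subst_z_simps)
  ultimately show ?thesis using \<psi> by blast
qed

section \<open>The grading by the symmetric group\<close>

definition word_degree :: "perm list \<Rightarrow> perm"
  where "word_degree w = foldr (\<circ>) w id"

lemma word_degree_simps [simp]:
  "word_degree [] = id" "word_degree (x # w) = x \<circ> word_degree w"
  "word_degree (u @ v) = word_degree u \<circ> word_degree v"
proof -
  show "word_degree (u @ v) = word_degree u \<circ> word_degree v"
    by (induction u) (simp_all add: word_degree_def comp_assoc)
qed (simp_all add: word_degree_def)

lemma word_degree_permutes: "w \<in> lists (transpositions n) \<Longrightarrow> word_degree w permutes {1..n}"
proof (induction w rule: list.induct)
  case (Cons x w)
  then have "word_degree w permutes {1..n}" "x permutes {1..n}" using transposition_permutes by auto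
  then show ?case unfolding word_degree_simps by (rule permutes_compose)
qed (simp add: permutes_id)

definition graded_part :: "perm \<Rightarrow> (perm list \<Rightarrow>\<^sub>0 'k::comm_ring_1) \<Rightarrow> (perm list \<Rightarrow>\<^sub>0 'k)"
  where "graded_part g = wordwise (\<lambda>w c. if word_degree w = g then c else 0)"

lemma additive_graded: "additive (\<lambda>c :: 'k::comm_ring_1. if P then c else 0)"
  by (simp add: additive_def)

lemma additive_graded_part: "additive (graded_part g)"
  unfolding graded_part_def by (rule additive_wordwise[OF additive_graded])

lemma lookup_graded_part:
  "lookup (graded_part g f) w = (if word_degree w = g then lookup f w else 0)"
  unfolding graded_part_def by (rule lookup_wordwise[OF additive_graded])

lemma keys_graded_part: "keys f \<subseteq> A \<Longrightarrow> keys (graded_part g f) \<subseteq> A"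
  unfolding graded_part_def using keys_wordwise by blast

lemma graded_part_homogeneous:
  assumes "\<And>w. w \<in> keys f \<Longrightarrow> word_degree w = h"
  shows "graded_part g f = (if g = h then f else 0)"
  using assms by (intro poly_mapping_eqI) (auto simp: lookup_graded_part in_keys_iff)

lemma finite_sym: "finite {g. g permutes {1..n :: nat}}" "finite {g. g permutes {Suc 0..n}}"
  by (rule finite_permutations; simp)+

lemma sum_graded_part:
  assumes "keys f \<subseteq> lists (transpositions n)"
  shows "(\<Sum>g | g permutes {1..n}. graded_part g f) = f"
proof (rule poly_mapping_eqI)
  fix w
  show "lookup (\<Sum>g | g permutes {1..n}. graded_part g f) w = lookup f w"
  proof (cases "w \<in> keys f")
    case True
    then have "word_degree w permutes {1..n}" using assms word_degree_permutes by blast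
    then show ?thesis by (simp add: lookup_sum lookup_graded_part sum.delta finite_sym)
  next
    case False
    then have "lookup f w = 0" by (simp add: in_keys_iff)
    then show ?thesis by (simp add: lookup_sum lookup_graded_part sum.neutral)
  qed
qed

text \<open>The braiding preserves the product of the letters of a word, so the Nichols ideal is homogeneous.\<close>

lemma braid_compatible_graded: "braid_compatible n q q (\<lambda>w c. if word_degree w = g then c else 0)"
proof -
  have "word_degree (u @ conj_perm x y # x # v) = word_degree (u @ x # y # v)" if "x \<in> transpositions n" for u v x y
    using conj_perm_comp[OF transposition_bij[OF that], of y] by (simp add: o_assoc)
  then show ?thesis by (auto simp: braid_compatible_def additive_graded)
qed

context rack_cocycle
begin

lemma graded_part_nichols_ideal: "f \<in> nichols_ideal n q \<Longrightarrow> graded_part g f \<in> nichols_ideal n q"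
  unfolding graded_part_def
  by (rule nichols_ideal_wordwise[OF rack_cocycle_axioms rack_cocycle_axioms braid_compatible_graded])

lemma nichols_grading_eq:
  "nichols_grading n q g = nichols_proj n q ` {f \<in> carrier T. \<forall>w\<in>keys f. word_degree w = g}"
  by (simp add: nichols_grading_def word_degree_def)

text \<open>The components are unique because the ideal contains the homogeneous parts of its elements.\<close>

lemma comp_family_nichols:
  assumes f: "keys f \<subseteq> lists (transpositions n)" and g: "g permutes {1..n}"
  shows "comp_family (sym_group n) (nichols_grading n q) (nichols_alg n q) (nichols_proj n q f) g =
    nichols_proj n q (graded_part g f)"
proof -
  interpret N: assoc_algebra "nichols_alg n q" by (rule assoc_algebra_nichols_alg)
  let ?S = "{g. g permutes {1..n}}" and ?p = "nichols_proj n q"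
  have ring_T: "ring T" by (rule ring_tensor_alg)
  have S: "carrier (sym_group n) = ?S" by (simp add: sym_group_def)
  have sum: "(\<Oplus>\<^bsub>nichols_alg n q\<^esub>g\<in>?S. ?p (F g)) = ?p (\<Sum>g\<in>?S. F g)"
    if "\<And>g. g \<in> ?S \<Longrightarrow> keys (F g) \<subseteq> lists (transpositions n)" for F
    using finsum_epi[OF ring_T N.ring_axioms nichols_epi, of ?S F] finsum_tensor_alg[of ?S F] that by simp
  define d where "d = (\<lambda>g\<in>?S. ?p (graded_part g f))"
  have "comp_family (sym_group n) (nichols_grading n q) (nichols_alg n q) (?p f) = d"
    unfolding comp_family_def S
  proof (rule the_equality, intro conjI)
    show "d \<in> (\<Pi>\<^sub>E g\<in>?S. nichols_grading n q g)"
      unfolding d_def nichols_grading_eq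
      using keys_graded_part[OF f] by (auto intro!: imageI simp: in_keys_iff lookup_graded_part split: if_splits)
    have "(\<Oplus>\<^bsub>nichols_alg n q\<^esub>g\<in>?S. d g) = (\<Oplus>\<^bsub>nichols_alg n q\<^esub>g\<in>?S. ?p (graded_part g f))"
      using alg_epiD(1)[OF nichols_epi] keys_graded_part[OF f] by (intro N.finsum_cong') (auto simp: d_def)
    then show "?p f = (\<Oplus>\<^bsub>nichols_alg n q\<^esub>g\<in>?S. d g)"
      using sum[of "\<lambda>g. graded_part g f"] keys_graded_part[OF f] sum_graded_part[OF f] by simp
  next
    fix d' assume d': "d' \<in> (\<Pi>\<^sub>E g\<in>?S. nichols_grading n q g) \<and> ?p f = (\<Oplus>\<^bsub>nichols_alg n q\<^esub>g\<in>?S. d' g)"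
    have "\<exists>F. \<forall>g\<in>?S. F g \<in> carrier T \<and> (\<forall>w\<in>keys (F g). word_degree w = g) \<and> d' g = ?p (F g)"
    proof (intro bchoice ballI)
      fix g assume "g \<in> ?S"
      then have "d' g \<in> ?p ` {f \<in> carrier T. \<forall>w\<in>keys f. word_degree w = g}"
        using d' unfolding nichols_grading_eq by blast
      then show "\<exists>y. y \<in> carrier T \<and> (\<forall>w\<in>keys y. word_degree w = g) \<and> d' g = ?p y"
        by blast
    qed
    then obtain F where F0: "\<forall>g\<in>?S. F g \<in> carrier T \<and> (\<forall>w\<in>keys (F g). word_degree w = g) \<and> d' g = ?p (F g)"
      by blast
    have F: "\<And>g. g permutes {1..n} \<Longrightarrow> keys (F g) \<subseteq> lists (transpositions n)"
      "\<And>g w. g permutes {1..n} \<Longrightarrow> w \<in> keys (F g) \<Longrightarrow> word_degree w = g"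
      "\<And>g. g permutes {1..n} \<Longrightarrow> d' g = ?p (F g)"
      using F0 by simp_all
    have sF: "keys (\<Sum>g\<in>?S. F g) \<subseteq> lists (transpositions n)" using F(1) by (intro keys_sum_subset) simp
    have "(\<Oplus>\<^bsub>nichols_alg n q\<^esub>g\<in>?S. d' g) = (\<Oplus>\<^bsub>nichols_alg n q\<^esub>g\<in>?S. ?p (F g))"
      using alg_epiD(1)[OF nichols_epi] F by (intro N.finsum_cong') auto
    then have "?p f = ?p (\<Sum>g\<in>?S. F g)" using d' sum[of F] F(1) by simp
    then have I: "f - (\<Sum>g\<in>?S. F g) \<in> nichols_ideal n q"
      using nichols_proj_eq_iff[of f "\<Sum>g\<in>?S. F g"] f sF by simp
    have "d' g = d g" if g: "g permutes {1..n}" for g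
    proof -
      have "graded_part g (\<Sum>h\<in>?S. F h) = (\<Sum>h\<in>?S. if g = h then F h else 0)"
        unfolding additive.sum[OF additive_graded_part]
        by (intro sum.cong HOL.refl graded_part_homogeneous) (simp add: F(2))
      also have "\<dots> = F g" using g by (simp add: sum.delta' finite_sym)
      finally have "graded_part g f - F g \<in> nichols_ideal n q"
        using graded_part_nichols_ideal[OF I, of g] by (simp add: additive.diff[OF additive_graded_part])
      then have "?p (graded_part g f) = ?p (F g)"
        using nichols_proj_eq_iff[of "graded_part g f" "F g"] keys_graded_part[OF f] F(1)[OF g] by simp
      then show ?thesis using F(3)[OF g] g by (simp add: d_def)
    qed
    moreover have "d' g = d g" if "\<not> g permutes {1..n}" for g
      using d' that by (auto simp: d_def PiE_iff extensional_def)
    ultimately show "d' = d" by blast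
  qed
  then show ?thesis using g by (simp add: d_def)
qed

end

section \<open>Twisting by a cocycle\<close>

text \<open>The scalar by which the product of the letters in the cocycle extension differs from their product
  in the original algebra.\<close>

fun iterate_cocycle :: "(perm \<Rightarrow> perm \<Rightarrow> 'k::comm_ring_1) \<Rightarrow> perm list \<Rightarrow> 'k"
  where "iterate_cocycle \<nu> [] = 1"
      | "iterate_cocycle \<nu> (x # w) = iterate_cocycle \<nu> w * \<nu> x (word_degree w)"

text \<open>The hypothesis \<open>swap\<close> says that moving a letter past another costs the same factor on both sides: \<open>q\<close> and the
  change of \<open>\<nu>\<close> in the twisted algebra, \<open>q\<^sub>z\<close> in the other one. The cocycles of interest have values in
  \<open>{1, -1, z, -z}\<close>, where every element is its own inverse.\<close>

locale twisting = rack_cocycle n q for n :: nat and q :: "perm \<times> perm \<Rightarrow> complex" +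
  fixes \<nu> :: "perm \<Rightarrow> perm \<Rightarrow> CC2"
  assumes cocycle: "g permutes {1..n} \<Longrightarrow> h permutes {1..n} \<Longrightarrow> k permutes {1..n} \<Longrightarrow>
      \<nu> g h * \<nu> (g \<circ> h) k = \<nu> g (h \<circ> k) * \<nu> h k"
    and normalised: "g permutes {1..n} \<Longrightarrow> \<nu> id g = 1" "g permutes {1..n} \<Longrightarrow> \<nu> g id = 1"
    and involutive: "g permutes {1..n} \<Longrightarrow> h permutes {1..n} \<Longrightarrow> \<nu> g h * \<nu> g h = 1"
    and swap: "x \<in> transpositions n \<Longrightarrow> y \<in> transpositions n \<Longrightarrow>
      const (q (x, y)) * \<nu> x y = q_z n (x, y) * \<nu> (conj_perm x y) x"
begin

abbreviation "m \<equiv> iterate_cocycle \<nu>"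
abbreviation "A \<equiv> nichols_alg n q"

sublocale A: complex_algebra A
  unfolding complex_algebra_def by (rule assoc_algebra_nichols_alg)

lemma m_append:
  assumes "u \<in> lists (transpositions n)" "v \<in> lists (transpositions n)"
  shows "m (u @ v) = m u * m v * \<nu> (word_degree u) (word_degree v)"
  using assms(1)
proof (induction u rule: list.induct)
  case Nil
  show ?case
    by (simp only: append.simps word_degree_simps iterate_cocycle.simps mult_1_left mult_1_right
        normalised(1)[OF word_degree_permutes[OF assms(2)]])
next
  case (Cons x u)
  then have x: "x \<in> transpositions n" "u \<in> lists (transpositions n)" by auto
  have "m (x # u @ v) = m u * m v * (\<nu> x (word_degree u \<circ> word_degree v) * \<nu> (word_degree u) (word_degree v))"
    using Cons.IH[OF x(2)] by (simp add: mult_ac)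
  also have "\<dots> = m u * m v * (\<nu> x (word_degree u) * \<nu> (x \<circ> word_degree u) (word_degree v))"
    using cocycle[OF transposition_permutes[OF x(1)] word_degree_permutes[OF x(2)] word_degree_permutes[OF assms(2)]] by simp
  finally show ?case
    by (simp only: append.simps word_degree_simps iterate_cocycle.simps mult_ac)
qed

lemma m_involutive: "w \<in> lists (transpositions n) \<Longrightarrow> m w * m w = 1"
proof (induction w rule: list.induct)
  case (Cons x w)
  then have x: "x \<in> transpositions n" "w \<in> lists (transpositions n)" by auto
  have "m (x # w) * m (x # w) = (m w * m w) * (\<nu> x (word_degree w) * \<nu> x (word_degree w))" by (simp add: mult_ac)
  then show ?case using Cons.IH[OF x(2)] involutive[OF transposition_permutes[OF x(1)] word_degree_permutes[OF x(2)]] by simp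
qed simp

lemma m_letter: "x \<in> transpositions n \<Longrightarrow> m [x] = 1"
  using normalised(2)[OF transposition_permutes] by simp

text \<open>Only the factor \<open>\<nu>(x, y)\<close> of the iterated cocycle changes when the two letters are exchanged, since the
  product of all letters does not.\<close>

lemma m_swap:
  assumes u: "u \<in> lists (transpositions n)" and v: "v \<in> lists (transpositions n)"
    and x: "x \<in> transpositions n" and y: "y \<in> transpositions n"
  shows "m (u @ conj_perm x y # x # v) * q_z n (x, y) = m (u @ x # y # v) * const (q (x, y))"
proof -
  have expand: "m (u @ a # b # v) =
    m u * m v * \<nu> a b * \<nu> (a \<circ> b) (word_degree v) * \<nu> (word_degree u) (a \<circ> b \<circ> word_degree v)"
    if "a \<in> transpositions n" "b \<in> transpositions n" for a b
  proof -
    have "m ([a, b] @ v) = m [a, b] * m v * \<nu> (a \<circ> b) (word_degree v)"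
      using m_append[of "[a, b]" v] that v by (simp del: iterate_cocycle.simps)
    moreover have "m [a, b] = \<nu> a b" using m_letter[OF that(2)] by simp
    ultimately show ?thesis
      using m_append[OF u, of "[a, b] @ v"] that v
      by (simp add: mult_ac comp_assoc del: iterate_cocycle.simps)
  qed
  have c: "conj_perm x y \<in> transpositions n" "conj_perm x y \<circ> x = x \<circ> y"
    using conj_perm_transposition_closed[OF x y] conj_perm_comp[OF transposition_bij[OF x]] by auto
  have "m (u @ conj_perm x y # x # v) * q_z n (x, y) =
    m u * m v * (q_z n (x, y) * \<nu> (conj_perm x y) x) * \<nu> (x \<circ> y) (word_degree v) * \<nu> (word_degree u) (x \<circ> y \<circ> word_degree v)"
    using expand[OF c(1) x] c(2) by (simp add: mult_ac)
  also have "\<dots> = m (u @ x # y # v) * const (q (x, y))"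
    unfolding swap[OF x y, symmetric] expand[OF x y] by (simp add: mult_ac)
  finally show ?thesis .
qed

text \<open>In the cocycle extension, a product \<open>x\<^sub>1 \<star> \<dots> \<star> x\<^sub>k\<close> of generators is \<open>m [x\<^sub>1, \<dots>, x\<^sub>k]\<close> times the product in \<open>A\<close>.
  An element of \<open>R \<otimes> A\<close> is a pair of elements of \<open>A\<close>, and \<open>twist d\<close> gives its component at \<open>d\<close>.\<close>

definition twist :: "bit \<Rightarrow> (perm list \<Rightarrow>\<^sub>0 CC2) \<Rightarrow> (perm list \<Rightarrow>\<^sub>0 complex)"
  where "twist d = wordwise (\<lambda>w r. lookup (m w * r) d)"

lemma additive_twist_coeff: "additive (\<lambda>r. lookup (s * r) d)"
  by (simp add: additive_def distrib_left lookup_add)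

lemma additive_twist: "additive (twist d)"
  unfolding twist_def by (rule additive_wordwise[OF additive_twist_coeff])

lemma lookup_twist: "lookup (twist d f) w = lookup (m w * lookup f w) d"
  unfolding twist_def by (rule lookup_wordwise[OF additive_twist_coeff])

lemma twist_single: "twist d (single w r) = single w (lookup (m w * r) d)"
  unfolding twist_def by (rule wordwise_single[OF additive_twist_coeff])

lemma keys_twist: "keys f \<subseteq> B \<Longrightarrow> keys (twist d f) \<subseteq> B"
  unfolding twist_def using keys_wordwise by blast

lemma lookup_mult_const: "lookup (r * const a) d = lookup r d * a"
  using bit_cases[of d] by (auto simp: lookup_mult_CC2 UNIV_bit lookup_const)

lemma twist_nichols_ideal_iff:
  assumes f: "keys f \<subseteq> lists (transpositions n)"
  shows "f \<in> nichols_ideal n (q_z n) \<longleftrightarrow> (\<forall>d. twist d f \<in> nichols_ideal n q)"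
proof -
  have compat: "braid_compatible n (q_z n) q (\<lambda>w r. lookup (m w * r) d)" for d
    unfolding braid_compatible_def
  proof (intro conjI allI ballI additive_twist_coeff)
    fix u v x y c
    assume "u \<in> lists (transpositions n)" "v \<in> lists (transpositions n)" "x \<in> transpositions n" "y \<in> transpositions n"
    from m_swap[OF this]
    have "m (u @ conj_perm x y # x # v) * (c * q_z n (x, y)) = (m (u @ x # y # v) * c) * const (q (x, y))"
      by (simp add: mult_ac)
    then show "lookup (m (u @ conj_perm x y # x # v) * (c * q_z n (x, y))) d =
      lookup (m (u @ x # y # v) * c) d * q (x, y)"
      by (simp only: lookup_mult_const)
  qed
  have "f \<in> nichols_ideal n (q_z n) \<longleftrightarrow>
    (\<forall>d\<in>UNIV. wordwise (\<lambda>w r. lookup (m w * r) d) f \<in> nichols_ideal n q)"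
  proof (rule nichols_ideal_iff_wordwise[OF rack_cocycle_z rack_cocycle_axioms compat _ f])
    fix w r assume w: "w \<in> lists (transpositions n)" and "\<forall>d\<in>UNIV. lookup (m w * r) d = 0"
    then have "m w * r = 0" by (intro poly_mapping_eqI) simp
    moreover have "r = m w * (m w * r)" using m_involutive[OF w] by (simp flip: mult.assoc)
    ultimately show "r = 0" by simp
  qed
  then show ?thesis by (simp add: twist_def)
qed

definition proj_family :: "(bit \<Rightarrow> perm list \<Rightarrow>\<^sub>0 complex) \<Rightarrow> bit \<Rightarrow> (perm list \<Rightarrow>\<^sub>0 complex) set"
  where "proj_family F = (\<lambda>d. nichols_proj n q (F d))"

lemma proj_family_closed:
  "(\<And>d. keys (F d) \<subseteq> lists (transpositions n)) \<Longrightarrow> proj_family F \<in> carrier A.BC"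
  using alg_epiD(1)[OF nichols_epi] by (simp add: proj_family_def A.base_change_sel)

lemma proj_add:
  "keys f \<subseteq> lists (transpositions n) \<Longrightarrow> keys g \<subseteq> lists (transpositions n) \<Longrightarrow>
    nichols_proj n q (f + g) = nichols_proj n q f \<oplus>\<^bsub>A\<^esub> nichols_proj n q g"
  using alg_epiD(4)[OF nichols_epi, of f g] by simp

lemma finsum_proj_family:
  assumes "finite S" "\<And>s d. s \<in> S \<Longrightarrow> keys (F s d) \<subseteq> lists (transpositions n)"
  shows "finsum A.BC (\<lambda>s. proj_family (F s)) S = proj_family (\<lambda>d. \<Sum>s\<in>S. F s d)"
proof -
  interpret BC: abelian_group A.BC by (rule A.abelian_group_base_change)
  show ?thesis using assms
  proof (induction S rule: finite_induct)
    case empty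
    then show ?case using alg_epiD(6)[OF nichols_epi] by (simp add: proj_family_def A.base_change_sel)
  next
    case (insert s S)
    have "proj_family (F s) \<in> carrier A.BC" "(\<lambda>s. proj_family (F s)) \<in> S \<rightarrow> carrier A.BC"
      using insert.prems by (auto intro!: proj_family_closed)
    moreover have "keys (\<Sum>s\<in>S. F s d) \<subseteq> lists (transpositions n)" for d
      using insert.prems by (intro keys_sum_subset) simp
    ultimately show ?case
      using insert by (simp add: A.base_change_sel proj_family_def proj_add)
  qed
qed

text \<open>The iterated cocycle is its own inverse, so multiplying by it again undoes the twist.\<close>

lemma twist_surj:
  assumes W: "W \<subseteq> lists (transpositions n)" and t: "\<And>d. keys (t d) \<subseteq> W"
  shows "\<exists>f. keys f \<subseteq> W \<and> (\<forall>d. twist d f = t d)"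
proof -
  let ?g = "embed (t 0) + scale zR (embed (t 1))"
  let ?f = "wordwise (\<lambda>w r. m w * r) ?g"
  have add: "additive (\<lambda>r. s * r)" for s :: CC2 by (simp add: additive_def distrib_left)
  have g: "keys ?g \<subseteq> W"
    using t by (simp add: keys_add_subset keys_embed subset_trans[OF keys_scale])
  then have f: "keys ?f \<subseteq> W" using keys_wordwise by blast
  have "twist d ?f = t d" for d
  proof (rule poly_mapping_eqI)
    fix w
    show "lookup (twist d ?f) w = lookup (t d) w"
    proof (cases "w \<in> W")
      case True
      have "m w * (m w * r) = r" for r using m_involutive[OF subsetD[OF W True]] by (simp flip: mult.assoc)
      then have "lookup (twist d ?f) w = lookup (lookup ?g w) d"
        by (simp add: lookup_twist lookup_wordwise[OF add])
      also have "\<dots> = lookup (t d) w"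
        using bit_cases[of d] by (auto simp: lookup_add lookup_embed lookup_mult_CC2 UNIV_bit lookup_const lookup_zR)
      finally show ?thesis .
    next
      case False
      then have "w \<notin> keys (t d)" "w \<notin> keys (twist d ?f)"
        using t keys_twist[OF f] by blast+
      then show ?thesis by (simp add: in_keys_iff)
    qed
  qed
  with f show ?thesis by blast
qed

lemma lookup_mult_expand:
  fixes r s t :: CC2
  shows "lookup (r * s * t) c = (\<Sum>d\<in>UNIV. \<Sum>e\<in>UNIV.
    lookup (group_elt d * group_elt e * t) c * (lookup r d * lookup s e))"
proof -
  have elt: "group_elt 0 = 1" "group_elt 1 = zR" by (simp_all add: group_elt_def zR_def)
  define r0 r1 s0 s1 where "r0 = lookup r 0" "r1 = lookup r 1"
    "s0 = lookup s 0" "s1 = lookup s 1"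
  have "r * s * t = (const r0 + const r1 * zR) * (const s0 + const s1 * zR) * t"
    unfolding r0_r1_s0_s1_def by (simp only: CC2_expand[symmetric])
  also have "\<dots> = t * const (r0 * s0) + (zR * t) * const (r0 * s1) + (zR * t) * const (r1 * s0) + (zR * zR * t) * const (r1 * s1)"
    by (simp add: const_simps algebra_simps)
  finally show ?thesis
    by (simp add: lookup_add lookup_mult_const UNIV_bit elt r0_r1_s0_s1_def)
qed

lemma graded_part_single:
  "graded_part g (single w c) = (if g = word_degree w then single w c else 0)"
  by (rule graded_part_homogeneous) (simp split: if_splits)

text \<open>The right hand side is the product of the cocycle extension, written out in the tensor algebra. On words
  only the summand of their degrees is left, and \<open>m_append\<close> gives its value.\<close>

lemma twist_word_mult:
  assumes f: "keys f \<subseteq> lists (transpositions n)" and f': "keys f' \<subseteq> lists (transpositions n)"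
  shows "twist c (word_mult f f') = (\<Sum>g | g permutes {1..n}. \<Sum>h | h permutes {1..n}. \<Sum>d\<in>UNIV. \<Sum>e\<in>UNIV.
    scale (lookup (group_elt d * group_elt e * \<nu> g h) c)
      (word_mult (graded_part g (twist d f)) (graded_part h (twist e f'))))"
proof (rule additive_eqI[OF _ _ f])
  show "additive (\<lambda>f. twist c (word_mult f f'))"
    by (rule additive_comp[OF additive_twist additive_word_mult_left])
  fix u r assume u: "u \<in> lists (transpositions n)"
  show "twist c (word_mult (single u r) f') =
    (\<Sum>g | g permutes {1..n}. \<Sum>h | h permutes {1..n}. \<Sum>d\<in>UNIV. \<Sum>e\<in>UNIV.
      scale (lookup (group_elt d * group_elt e * \<nu> g h) c)
        (word_mult (graded_part g (twist d (single u r))) (graded_part h (twist e f'))))"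
  proof (rule additive_eqI[OF _ _ f'])
    show "additive (\<lambda>f'. twist c (word_mult (single u r) f'))"
      by (rule additive_comp[OF additive_twist additive_word_mult_right])
    fix v s assume v: "v \<in> lists (transpositions n)"
    let ?a = "\<lambda>d. lookup (m u * r) d" and ?b = "\<lambda>e. lookup (m v * s) e"
    let ?K = "single (u @ v) (lookup ((m u * r) * (m v * s) * \<nu> (word_degree u) (word_degree v)) c)"
    have "(\<Sum>d\<in>UNIV. \<Sum>e\<in>UNIV. scale (lookup (group_elt d * group_elt e * \<nu> g h) c)
        (word_mult (graded_part g (single u (?a d))) (graded_part h (single v (?b e))))) =
      (if g = word_degree u then if h = word_degree v then ?K else 0 else 0)" for g h
    proof (cases "g = word_degree u \<and> h = word_degree v")
      case True
      have single: "(\<Sum>d\<in>UNIV. \<Sum>e\<in>UNIV. single (u @ v) (F d e)) =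
        single (u @ v) (\<Sum>d\<in>UNIV. \<Sum>e\<in>UNIV. F d e)" for F :: "bit \<Rightarrow> bit \<Rightarrow> complex"
        by (simp add: UNIV_bit single_add)
      show ?thesis
        using True by (simp only: graded_part_single if_True word_mult_single scale_single single simp_thms
            lookup_mult_expand[of "m u * r" "m v * s"])
    next
      case False
      then have zero: "scale k (word_mult (graded_part g (single u a)) (graded_part h (single v b))) = 0"
        for k a b :: complex
        by (auto simp: graded_part_single additive.zero[OF additive_word_mult_left]
            additive.zero[OF additive_word_mult_right] scale_simps)
      show ?thesis using False by (auto simp: zero)
    qed
    then have "(\<Sum>g | g permutes {1..n}. \<Sum>h | h permutes {1..n}. \<Sum>d\<in>UNIV. \<Sum>e\<in>UNIV.
      scale (lookup (group_elt d * group_elt e * \<nu> g h) c)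
        (word_mult (graded_part g (twist d (single u r))) (graded_part h (twist e (single v s))))) =
      (\<Sum>g | g permutes {1..n}. if g = word_degree u then \<Sum>h | h permutes {1..n}. if h = word_degree v then ?K else 0 else 0)"
      by (simp add: twist_single) (intro sum.cong HOL.refl, simp)
    also have "\<dots> = ?K"
      using word_degree_permutes[OF u] word_degree_permutes[OF v] by (simp add: sum.delta finite_sym)
    also have "\<dots> = twist c (word_mult (single u r) (single v s))"
      by (simp add: twist_single m_append[OF u v] mult_ac)
    finally show "twist c (word_mult (single u r) (single v s)) =
      (\<Sum>g | g permutes {1..n}. \<Sum>h | h permutes {1..n}. \<Sum>d\<in>UNIV. \<Sum>e\<in>UNIV.
      scale (lookup (group_elt d * group_elt e * \<nu> g h) c)
        (word_mult (graded_part g (twist d (single u r))) (graded_part h (twist e (single v s)))))" ..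
  qed (simp add: additive_def additive.add[OF additive_twist] additive.add[OF additive_graded_part]
      additive.add[OF additive_word_mult_right] scale_simps(1) sum.distrib)
qed (simp add: additive_def additive.add[OF additive_twist] additive.add[OF additive_graded_part]
    additive.add[OF additive_word_mult_left] scale_simps(1) sum.distrib)

text \<open>The inverse of the isomorphism of the main result, lifted to the tensor algebra.\<close>

lemma twist_epi: "alg_epi (TR n) (cocycle_ext (sym_group n) (nichols_grading n q) \<nu> A) (\<lambda>f. proj_family (\<lambda>d. twist d f))"
    (is "alg_epi _ ?C ?\<Phi>")
proof -
  have sel: "carrier ?C = carrier A.BC" "add ?C = add A.BC" "\<one>\<^bsub>?C\<^esub> = \<one>\<^bsub>A.BC\<^esub>" "\<zero>\<^bsub>?C\<^esub> = \<zero>\<^bsub>A.BC\<^esub>"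
    "k \<odot>\<^bsub>?C\<^esub> f = k \<odot>\<^bsub>A.BC\<^esub> f" for k f
    by (simp_all add: cocycle_ext_def)
  interpret BC: abelian_group A.BC by (rule A.abelian_group_base_change)
  note epi = alg_epiD[OF nichols_epi, simplified]
  let ?p = "nichols_proj n q"
  show ?thesis
  proof (rule alg_epiI)
    fix f assume "f \<in> carrier (TR n)"
    then have f: "keys f \<subseteq> lists (transpositions n)" by simp
    show "?\<Phi> f \<in> carrier ?C" unfolding sel using keys_twist[OF f] by (rule proj_family_closed)
    show "?\<Phi> (k \<odot>\<^bsub>TR n\<^esub> f) = k \<odot>\<^bsub>?C\<^esub> ?\<Phi> f" for k
    proof
      fix c
      have "twist c (scale k f) = scale (lookup k 0) (twist c f) + scale (lookup k 1) (twist (c - 1) f)"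
        by (rule poly_mapping_eqI)
          (simp add: lookup_twist lookup_add mult.left_commute[of _ k] lookup_mult_CC2[of k] UNIV_bit)
      then show "?\<Phi> (k \<odot>\<^bsub>TR n\<^esub> f) c = (k \<odot>\<^bsub>?C\<^esub> ?\<Phi> f) c"
        unfolding sel using keys_twist[OF f] epi(1)
        by (simp add: A.base_change_sel A.finsum_bit proj_family_def proj_add epi(7) subset_trans[OF keys_scale])
    qed
    fix g assume "g \<in> carrier (TR n)"
    then have g: "keys g \<subseteq> lists (transpositions n)" by simp
    show "?\<Phi> (f \<oplus>\<^bsub>TR n\<^esub> g) = ?\<Phi> f \<oplus>\<^bsub>?C\<^esub> ?\<Phi> g"
      unfolding sel by (simp add: A.base_change_sel proj_family_def additive.add[OF additive_twist] proj_add keys_twist f g)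
    show "?\<Phi> (f \<otimes>\<^bsub>TR n\<^esub> g) = ?\<Phi> f \<otimes>\<^bsub>?C\<^esub> ?\<Phi> g"
    proof -
      let ?S = "{g. g permutes {1..n}}"
      let ?t = "\<lambda>a b d e c. scale (lookup (group_elt d * group_elt e * \<nu> a b) c)
        (word_mult (graded_part a (twist d f)) (graded_part b (twist e g)))"
      have t: "keys (?t a b d e c) \<subseteq> lists (transpositions n)" for a b d e c
        by (intro subset_trans[OF keys_scale] word_mult_lists keys_graded_part keys_twist f g)
      have t2: "keys (\<Sum>e\<in>UNIV. ?t a b d e c) \<subseteq> lists (transpositions n)" for a b d c
        by (intro keys_sum_subset t)
      have t3: "keys (\<Sum>d\<in>UNIV. \<Sum>e\<in>UNIV. ?t a b d e c) \<subseteq> lists (transpositions n)" for a b c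
        by (intro keys_sum_subset t2)
      have t4: "keys (\<Sum>b\<in>?S. \<Sum>d\<in>UNIV. \<Sum>e\<in>UNIV. ?t a b d e c) \<subseteq> lists (transpositions n)" for a c
        by (intro keys_sum_subset t3)
      have fin: "finite (UNIV :: bit set)" by (simp add: UNIV_bit)
      let ?comp = "comp_family (sym_group n) (nichols_grading n q) A"
      have pure: "pure A r (?p x \<otimes>\<^bsub>A\<^esub> ?p y) = proj_family (\<lambda>c. scale (lookup r c) (word_mult x y))"
        if "keys x \<subseteq> lists (transpositions n)" "keys y \<subseteq> lists (transpositions n)" for r x y
        using epi(3)[OF that] epi(7)[OF word_mult_lists[OF that]] by (simp add: pure_def proj_family_def)
      have inner: "(\<Oplus>\<^bsub>A.BC\<^esub>d\<in>UNIV. \<Oplus>\<^bsub>A.BC\<^esub>e\<in>UNIV. pure A (group_elt d * group_elt e * \<nu> a b)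
          (?comp (?\<Phi> f d) a \<otimes>\<^bsub>A\<^esub> ?comp (?\<Phi> g e) b)) = proj_family (\<lambda>c. \<Sum>d\<in>UNIV. \<Sum>e\<in>UNIV. ?t a b d e c)"
        if "a permutes {1..n}" "b permutes {1..n}" for a b
      proof -
        have "pure A (group_elt d * group_elt e * \<nu> a b) (?comp (?\<Phi> f d) a \<otimes>\<^bsub>A\<^esub> ?comp (?\<Phi> g e) b) =
          proj_family (?t a b d e)" for d e
          unfolding proj_family_def[of "\<lambda>d. twist d f"] proj_family_def[of "\<lambda>d. twist d g"]
          by (simp only: comp_family_nichols[OF keys_twist[OF f] that(1)] comp_family_nichols[OF keys_twist[OF g] that(2)]
              pure[OF keys_graded_part[OF keys_twist[OF f]] keys_graded_part[OF keys_twist[OF g]]])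
        then show ?thesis
          by (simp only: finsum_proj_family[OF fin t] finsum_proj_family[OF fin t2])
      qed
      have "?\<Phi> f \<otimes>\<^bsub>?C\<^esub> ?\<Phi> g = (\<Oplus>\<^bsub>A.BC\<^esub>a\<in>?S. \<Oplus>\<^bsub>A.BC\<^esub>b\<in>?S. \<Oplus>\<^bsub>A.BC\<^esub>d\<in>UNIV. \<Oplus>\<^bsub>A.BC\<^esub>e\<in>UNIV.
        pure A (group_elt d * group_elt e * \<nu> a b) (?comp (?\<Phi> f d) a \<otimes>\<^bsub>A\<^esub> ?comp (?\<Phi> g e) b))"
        by (simp add: cocycle_ext_def sym_group_def)
      also have "\<dots> = (\<Oplus>\<^bsub>A.BC\<^esub>a\<in>?S. \<Oplus>\<^bsub>A.BC\<^esub>b\<in>?S. proj_family (\<lambda>c. \<Sum>d\<in>UNIV. \<Sum>e\<in>UNIV. ?t a b d e c))"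
        by (intro BC.finsum_cong' HOL.refl Pi_I BC.finsum_closed proj_family_closed t3) (simp_all only: mem_Collect_eq inner)
      also have "\<dots> = proj_family (\<lambda>c. \<Sum>a\<in>?S. \<Sum>b\<in>?S. \<Sum>d\<in>UNIV. \<Sum>e\<in>UNIV. ?t a b d e c)"
        by (simp only: finsum_proj_family[OF finite_sym(1) t3] finsum_proj_family[OF finite_sym(1) t4])
      also have "\<dots> = ?\<Phi> (f \<otimes>\<^bsub>TR n\<^esub> g)"
        by (simp only: twist_word_mult[OF f g] tensor_alg_sel)
      finally show ?thesis ..
    qed
  next
    fix F assume F: "F \<in> carrier ?C"
    have "\<forall>d. \<exists>t. keys t \<subseteq> lists (transpositions n) \<and> ?p t = F d"
    proof
      fix d
      have "F d \<in> ?p ` carrier T" using F unfolding sel A.base_change_sel alg_epiD(2)[OF nichols_epi] by simp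
      then show "\<exists>t. keys t \<subseteq> lists (transpositions n) \<and> ?p t = F d" by auto
    qed
    from choice[OF this] obtain t
      where t: "\<And>d. keys (t d) \<subseteq> lists (transpositions n)" "\<And>d. ?p (t d) = F d" by blast
    from twist_surj[OF subset_refl, of t] t(1) obtain f
      where f: "keys f \<subseteq> lists (transpositions n)" "\<And>d. twist d f = t d" by blast
    then have "?\<Phi> f = F" using t(2) by (simp add: proj_family_def)
    with f(1) show "\<exists>f\<in>carrier (TR n). ?\<Phi> f = F" by (intro bexI[of _ f]) simp_all
  next
    show "?\<Phi> \<one>\<^bsub>TR n\<^esub> = \<one>\<^bsub>?C\<^esub>"
    proof
      fix d
      have "?p (single [] c) = c \<odot>\<^bsub>A\<^esub> \<one>\<^bsub>A\<^esub>" for c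
        using epi(7)[of "single [] 1" c] epi(5) by simp
      then show "?\<Phi> \<one>\<^bsub>TR n\<^esub> d = \<one>\<^bsub>?C\<^esub> d"
        unfolding sel by (simp add: A.base_change_sel pure_def proj_family_def twist_single)
    qed
    show "?\<Phi> \<zero>\<^bsub>TR n\<^esub> = \<zero>\<^bsub>?C\<^esub>"
      unfolding sel using epi(6) by (simp add: A.base_change_sel proj_family_def additive.zero[OF additive_twist])
  qed
qed

theorem gen_iso_cocycle_ext:
  "gen_iso (transpositions n)
    (cocycle_ext (sym_group n) (nichols_grading n q) \<nu> A) (\<lambda>\<tau>. pure A 1 (nichols_gen n q \<tau>))
    (B_z n) (nichols_gen n (q_z n))"
proof (rule gen_iso_of_epis[OF assoc_algebra_tensor_alg twist_epi nichols_alg_epi(1)])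
  fix f g assume "f \<in> carrier (TR n)" "g \<in> carrier (TR n)"
  then have fg: "keys f \<subseteq> lists (transpositions n)" "keys g \<subseteq> lists (transpositions n)"
    by simp_all
  have "proj_family (\<lambda>d. twist d f) = proj_family (\<lambda>d. twist d g) \<longleftrightarrow> (\<forall>d. twist d (f - g) \<in> nichols_ideal n q)"
    unfolding proj_family_def fun_eq_iff
    using fg by (simp add: nichols_proj_eq_iff keys_twist additive.diff[OF additive_twist])
  also have "\<dots> \<longleftrightarrow> nichols_proj n (q_z n) f = nichols_proj n (q_z n) g"
    using twist_nichols_ideal_iff[OF keys_diff_subset[OF fg]] nichols_proj_eq[OF rack_cocycle_z fg] by simp
  finally show "proj_family (\<lambda>d. twist d f) = proj_family (\<lambda>d. twist d g) \<longleftrightarrow>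
    nichols_proj n (q_z n) f = nichols_proj n (q_z n) g" .
next
  fix \<tau> assume \<tau>: "\<tau> \<in> transpositions n"
  have "nichols_proj n q (single [\<tau>] c) = c \<odot>\<^bsub>A\<^esub> nichols_gen n q \<tau>" for c
    using alg_epiD(7)[OF nichols_epi, of "single [\<tau>] 1" c] \<tau> by (simp add: nichols_gen_def)
  then have "proj_family (\<lambda>d. twist d (single [\<tau>] 1)) = pure A 1 (nichols_gen n q \<tau>)"
    by (simp only: pure_def proj_family_def twist_single m_letter[OF \<tau>] mult_1_left)
  with \<tau> show "single [\<tau>] 1 \<in> carrier (TR n) \<and>
    proj_family (\<lambda>d. twist d (single [\<tau>] 1)) = pure A 1 (nichols_gen n q \<tau>) \<and>
    nichols_proj n (q_z n) (single [\<tau>] 1) = nichols_gen n (q_z n) \<tau>"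
    by (simp add: nichols_gen_def)
qed

end

section \<open>Freeness\<close>

text \<open>The words in \<open>W\<close> form a basis of the quotient of the tensor algebra by \<open>I\<close>.\<close>

definition word_complement :: "perm list set \<Rightarrow> (perm list \<Rightarrow>\<^sub>0 'k::comm_ring_1) set \<Rightarrow> nat \<Rightarrow> bool"
  where "word_complement W I n \<longleftrightarrow> W \<subseteq> lists (transpositions n) \<and>
    (\<forall>f. keys f \<subseteq> lists (transpositions n) \<longrightarrow> (\<exists>g. keys g \<subseteq> W \<and> f - g \<in> I)) \<and>
    (\<forall>g. keys g \<subseteq> W \<longrightarrow> g \<in> I \<longrightarrow> g = 0)"

text \<open>Extend a basis of the ideal to a basis of the tensor algebra by adding words.\<close>

lemma ex_word_complement:
  assumes "rack_cocycle n (q :: perm \<times> perm \<Rightarrow> complex)"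
  shows "\<exists>W. word_complement W (nichols_ideal n q) n"
proof -
  interpret rack_cocycle n q by fact
  interpret V: vector_space "scale :: complex \<Rightarrow> (perm list \<Rightarrow>\<^sub>0 complex) \<Rightarrow> _"
    by unfold_locales (simp_all add: scale_simps)
  let ?I = "nichols_ideal n q" and ?L = "lists (transpositions n)"
  have span_keys: "keys f \<subseteq> W" if "f \<in> V.span ((\<lambda>w. single w 1) ` W)" for f W
  proof -
    have "V.subspace {f. keys f \<subseteq> W}"
      by (auto simp: V.subspace_def keys_add_subset intro!: keys_scale[THEN subset_trans])
    then have "V.span ((\<lambda>w. single w 1) ` W) \<subseteq> {f. keys f \<subseteq> W}"
      by (intro V.span_minimal) auto
    then show ?thesis using that by blast
  qed
  have keys_span: "f \<in> V.span ((\<lambda>w. single w 1) ` W)" if "keys f \<subseteq> W" for f W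
  proof -
    have "(\<Sum>w\<in>keys f. scale (lookup f w) (single w 1)) \<in> V.span ((\<lambda>w. single w 1) ` W)"
      using that by (intro V.span_sum V.span_scale V.span_base) auto
    then show ?thesis by (simp add: sum_singles)
  qed
  obtain B0 where B0: "B0 \<subseteq> ?I" "V.independent B0" "?I \<subseteq> V.span B0"
    by (rule V.maximal_independent_subset)
  have "V.subspace ?I"
    by (auto simp: V.subspace_def nichols_ideal_zero nichols_ideal_add nichols_ideal_scale)
  then have span_B0: "V.span B0 = ?I"
    using V.span_minimal[OF B0(1)] B0(3) by blast
  obtain B where B: "B0 \<subseteq> B" "B \<subseteq> B0 \<union> (\<lambda>w. single w 1) ` ?L" "V.independent B"
    "B0 \<union> (\<lambda>w. single w 1) ` ?L \<subseteq> V.span B"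
    by (rule V.maximal_independent_subset_extend[OF Un_upper1 B0(2)])
  define W where "W = {w \<in> ?L. single w 1 \<in> B - B0}"
  have W: "(\<lambda>w. single w 1) ` W = B - B0" using B(2) by (auto simp: W_def)
  have "\<exists>g. keys g \<subseteq> W \<and> f - g \<in> ?I" if "keys f \<subseteq> ?L" for f
  proof -
    have "f \<in> V.span ((\<lambda>w. single w 1) ` ?L)" by (rule keys_span[OF that])
    also have "\<dots> \<subseteq> V.span B" using B(4) by (intro V.span_minimal) auto
    also have "B = B0 \<union> (\<lambda>w. single w 1) ` W" unfolding W using B(1) by blast
    finally obtain x g where "f = x + g" "x \<in> V.span B0" "g \<in> V.span ((\<lambda>w. single w 1) ` W)"
      unfolding V.span_Un by blast
    then show ?thesis using span_keys span_B0 by (intro exI[of _ g]) auto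
  qed
  moreover have "g = 0" if g: "keys g \<subseteq> W" "g \<in> ?I" for g
  proof -
    have g0: "g \<in> V.span B0" and g1: "g \<in> V.span (B - B0)"
      using g span_B0 keys_span[OF g(1)] unfolding W by auto
    have "V.representation B0 g = V.representation (B - B0) g"
      using V.representation_extend[OF B(3) g0 B(1)] V.representation_extend[OF B(3) g1 Diff_subset] by simp
    then have "{b. V.representation B0 g b \<noteq> 0} = {}"
      using V.representation_ne_zero[of B0 g] V.representation_ne_zero[of "B - B0" g] by auto
    then show "g = 0" using V.sum_nonzero_representation_eq[OF B0(2) g0] by simp
  qed
  ultimately have "word_complement W ?I n" unfolding word_complement_def W_def by blast
  then show ?thesis ..
qed

text \<open>Twisting multiplies every word by a unit, so it takes monomial bases to monomial bases. Over \<open>R\<close>, where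
  not every module is free, the basis is inherited from the complex algebra in this way.\<close>

lemma (in twisting) word_complement_z:
  assumes "word_complement W (nichols_ideal n q) n"
  shows "word_complement W (nichols_ideal n (q_z n)) n"
proof -
  have W: "W \<subseteq> lists (transpositions n)"
    and ex: "\<And>f. keys f \<subseteq> lists (transpositions n) \<Longrightarrow> \<exists>g. keys g \<subseteq> W \<and> f - g \<in> nichols_ideal n q"
    and zero: "\<And>g. keys g \<subseteq> W \<Longrightarrow> g \<in> nichols_ideal n q \<Longrightarrow> g = 0"
    using assms unfolding word_complement_def by blast+
  have "\<exists>g. keys g \<subseteq> W \<and> f - g \<in> nichols_ideal n (q_z n)"
    if f: "keys f \<subseteq> lists (transpositions n)" for f
  proof -
    have "\<forall>d. \<exists>h. keys h \<subseteq> W \<and> twist d f - h \<in> nichols_ideal n q"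
      using ex[OF keys_twist[OF f]] by blast
    from choice[OF this] obtain h where h: "\<And>d. keys (h d) \<subseteq> W" "\<And>d. twist d f - h d \<in> nichols_ideal n q" by blast
    from twist_surj[OF W, of h] h(1) obtain g where g: "keys g \<subseteq> W" "\<And>d. twist d g = h d" by blast
    have "f - g \<in> nichols_ideal n (q_z n)"
      using twist_nichols_ideal_iff[of "f - g"] keys_diff_subset[OF f subset_trans[OF g(1) W]] g(2) h(2)
      by (simp add: additive.diff[OF additive_twist])
    with g(1) show ?thesis by blast
  qed
  moreover have "g = 0" if g: "keys g \<subseteq> W" "g \<in> nichols_ideal n (q_z n)" for g
  proof -
    have gL: "keys g \<subseteq> lists (transpositions n)" using g(1) W by blast
    have *: "twist d g = 0" for d
      using twist_nichols_ideal_iff[OF gL] g zero[OF keys_twist[OF g(1)]] by blast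
    show "g = 0"
    proof (rule poly_mapping_eqI)
      fix w
      show "lookup g w = lookup 0 w"
      proof (cases "w \<in> lists (transpositions n)")
        case True
        have "m w * lookup g w = 0"
          using * by (intro poly_mapping_eqI) (simp flip: lookup_twist)
        then have "m w * m w * lookup g w = 0" by (simp add: mult.assoc)
        then show ?thesis by (simp add: m_involutive[OF True])
      next
        case False
        then have "w \<notin> keys g" using gL by blast
        then show ?thesis by (simp add: in_keys_iff)
      qed
    qed
  qed
  ultimately show ?thesis unfolding word_complement_def using W by blast
qed

text \<open>A family of coefficients is the same as a combination \<open>lift c\<close> of words in \<open>W\<close>, and every element of the
  quotient has exactly one representative of this kind.\<close>

lemma (in rack_cocycle) free_module_nichols_alg:
  assumes W: "word_complement W (nichols_ideal n q) n"
  shows "free_module (nichols_alg n q)"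
proof -
  interpret N: assoc_algebra "nichols_alg n q" by (rule assoc_algebra_nichols_alg)
  let ?p = "nichols_proj n q" and ?A = "nichols_alg n q"
  have WL: "W \<subseteq> lists (transpositions n)"
    and ex: "\<And>f. keys f \<subseteq> lists (transpositions n) \<Longrightarrow> \<exists>g. keys g \<subseteq> W \<and> f - g \<in> nichols_ideal n q"
    and zero: "\<And>g. keys g \<subseteq> W \<Longrightarrow> g \<in> nichols_ideal n q \<Longrightarrow> g = 0"
    using W unfolding word_complement_def by blast+
  have inj_p: "g = g'" if "keys g \<subseteq> W" "keys g' \<subseteq> W" "?p g = ?p g'" for g g'
    using nichols_proj_eq_iff[of g g'] zero[OF keys_diff_subset[OF that(1,2)]] that WL by auto
  define e where "e w = ?p (single w 1)" for w
  have inj: "inj_on e W"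
  proof (rule inj_onI)
    fix w w' assume "w \<in> W" "w' \<in> W" "e w = e w'"
    then have "single w (1 :: 'k) = single w' 1"
      by (intro inj_p) (auto simp: e_def)
    then show "w = w'" by (metis keys_single one_neq_zero singleton_inject)
  qed
  define \<theta> where "\<theta> = the_inv_into W e"
  have \<theta>: "\<theta> (e w) = w" if "w \<in> W" for w unfolding \<theta>_def by (rule the_inv_into_f_f[OF inj that])
  define lift where "lift c = (\<Sum>x | c x \<noteq> 0. single (\<theta> x) (c x))" for c :: "_ \<Rightarrow> 'k"
  have keys_lift: "keys (lift c) \<subseteq> W" if "{x. c x \<noteq> 0} \<subseteq> e ` W" for c
    unfolding lift_def using that \<theta> by (intro keys_sum_subset keys_single_subset) auto
  have lookup_lift: "lookup (lift c) w = c (e w)"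
    if c: "finite {x. c x \<noteq> 0}" "{x. c x \<noteq> 0} \<subseteq> e ` W" and w: "w \<in> W" for c w
  proof -
    have "lookup (lift c) w = (\<Sum>x | c x \<noteq> 0. if x = e w then c x else 0)"
      unfolding lift_def lookup_sum
      using c(2) \<theta> w by (intro sum.cong HOL.refl) (auto simp: lookup_single when_def)
    then show ?thesis using c(1) by (simp add: sum.delta)
  qed
  have p_lift: "(\<Oplus>\<^bsub>?A\<^esub>x\<in>{x. c x \<noteq> 0}. c x \<odot>\<^bsub>?A\<^esub> x) = ?p (lift c)"
    if c: "finite {x. c x \<noteq> 0}" "{x. c x \<noteq> 0} \<subseteq> e ` W" for c
  proof -
    have *: "keys (single (\<theta> x) (c x)) \<subseteq> lists (transpositions n)" "c x \<odot>\<^bsub>?A\<^esub> x = ?p (single (\<theta> x) (c x))"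
      if x: "x \<in> {x. c x \<noteq> 0}" for x
    proof -
      obtain w where w: "w \<in> W" "x = e w" using c(2) x by blast
      then have 1: "single w 1 \<in> carrier T" using WL by auto
      have \<theta>x: "\<theta> x = w" unfolding w(2) by (rule \<theta>[OF w(1)])
      have "?p (single w (c x)) = c x \<odot>\<^bsub>?A\<^esub> x"
        using alg_epiD(7)[OF nichols_epi 1, of "c x"] unfolding w(2) e_def by simp
      with 1 show "keys (single (\<theta> x) (c x)) \<subseteq> lists (transpositions n)" "c x \<odot>\<^bsub>?A\<^esub> x = ?p (single (\<theta> x) (c x))"
        unfolding \<theta>x by simp_all
    qed
    have "(\<Oplus>\<^bsub>?A\<^esub>x\<in>{x. c x \<noteq> 0}. c x \<odot>\<^bsub>?A\<^esub> x) = (\<Oplus>\<^bsub>?A\<^esub>x\<in>{x. c x \<noteq> 0}. ?p (single (\<theta> x) (c x)))"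
      using * alg_epiD(1)[OF nichols_epi] by (intro N.finsum_cong') auto
    also have "\<dots> = ?p (finsum T (\<lambda>x. single (\<theta> x) (c x)) {x. c x \<noteq> 0})"
      using *(1) by (intro finsum_epi[OF ring_tensor_alg N.ring_axioms nichols_epi, symmetric]) auto
    also have "finsum T (\<lambda>x. single (\<theta> x) (c x)) {x. c x \<noteq> 0} = lift c"
      unfolding lift_def by (rule finsum_tensor_alg[OF *(1)])
    finally show ?thesis .
  qed
  have unique_coeffs: "\<exists>!c. finite {x. c x \<noteq> 0} \<and> {x. c x \<noteq> 0} \<subseteq> e ` W \<and> y = (\<Oplus>\<^bsub>?A\<^esub>x\<in>{x. c x \<noteq> 0}. c x \<odot>\<^bsub>?A\<^esub> x)"
    if y: "y \<in> carrier ?A" for y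
  proof -
    obtain f where f: "keys f \<subseteq> lists (transpositions n)" "y = ?p f"
      using y unfolding alg_epiD(2)[OF nichols_epi, symmetric] by auto
    then obtain g where g: "keys g \<subseteq> W" "f - g \<in> nichols_ideal n q" using ex by blast
    then have yg: "y = ?p g" using nichols_proj_eq_iff[of f g] f WL by auto
    define c where "c x = (if x \<in> e ` W then lookup g (\<theta> x) else 0)" for x
    have supp: "{x. c x \<noteq> 0} \<subseteq> e ` keys g"
      using \<theta> by (auto simp: c_def in_keys_iff split: if_splits)
    then have c: "finite {x. c x \<noteq> 0}" "{x. c x \<noteq> 0} \<subseteq> e ` W"
      using g(1) finite_subset[OF supp] by auto
    have unique: "lift c' = g" if "finite {x. c' x \<noteq> 0}" "{x. c' x \<noteq> 0} \<subseteq> e ` W" "y = ?p (lift c')" for c'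
      using inj_p[OF keys_lift[OF that(2)] g(1)] that(3) yg by simp
    have "lift c = g"
    proof (rule poly_mapping_eqI)
      fix w
      show "lookup (lift c) w = lookup g w"
      proof (cases "w \<in> W")
        case True
        then have "c (e w) = lookup g w" using \<theta> by (simp add: c_def)
        then show ?thesis using lookup_lift[OF c True] by simp
      next
        case False
        then have "w \<notin> keys (lift c)" "w \<notin> keys g" using keys_lift[OF c(2)] g(1) by auto
        then show ?thesis by (simp add: in_keys_iff)
      qed
    qed
    show ?thesis
    proof (rule ex1I[of _ c])
      show "finite {x. c x \<noteq> 0} \<and> {x. c x \<noteq> 0} \<subseteq> e ` W \<and> y = (\<Oplus>\<^bsub>?A\<^esub>x\<in>{x. c x \<noteq> 0}. c x \<odot>\<^bsub>?A\<^esub> x)"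
        using c p_lift[OF c] \<open>lift c = g\<close> yg by simp
      fix c' assume c': "finite {x. c' x \<noteq> 0} \<and> {x. c' x \<noteq> 0} \<subseteq> e ` W \<and> y = (\<Oplus>\<^bsub>?A\<^esub>x\<in>{x. c' x \<noteq> 0}. c' x \<odot>\<^bsub>?A\<^esub> x)"
      then have "lift c' = g" using unique[of c'] p_lift[of c'] by simp
      show "c' = c"
      proof
        fix x
        show "c' x = c x"
        proof (cases "x \<in> e ` W")
          case True
          then obtain w where w: "w \<in> W" "x = e w" by blast
          then show ?thesis
            using lookup_lift[of c' w] lookup_lift[OF c w(1)] c' \<open>lift c' = g\<close> \<open>lift c = g\<close> by simp
        next
          case False
          then have "c' x = 0" using c' by blast
          moreover have "c x = 0" using False by (simp add: c_def)
          ultimately show ?thesis by simp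
        qed
      qed
    qed
  qed
  have "e ` W \<subseteq> carrier ?A"
  proof
    fix x assume "x \<in> e ` W"
    then obtain w where w: "w \<in> W" "x = e w" by blast
    then have "single w 1 \<in> carrier T" using WL by auto
    from alg_epiD(1)[OF nichols_epi this] show "x \<in> carrier ?A" using w(2) by (simp add: e_def)
  qed
  then show ?thesis
    unfolding free_module_def
    by (intro conjI exI[of _ "e ` W"] ballI unique_coeffs N.is_module)
qed

section \<open>The cocycle \<open>[1,z]\<close> and its product with its specialisation\<close>

context T_section
begin

lemma twisting_plus: "twisting n (q_plus n) \<mu>"
proof (intro twisting.intro twisting_axioms.intro)
  show "rack_cocycle n (q_plus n)" by (rule rack_cocycle_sign) simp
  show "\<mu> g h * \<mu> g h = 1" for g h using mu_values[of g h] by (auto simp: zR_square)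
  fix x y assume x: "x \<in> transpositions n" and "y \<in> transpositions n"
  then obtain i j where y: "y = transpose i j" "1 \<le> i" "i < j" "j \<le> n" by (elim transpositionsE)
  have one: "(1 :: complex) * 1 = 1" by simp
  show "const (q_plus n (x, y)) * \<mu> x y = q_z n (x, y) * \<mu> (conj_perm x y) x"
    unfolding y(1) qfun_transpose[OF one x y(2-4)] qfun_transpose[OF zR_square x y(2-4)] mu_swap[OF x y(2-4)]
    by (simp add: const_simps)
qed (use mu_cocycle mu_normalised in auto)

text \<open>Multiplying a cocycle by its specialisation replaces \<open>z\<close> by \<open>-z\<close>, which makes up for the passage from \<open>q\<^sub>1\<close>
  to \<open>q\<^bsub>-1\<^esub>\<close>.\<close>

lemma twisting_minus: "twisting n (q_minus n) (twist_minus \<mu>)"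
proof (intro twisting.intro twisting_axioms.intro)
  let ?s = "\<lambda>r. const (subst_z (- 1) r)"
  have s_mult: "?s (r * s) = ?s r * ?s s" for r s by (simp add: subst_z_mult const_simps)
  have s_one: "?s 1 = 1" by (simp add: subst_z_simps const_simps)
  have s_zR: "?s zR = - 1" by (simp add: subst_z_simps const_simps)
  have sq: "\<mu> g h * \<mu> g h = 1" for g h using mu_values[of g h] by (auto simp: zR_square)
  show "rack_cocycle n (q_minus n)" by (rule rack_cocycle_sign) simp
  show "twist_minus \<mu> g h * twist_minus \<mu> g h = 1" for g h
  proof -
    have "twist_minus \<mu> g h * twist_minus \<mu> g h = (\<mu> g h * \<mu> g h) * ?s (\<mu> g h * \<mu> g h)"
      unfolding s_mult twist_minus_def by (simp only: mult_ac)
    then show ?thesis by (simp only: sq s_one mult_1_left)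
  qed
  show "twist_minus \<mu> id g = 1" "twist_minus \<mu> g id = 1" if "g permutes {1..n}" for g
    by (simp_all only: twist_minus_def mu_normalised[OF that] s_one mult_1_left)
  show "twist_minus \<mu> g h * twist_minus \<mu> (g \<circ> h) k = twist_minus \<mu> g (h \<circ> k) * twist_minus \<mu> h k"
    if "g permutes {1..n}" "h permutes {1..n}" "k permutes {1..n}" for g h k
  proof -
    have "twist_minus \<mu> g h * twist_minus \<mu> (g \<circ> h) k = (\<mu> g h * \<mu> (g \<circ> h) k) * ?s (\<mu> g h * \<mu> (g \<circ> h) k)"
      unfolding s_mult twist_minus_def by (simp only: mult_ac)
    also have "\<dots> = twist_minus \<mu> g (h \<circ> k) * twist_minus \<mu> h k"
      unfolding mu_cocycle[OF that] s_mult twist_minus_def by (simp only: mult_ac)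
    finally show ?thesis .
  qed
  fix x y assume x: "x \<in> transpositions n" and "y \<in> transpositions n"
  then obtain i j where y: "y = transpose i j" "1 \<le> i" "i < j" "j \<le> n" by (elim transpositionsE)
  have one: "(- 1 :: complex) * (- 1) = 1" by simp
  show "const (q_minus n (x, y)) * twist_minus \<mu> x y = q_z n (x, y) * twist_minus \<mu> (conj_perm x y) x"
    unfolding y(1) qfun_transpose[OF one x y(2-4)] qfun_transpose[OF zR_square x y(2-4)] twist_minus_def mu_swap[OF x y(2-4)] s_mult
    by (simp add: const_simps s_zR s_one)
qed

lemma twist_minus_cocycles2:
  "twist_minus \<mu> \<in> cocycles2 (sym_group n) (units_of (ring_of_type_algebra :: CC2 ring))"
proof -
  interpret twisting n "q_minus n" "twist_minus \<mu>" by (rule twisting_minus)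
  have "twist_minus \<mu> g h \<in> Units (ring_of_type_algebra :: CC2 ring)"
    if "g permutes {1..n}" "h permutes {1..n}" for g h
    using involutive[OF that] by (auto simp: Units_def ring_of_type_algebra_def)
  then show ?thesis
    using cocycle normalised by (auto simp: cocycles2_def units_of_def sym_group_def ring_of_type_algebra_def)
qed

lemma free_module_B_z: "free_module (B_z n)"
proof -
  obtain W where "word_complement W (nichols_ideal n (q_plus n)) n"
    using ex_word_complement[OF rack_cocycle_sign, of 1 n] by auto
  then have "word_complement W (nichols_ideal n (q_z n)) n"
    by (rule twisting.word_complement_z[OF twisting_plus])
  then show ?thesis by (rule rack_cocycle.free_module_nichols_alg[OF rack_cocycle_z])
qed

end

lemma gen_iso_alg_iso: "gen_iso S A a B b \<Longrightarrow> alg_iso A B \<noteq> {}"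
  by (auto simp: gen_iso_def)

theorem theorem6p20:
  fixes n :: nat and T :: "perm \<Rightarrow> T_word set"
  assumes "0 < n" and "is_section n T"
  shows
    "cocycle_1z n T \<in> cocycles2 (sym_group n) C2
     \<and> twist_minus (cocycle_1z n T)
          \<in> cocycles2 (sym_group n) (units_of (ring_of_type_algebra :: CC2 ring))
     \<and> gen_iso (transpositions n)
          (cocycle_ext (sym_group n) (nichols_grading n (q_plus n)) (cocycle_1z n T) (B_plus n))
          (\<lambda>\<tau>. pure (B_plus n) 1 (nichols_gen n (q_plus n) \<tau>))
          (B_z n) (nichols_gen n (q_z n))
     \<and> gen_iso (transpositions n)
          (cocycle_ext (sym_group n) (nichols_grading n (q_minus n))
             (twist_minus (cocycle_1z n T)) (B_minus n))
          (\<lambda>\<tau>. pure (B_minus n) 1 (nichols_gen n (q_minus n) \<tau>))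
          (B_z n) (nichols_gen n (q_z n))
     \<and> C2_flat_deformation (B_z n) (B_plus n) (B_minus n)
     \<and> gen_iso (transpositions n)
          (specialise 1 (B_z n)) (\<lambda>\<tau>. specialise_proj 1 (B_z n) (nichols_gen n (q_z n) \<tau>))
          (B_plus n) (nichols_gen n (q_plus n))
     \<and> gen_iso (transpositions n)
          (specialise (-1) (B_z n)) (\<lambda>\<tau>. specialise_proj (-1) (B_z n) (nichols_gen n (q_z n) \<tau>))
          (B_minus n) (nichols_gen n (q_minus n))
     \<and> ideal_direct_sum (B_z n) (scalar_ideal idem_plus (B_z n)) (scalar_ideal idem_minus (B_z n))
     \<and> (let P = idem_part idem_plus (base_change (B_plus n));
            M = idem_part idem_minus (base_change (B_minus n))
        in \<exists>\<psi> \<in> alg_iso (B_z n) (dsum_alg P M).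
             (\<forall>\<tau> \<in> transpositions n. \<psi> (nichols_gen n (q_z n) \<tau>) =
                (pure (B_plus n) idem_plus (nichols_gen n (q_plus n) \<tau>),
                 pure (B_minus n) idem_minus (nichols_gen n (q_minus n) \<tau>)))
             \<and> \<psi> ` scalar_ideal idem_plus (B_z n) = carrier P \<times> {\<zero>\<^bsub>M\<^esub>}
             \<and> \<psi> ` scalar_ideal idem_minus (B_z n) = {\<zero>\<^bsub>P\<^esub>} \<times> carrier M)"
proof -
  interpret T_section n T by unfold_locales fact
  have spec: "gen_iso (transpositions n)
      (specialise 1 (B_z n)) (\<lambda>\<tau>. specialise_proj 1 (B_z n) (nichols_gen n (q_z n) \<tau>))
      (B_plus n) (nichols_gen n (q_plus n))"
    "gen_iso (transpositions n)
      (specialise (-1) (B_z n)) (\<lambda>\<tau>. specialise_proj (-1) (B_z n) (nichols_gen n (q_z n) \<tau>))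
      (B_minus n) (nichols_gen n (q_minus n))"
    by (rule gen_iso_specialise; simp)+
  show ?thesis
    unfolding Let_def
    by (intro conjI mu_cocycles2 twist_minus_cocycles2 spec nichols_direct_sum
        twisting.gen_iso_cocycle_ext[OF twisting_plus] twisting.gen_iso_cocycle_ext[OF twisting_minus]
        ideal_direct_sum_idem[OF assoc_algebra_nichols(1)])
      (simp add: C2_flat_deformation_def free_module_B_z gen_iso_alg_iso[OF spec(1)] gen_iso_alg_iso[OF spec(2)])
qed

end
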